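(* Let $\mathcal{G}$ be a class of groups which is closed under taking finite-index normal subgroups. Let $\Gamma$ be a connected, locally finite graph of finite treewidth. Let a group $G$ act on $\Gamma$ such that the quotient graph $G\backslash\Gamma$ is finite and each vertex stabilizer $G_v=\{g\in G : gv=v\}$, $v\in V(\Gamma)$, is in $\mathcal{G}$. Then $G$ acts on the tree $T(\mathcal{C}_{\mathrm{opt}})$ (the structure tree of the optimal cuts of $\Gamma$, with the action induced from that on $\Gamma$) such that all vertex and edge stabilizers are virtually $\mathcal{G}$ and $G\backslash T(\mathcal{C}_{\mathrm{opt}})$ is finite.
   Context: Graphs are undirected, without loops and multiple edges. A group acts on a graph by graph automorphisms. A group is virtually $\mathcal{G}$ if it has a subgroup of finite index which is in $\mathcal{G}$. Treewidth. A tree decomposition of $\Gamma$ is a tree $T$ with a map $t\mapsto X_t\subseteq V(\Gamma)$, $t\in V(T)$, such that (T1) every vertex of $\Gamma$ lies in some $X_t$; (T2) for every edge $uv\in E(\Gamma)$ there is $t$ with $u,v\in X_t$; (T3) if $v\in X_t\cap X_s$ then $v\in X_r$ for all $r$ on the geodesic path in $T$ from $s$ to $t$. $\Gamma$ has finite treewidth if for some $k\in\mathbb{N}$ there is a tree decomposition with $|X_t|\le k+1$ for all $t$. Cuts. For $C\subseteq V(\Gamma)$ write $\overline{C}=V(\Gamma)\setminus C$ and $\delta C=\{uv\in E(\Gamma): u\in C, v\in\overline{C}\}$. A cut is a subset $C\subseteq V(\Gamma)$ such that $C$ and $\overline{C}$ are non-empty and induce connected subgraphs, and $\delta C$ is finite.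 A $k$-cut is a cut with $|\delta C|\le k$. Cuts $C,D$ are nested if one of $C\subseteq D$, $C\subseteq\overline{D}$, $\overline{C}\subseteq D$, $\overline{C}\subseteq\overline{D}$ holds. A bi-infinite simple path $\alpha$ is a sequence $(v_i)_{i\in\mathbb{Z}}$ of pairwise distinct vertices with $v_iv_{i+1}\in E(\Gamma)$; $\alpha\cap C$ denotes the set of its vertices in $C$. Put $\mathcal{C}(\alpha)=\{C : C \text{ is a cut and } |\alpha\cap C|=\infty=|\alpha\cap\overline{C}|\}$ and $\mathcal{C}_{\min}(\alpha)=\{C\in\mathcal{C}(\alpha): |\delta C| \text{ is minimal in } \mathcal{C}(\alpha)\}$. $\Gamma$ is accessible if there is $k\in\mathbb{N}$ such that for every bi-infinite simple path $\alpha$ either $\mathcal{C}(\alpha)=\emptyset$ or $\mathcal{C}(\alpha)$ contains a $k$-cut. (Under the hypotheses of the claim $\Gamma$ is accessible, so the following is defined.) Optimal cuts. For $\Gamma$ accessible, fix such a $k$. For a cut $C$ let $m(C)$ be the (finite) number of $k$-cuts $D$ that are not nested with $C$. For a bi-infinite simple path $\alpha$ with $\mathcal{C}(\alpha)\neq\emptyset$ let $m_\alpha=\min\{m(C): C\in\mathcal{C}_{\min}(\alpha)\}$ and $\mathcal{C}_{\mathrm{opt}}(\alpha)=\{C\in\mathcal{C}_{\min}(\alpha): m(C)=m_\alpha\}$ (and $\mathcal{C}_{\mathrm{opt}}(\alpha)=\emptyset$ if $\mathcal{C}(\alpha)=\emptyset$). Then $\mathcal{C}_{\mathrm{opt}}=\bigcup_\alpha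 \mathcal{C}_{\mathrm{opt}}(\alpha)$ over all bi-infinite simple paths $\alpha$; its elements are called optimal cuts. Structure tree. For $C,D\in\mathcal{C}_{\mathrm{opt}}$ let $C\sim D$ if either $C=D$, or both $\overline{C}\subsetneq D$ and for all $E\in\mathcal{C}_{\mathrm{opt}}$: $\overline{C}\subsetneq E\subseteq D$ implies $D=E$. This is an equivalence relation with classes $[C]$. $T(\mathcal{C}_{\mathrm{opt}})$ is the undirected graph with vertex set $\{[C]: C\in\mathcal{C}_{\mathrm{opt}}\}$ and edges $(C,\overline{C})$, $C\in\mathcal{C}_{\mathrm{opt}}$, where $(C,\overline{C})$ goes from $[C]$ to $[\overline{C}]$ and its inverse edge is $(\overline{C},C)$. It is a tree. (A graph is connected if any two of its vertices have finite distance, and a tree is a connected graph without cycles; the empty graph is allowed, which occurs when $\mathcal{C}_{\mathrm{opt}}=\emptyset$.) An action on $\Gamma$ induces an action on $\mathcal{C}_{\mathrm{opt}}$ by $C\mapsto gC$ and on $T(\mathcal{C}_{\mathrm{opt}})$ by $[C]\mapsto[gC]$. *)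

theory Defs
  imports
    "HOL-Algebra.Group_Action"
    "Graph_Theory.Digraph_Component"
begin

section \<open>Graphs\<close>

text \<open>
  An undirected graph is represented by a symmetric digraph: an edge is a pair of mutually inverse
  arcs. Simple undirected graphs (no loops, no multiple edges, possibly infinite) are the
  \<^typ>\<open>'v pair_pre_digraph\<close>s satisfying \<^const>\<open>pair_bidirected_digraph\<close>, with arcs being pairs of
  vertices. Undirected multigraphs with explicit inverse edges are the \<^const>\<open>bidirected_digraph\<close>s.

  The library's \<open>connected\<close> excludes the empty graph and its \<open>tree\<close> regards an arc followed by its
  inverse as a cycle, hence the following versions for undirected graphs, where the empty graph
  is connected.
\<close>

definition connected_graph :: "('a, 'b) pre_digraph \<Rightarrow> bool" where
  "connected_graph \<Gamma> \<longleftrightarrow> (\<forall>u\<in>verts \<Gamma>. \<forall>v\<in>verts \<Gamma>. u \<rightarrow>\<^sup>*\<^bsub>\<Gamma>\<^esub> v)"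

definition undirected_tree :: "('a, 'b) pre_digraph \<Rightarrow> ('b \<Rightarrow> 'b) \<Rightarrow> bool" where
  "undirected_tree T arev \<longleftrightarrow>
     bidirected_digraph T arev \<and> connected_graph T \<and>
     (\<forall>p. pre_digraph.cycle T p \<longrightarrow> (\<exists>e. p = [e, arev e]))"

definition locally_finite :: "('a, 'b) pre_digraph \<Rightarrow> bool" where
  "locally_finite \<Gamma> \<longleftrightarrow> (\<forall>v\<in>verts \<Gamma>. finite (out_arcs \<Gamma> v))"


section \<open>Treewidth\<close>

text \<open>
  In the third condition, \<open>p\<close> is the path from \<open>s\<close> to \<open>t\<close> without repeated vertices; it is unique
  because \<open>T\<close> is a tree, so it is the geodesic.
\<close>

definition tree_decomposition ::
    "'v pair_pre_digraph \<Rightarrow> 't pair_pre_digraph \<Rightarrow> ('t \<Rightarrow> 'v set) \<Rightarrow> bool" where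
  "tree_decomposition \<Gamma> T X \<longleftrightarrow>
     undirected_tree (with_proj T) (swap_in (parcs T)) \<and>
     (\<forall>t\<in>pverts T. X t \<subseteq> pverts \<Gamma>) \<and>
     (\<forall>v\<in>pverts \<Gamma>. \<exists>t\<in>pverts T. v \<in> X t) \<and>
     (\<forall>(u, v)\<in>parcs \<Gamma>. \<exists>t\<in>pverts T. u \<in> X t \<and> v \<in> X t) \<and>
     (\<forall>s\<in>pverts T. \<forall>t\<in>pverts T. \<forall>v\<in>X s \<inter> X t. \<forall>p.
        pre_digraph.apath (with_proj T) s p t \<longrightarrow>
        (\<forall>r\<in>set (pre_digraph.awalk_verts (with_proj T) s p). v \<in> X r))"

text \<open>
  HOL cannot quantify over types inside a definition, so the type \<open>'t\<close> of nodes of the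
  decomposition tree is a parameter. With \<open>'t\<close> a free type variable in an assumption of a theorem,
  the theorem applies to tree decompositions over arbitrary node types.
\<close>

definition finite_treewidth :: "'t itself \<Rightarrow> 'v pair_pre_digraph \<Rightarrow> bool" where
  "finite_treewidth (_ :: 't itself) \<Gamma> \<longleftrightarrow>
     (\<exists>k::nat. \<exists>(T :: 't pair_pre_digraph) X. tree_decomposition \<Gamma> T X \<and>
        (\<forall>t\<in>pverts T. finite (X t) \<and> card (X t) \<le> k + 1))"


section \<open>Cuts\<close>

text \<open>
  Each undirected edge joining \<open>C\<close> to its complement contributes exactly one arc to \<open>boundary \<Gamma> C\<close>,
  namely the one oriented from \<open>C\<close> to the complement.
\<close>

definition boundary :: "'v pair_pre_digraph \<Rightarrow> 'v set \<Rightarrow> ('v \<times> 'v) set" where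
  "boundary \<Gamma> C = {(u, v) \<in> parcs \<Gamma>. u \<in> C \<and> v \<in> pverts \<Gamma> - C}"

definition is_cut :: "'v pair_pre_digraph \<Rightarrow> 'v set \<Rightarrow> bool" where
  "is_cut \<Gamma> C \<longleftrightarrow>
     C \<subseteq> pverts \<Gamma> \<and> C \<noteq> {} \<and> pverts \<Gamma> - C \<noteq> {} \<and>
     connected_graph (with_proj \<Gamma> \<restriction> C) \<and> connected_graph (with_proj \<Gamma> \<restriction> (pverts \<Gamma> - C)) \<and>
     finite (boundary \<Gamma> C)"

definition is_k_cut :: "'v pair_pre_digraph \<Rightarrow> nat \<Rightarrow> 'v set \<Rightarrow> bool" where
  "is_k_cut \<Gamma> k C \<longleftrightarrow> is_cut \<Gamma> C \<and> card (boundary \<Gamma> C) \<le> k"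

definition nested :: "'v pair_pre_digraph \<Rightarrow> 'v set \<Rightarrow> 'v set \<Rightarrow> bool" where
  "nested \<Gamma> C D \<longleftrightarrow>
     C \<subseteq> D \<or> C \<subseteq> pverts \<Gamma> - D \<or> pverts \<Gamma> - C \<subseteq> D \<or> pverts \<Gamma> - C \<subseteq> pverts \<Gamma> - D"

definition biinfinite_path :: "'v pair_pre_digraph \<Rightarrow> (int \<Rightarrow> 'v) \<Rightarrow> bool" where
  "biinfinite_path \<Gamma> \<alpha> \<longleftrightarrow> inj \<alpha> \<and> (\<forall>i. (\<alpha> i, \<alpha> (i + 1)) \<in> parcs \<Gamma>)"

definition cuts_splitting :: "'v pair_pre_digraph \<Rightarrow> (int \<Rightarrow> 'v) \<Rightarrow> 'v set set" where
  "cuts_splitting \<Gamma> \<alpha> =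
     {C. is_cut \<Gamma> C \<and> infinite (range \<alpha> \<inter> C) \<and> infinite (range \<alpha> \<inter> (pverts \<Gamma> - C))}"

definition min_cuts_splitting :: "'v pair_pre_digraph \<Rightarrow> (int \<Rightarrow> 'v) \<Rightarrow> 'v set set" where
  "min_cuts_splitting \<Gamma> \<alpha> =
     {C. is_arg_min (\<lambda>C. card (boundary \<Gamma> C)) (\<lambda>C. C \<in> cuts_splitting \<Gamma> \<alpha>) C}"

definition accessible_bound :: "'v pair_pre_digraph \<Rightarrow> nat \<Rightarrow> bool" where
  "accessible_bound \<Gamma> k \<longleftrightarrow>
     (\<forall>\<alpha>. biinfinite_path \<Gamma> \<alpha> \<longrightarrow>
        cuts_splitting \<Gamma> \<alpha> = {} \<or> (\<exists>C\<in>cuts_splitting \<Gamma> \<alpha>. is_k_cut \<Gamma> k C))"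

definition accessible :: "'v pair_pre_digraph \<Rightarrow> bool" where
  "accessible \<Gamma> \<longleftrightarrow> (\<exists>k. accessible_bound \<Gamma> k)"


section \<open>Optimal cuts and their structure tree\<close>

text \<open>
  The set counted here is finite if \<open>\<Gamma>\<close> is connected and locally finite and \<open>C\<close> is a cut, so the
  convention that infinite sets have cardinality \<open>0\<close> plays no role.
\<close>

definition crossing_number :: "'v pair_pre_digraph \<Rightarrow> nat \<Rightarrow> 'v set \<Rightarrow> nat" where
  "crossing_number \<Gamma> k C = card {D. is_k_cut \<Gamma> k D \<and> \<not> nested \<Gamma> C D}"

definition opt_cuts_splitting :: "'v pair_pre_digraph \<Rightarrow> nat \<Rightarrow> (int \<Rightarrow> 'v) \<Rightarrow> 'v set set" where
  "opt_cuts_splitting \<Gamma> k \<alpha> =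
     {C. is_arg_min (crossing_number \<Gamma> k) (\<lambda>C. C \<in> min_cuts_splitting \<Gamma> \<alpha>) C}"

definition opt_cuts :: "'v pair_pre_digraph \<Rightarrow> nat \<Rightarrow> 'v set set" where
  "opt_cuts \<Gamma> k = (\<Union>\<alpha>\<in>{\<alpha>. biinfinite_path \<Gamma> \<alpha>}. opt_cuts_splitting \<Gamma> k \<alpha>)"

definition cut_rel :: "'v pair_pre_digraph \<Rightarrow> nat \<Rightarrow> ('v set \<times> 'v set) set" where
  "cut_rel \<Gamma> k =
     {(C, D) \<in> opt_cuts \<Gamma> k \<times> opt_cuts \<Gamma> k.
        C = D \<or>
        (pverts \<Gamma> - C \<subset> D \<and>
         (\<forall>E\<in>opt_cuts \<Gamma> k. pverts \<Gamma> - C \<subset> E \<and> E \<subseteq> D \<longrightarrow> D = E))}"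

definition cut_class :: "'v pair_pre_digraph \<Rightarrow> nat \<Rightarrow> 'v set \<Rightarrow> 'v set set" where
  "cut_class \<Gamma> k C = cut_rel \<Gamma> k `` {C}"

text \<open>
  The arc from \<open>[C]\<close> to the class of the complement of \<open>C\<close>, that is the pair of \<open>C\<close> and its
  complement, is represented by \<open>C\<close>.
\<close>

definition structure_tree :: "'v pair_pre_digraph \<Rightarrow> nat \<Rightarrow> ('v set set, 'v set) pre_digraph" where
  "structure_tree \<Gamma> k =
     \<lparr>verts = opt_cuts \<Gamma> k // cut_rel \<Gamma> k,
      arcs = opt_cuts \<Gamma> k,
      tail = cut_class \<Gamma> k,
      head = (\<lambda>C. cut_class \<Gamma> k (pverts \<Gamma> - C))\<rparr>"

text \<open>\<^const>\<open>bidirected_digraph\<close> demands that the inversion fixes everything that is not an arc.\<close>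

definition structure_tree_rev :: "'v pair_pre_digraph \<Rightarrow> nat \<Rightarrow> 'v set \<Rightarrow> 'v set" where
  "structure_tree_rev \<Gamma> k C = (if C \<in> opt_cuts \<Gamma> k then pverts \<Gamma> - C else C)"


section \<open>Group actions on graphs\<close>

text \<open>
  \<open>\<phi>\<close> is the action on vertices and \<open>\<psi>\<close> the action on arcs. For a simple graph the action on arcs is
  the one determined by \<open>\<phi>\<close>, so that \<open>acts_on_simple_graph\<close> says that \<open>\<phi>\<close> is an action
  by graph automorphisms.
\<close>

definition acts_on_graph ::
    "'g monoid \<Rightarrow> ('a, 'b) pre_digraph \<Rightarrow> ('b \<Rightarrow> 'b) \<Rightarrow> ('g \<Rightarrow> 'a \<Rightarrow> 'a) \<Rightarrow> ('g \<Rightarrow> 'b \<Rightarrow> 'b) \<Rightarrow> bool" where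
  "acts_on_graph G \<Gamma> arev \<phi> \<psi> \<longleftrightarrow>
     group_action G (verts \<Gamma>) \<phi> \<and> group_action G (arcs \<Gamma>) \<psi> \<and>
     (\<forall>g\<in>carrier G. \<forall>e\<in>arcs \<Gamma>.
        tail \<Gamma> (\<psi> g e) = \<phi> g (tail \<Gamma> e) \<and>
        head \<Gamma> (\<psi> g e) = \<phi> g (head \<Gamma> e) \<and>
        \<psi> g (arev e) = arev (\<psi> g e))"

definition induced_arc_action :: "'v pair_pre_digraph \<Rightarrow> ('g \<Rightarrow> 'v \<Rightarrow> 'v) \<Rightarrow> 'g \<Rightarrow> 'v \<times> 'v \<Rightarrow> 'v \<times> 'v" where
  "induced_arc_action \<Gamma> \<phi> g = restrict (map_prod (\<phi> g) (\<phi> g)) (parcs \<Gamma>)"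

definition acts_on_simple_graph :: "'g monoid \<Rightarrow> 'v pair_pre_digraph \<Rightarrow> ('g \<Rightarrow> 'v \<Rightarrow> 'v) \<Rightarrow> bool" where
  "acts_on_simple_graph G \<Gamma> \<phi> \<longleftrightarrow>
     acts_on_graph G (with_proj \<Gamma>) (swap_in (parcs \<Gamma>)) \<phi> (induced_arc_action \<Gamma> \<phi>)"

text \<open>The vertices and arcs of the quotient graph are the orbits of vertices and of arcs.\<close>

definition finite_quotient ::
    "'g monoid \<Rightarrow> ('a, 'b) pre_digraph \<Rightarrow> ('g \<Rightarrow> 'a \<Rightarrow> 'a) \<Rightarrow> ('g \<Rightarrow> 'b \<Rightarrow> 'b) \<Rightarrow> bool" where
  "finite_quotient G \<Gamma> \<phi> \<psi> \<longleftrightarrow>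
     finite (orbits G (verts \<Gamma>) \<phi>) \<and> finite (orbits G (arcs \<Gamma>) \<psi>)"

definition cut_action ::
    "'v pair_pre_digraph \<Rightarrow> nat \<Rightarrow> ('g \<Rightarrow> 'v \<Rightarrow> 'v) \<Rightarrow> 'g \<Rightarrow> 'v set \<Rightarrow> 'v set" where
  "cut_action \<Gamma> k \<phi> g = (\<lambda>C\<in>opt_cuts \<Gamma> k. \<phi> g ` C)"

text \<open>
  The union is over sets that all coincide once \<open>[C]\<close> is known to determine \<open>[gC]\<close>. Restriction to
  the carrier is required by \<^const>\<open>group_action\<close>.
\<close>

definition cut_class_action ::
    "'v pair_pre_digraph \<Rightarrow> nat \<Rightarrow> ('g \<Rightarrow> 'v \<Rightarrow> 'v) \<Rightarrow> 'g \<Rightarrow> 'v set set \<Rightarrow> 'v set set" where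
  "cut_class_action \<Gamma> k \<phi> g =
     (\<lambda>X\<in>opt_cuts \<Gamma> k // cut_rel \<Gamma> k. \<Union>C\<in>X. cut_class \<Gamma> k (\<phi> g ` C))"


section \<open>Classes of groups\<close>

text \<open>
  A class of groups is rendered as a set of groups with elements in the type \<open>'g\<close> of elements of the
  acting group; only subgroups of the latter matter. No closure under isomorphism is required.
\<close>

definition closed_under_finite_index_normal :: "'g monoid set \<Rightarrow> bool" where
  "closed_under_finite_index_normal \<G> \<longleftrightarrow>
     (\<forall>H\<in>\<G>. \<forall>N. N \<lhd> H \<and> finite (rcosets\<^bsub>H\<^esub> N) \<longrightarrow> H\<lparr>carrier := N\<rparr> \<in> \<G>)"

definition virtually :: "'g monoid set \<Rightarrow> 'g monoid \<Rightarrow> bool" where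
  "virtually \<G> H \<longleftrightarrow>
     (\<exists>K. subgroup K H \<and> finite (rcosets\<^bsub>H\<^esub> K) \<and> H\<lparr>carrier := K\<rparr> \<in> \<G>)"

end

theory Submission
  imports Defs
begin

text \<open>
  Following a tree decomposition towards a ray, the sets of vertices beyond its successive nodes are
  bounded by at most one bag each and eventually leave every finite set. As degrees are bounded, a
  ray is therefore separated from any finite connected set by a cut of bounded size; this yields
  accessibility. Two optimal cuts that cross could be replaced by opposite corners, which have no
  larger boundaries and in total fewer crossings; hence optimal cuts are nested and form the edges
  of a tree. Only finitely many cuts of bounded size pass through a given edge of \<open>\<Gamma>\<close>, so there are
  finitely many orbits of optimal cuts, and the stabilizer of a cut has a finite orbit on \<open>\<Gamma>\<close>,
  namely on the ends of its boundary.

  The stabilizer of a vertex \<open>[C]\<close> acts cofinitely on a connected block of \<open>\<Gamma>\<close>, a neighbourhood of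
  \<open>\<Inter>[C]\<close>. If the block were infinite, it would contain a bi-infinite geodesic. Since there are
  only finitely many orbits of cuts of bounded size, their boundaries have bounded diameter, so a
  cut of bounded size that separates a large ball around a vertex of the geodesic from one of its
  tails must split it. But a path in a block is not split by any cut. So blocks are finite.
\<close>

section \<open>Connectivity\<close>

text \<open>Treewidth enters only through \<open>rays_separated\<close>, whose constant is a bag
  size times the maximal degree; the degrees are bounded because the action is cofinite. That
  constant serves for accessibility and again for the blocks, whereas the parameter of the optimal
  cuts may be any accessibility bound. A cut in a class \<open>X\<close> is oriented so as to
  contain the part of \<Gamma> that belongs to the vertex \<open>X\<close>: distinct members have
  disjoint complements, and \<open>\<Inter>X\<close> is what remains. This intersection is not shown
  to be connected, hence the thickened boundaries in the block. To pass from finite orbits to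
  stabilizers, a subgroup is wanted that is normal of finite index in a vertex stabilizer. The
  pointwise stabilizer of a ball around \<open>v\<close> is one, because everything fixing
  \<open>v\<close> maps the ball to itself. A large ball contains the ends of a boundary, so its
  pointwise stabilizer fixes the cut and lies in the stabilizer of the cut or class; there it has
  finite index, since \<open>v\<close> has a finite orbit.\<close>

definition conn :: "'v rel \<Rightarrow> 'v set \<Rightarrow> bool" where
  "conn E C \<longleftrightarrow> (\<forall>x\<in>C. \<forall>y\<in>C. (x, y) \<in> (E \<inter> C \<times> C)\<^sup>*)"

definition bd :: "'v rel \<Rightarrow> 'v set \<Rightarrow> 'v rel" where
  "bd E C = {(u, v) \<in> E. u \<in> C \<and> v \<notin> C}"

definition comp :: "'v rel \<Rightarrow> 'v set \<Rightarrow> 'v \<Rightarrow> 'v set" where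
  "comp E U x = {y \<in> U. (x, y) \<in> (E \<inter> U \<times> U)\<^sup>*}"

lemma bd_iff: "(u, v) \<in> bd E C \<longleftrightarrow> (u, v) \<in> E \<and> u \<in> C \<and> v \<notin> C"
  by (auto simp: bd_def)

lemma rtrancl_crossing:
  assumes "(x, y) \<in> R\<^sup>*" "x \<in> C" "y \<notin> C"
  shows "\<exists>a b. (a, b) \<in> R \<and> a \<in> C \<and> b \<notin> C"
  using assms by (induction rule: rtrancl_induct) blast+

lemma conn_crossing:
  assumes "conn E A" "x \<in> A \<inter> C" "y \<in> A - C"
  shows "\<exists>a b. (a, b) \<in> E \<and> a \<in> A \<inter> C \<and> b \<in> A - C"
  using rtrancl_crossing[of x y "E \<inter> A \<times> A" C] assms unfolding conn_def by blast

text \<open>Every set that contains \<open>x\<close> but not \<open>y\<close> is left by one of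
  these finitely many edges. Several finiteness results about cuts rest on this.\<close>

lemma rtrancl_finite_subrel:
  assumes "(x, y) \<in> R\<^sup>*"
  shows "\<exists>P. finite P \<and> P \<subseteq> R \<and> (x, y) \<in> P\<^sup>*"
  using assms
proof (induction rule: rtrancl_induct)
  case base
  show ?case by (rule exI[of _ "{}"]) auto
next
  case (step y z)
  then obtain P where P: "finite P" "P \<subseteq> R" "(x, y) \<in> P\<^sup>*" by blast
  have "(x, y) \<in> (insert (y, z) P)\<^sup>*" using P(3) rtrancl_mono[of P "insert (y, z) P"] by blast
  then have "(x, z) \<in> (insert (y, z) P)\<^sup>*" by (meson insertI1 rtrancl.rtrancl_into_rtrancl)
  with P step show ?case by (intro exI[of _ "insert (y, z) P"]) auto
qed

lemma sym_Restr: "sym E \<Longrightarrow> sym (E \<inter> C \<times> C)"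
  by (auto simp: sym_def)

lemma comp_subset: "comp E U x \<subseteq> U"
  by (auto simp: comp_def)

lemma self_in_comp: "x \<in> U \<Longrightarrow> x \<in> comp E U x"
  by (auto simp: comp_def)

lemma comp_step:
  assumes "a \<in> comp E U x" "(a, b) \<in> E" "b \<in> U"
  shows "b \<in> comp E U x"
  using assms unfolding comp_def by (auto intro: rtrancl.rtrancl_into_rtrancl)

lemma conn_if_reach:
  assumes "sym E" "\<And>x. x \<in> C \<Longrightarrow> (x, a) \<in> (E \<inter> C \<times> C)\<^sup>*"
  shows "conn E C"
  unfolding conn_def
proof (intro ballI)
  fix x y assume "x \<in> C" "y \<in> C"
  moreover have "sym ((E \<inter> C \<times> C)\<^sup>*)" by (intro sym_rtrancl sym_Restr assms)
  ultimately show "(x, y) \<in> (E \<inter> C \<times> C)\<^sup>*"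
    using assms(2)[of x] symD[OF _ assms(2)[of y]] rtrancl_trans[of x a _ y] by simp
qed

lemma conn_comp:
  assumes "sym E" "x \<in> U"
  shows "conn E (comp E U x)"
proof -
  have *: "(x, y) \<in> (E \<inter> comp E U x \<times> comp E U x)\<^sup>*" if "(x, y) \<in> (E \<inter> U \<times> U)\<^sup>*" for y
    using that
  proof (induction rule: rtrancl_induct)
    case (step y z)
    then have "(y, z) \<in> E \<inter> comp E U x \<times> comp E U x"
      by (auto simp: comp_def intro: rtrancl.rtrancl_into_rtrancl)
    with step show ?case by (meson rtrancl.rtrancl_into_rtrancl)
  qed simp
  have "sym ((E \<inter> comp E U x \<times> comp E U x)\<^sup>*)" by (intro sym_rtrancl sym_Restr assms)
  then show ?thesis using conn_if_reach[OF assms(1), of "comp E U x" x] * symD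
    unfolding comp_def by fastforce
qed

lemma comp_connected_subset:
  assumes "conn E A" "A \<subseteq> U" "a \<in> A" "a \<in> comp E U x"
  shows "A \<subseteq> comp E U x"
proof
  fix b assume "b \<in> A"
  then have "(a, b) \<in> (E \<inter> A \<times> A)\<^sup>*" using assms by (auto simp: conn_def)
  then have "(a, b) \<in> (E \<inter> U \<times> U)\<^sup>*" using rtrancl_mono[of "E \<inter> A \<times> A" "E \<inter> U \<times> U"] assms(2) by blast
  with assms \<open>b \<in> A\<close> show "b \<in> comp E U x" by (auto simp: comp_def intro: rtrancl_trans)
qed

text \<open>Replacing \<open>A\<close> by the complement of a component of its complement makes both sides connected
  without enlarging the boundary.\<close>

lemma conn_Diff_comp:
  assumes "sym E" "E \<subseteq> V \<times> V" "conn E V" "conn E A" "A \<subseteq> V" "A \<noteq> {}" "y \<in> V - A"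
  shows "conn E (V - comp E (V - A) y)"
proof -
  define D where "D = comp E (V - A) y"
  have DV: "D \<subseteq> V - A" unfolding D_def by (rule comp_subset)
  have *: "\<exists>a'\<in>A. (z, a') \<in> (E \<inter> (V - D) \<times> (V - D))\<^sup>*"
    if "(z, a) \<in> E\<^sup>*" "a \<in> A" "z \<in> V" "z \<notin> D" for z a
    using that
  proof (induction rule: converse_rtrancl_induct)
    case base then show ?case by blast
  next
    case (step z z')
    show ?case
    proof (cases "z \<in> A")
      case False
      have z': "z' \<in> V" using step assms by blast
      have "z' \<notin> D" using comp_step[of z' E "V - A" y z] step False symD[OF assms(1)]
        unfolding D_def by blast
      then obtain a' where "a' \<in> A" "(z', a') \<in> (E \<inter> (V - D) \<times> (V - D))\<^sup>*"
        using step z' by blast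
      moreover have "(z, z') \<in> E \<inter> (V - D) \<times> (V - D)" using step z' \<open>z' \<notin> D\<close> by blast
      ultimately show ?thesis by (meson converse_rtrancl_into_rtrancl)
    qed (use step in blast)
  qed
  obtain a where a: "a \<in> A" using assms by blast
  have reach: "(z, a) \<in> (E \<inter> (V - D) \<times> (V - D))\<^sup>*" if z: "z \<in> V - D" for z
  proof -
    have "(z, a) \<in> (E \<inter> V \<times> V)\<^sup>*" using assms(3,5) a z by (auto simp: conn_def)
    then have "(z, a) \<in> E\<^sup>*" by (rule rtrancl_mono[THEN subsetD, rotated]) blast
    then obtain a' where a': "a' \<in> A" "(z, a') \<in> (E \<inter> (V - D) \<times> (V - D))\<^sup>*"
      using *[OF _ a] z by auto
    have "(a', a) \<in> (E \<inter> A \<times> A)\<^sup>*" using assms(4) a a' by (auto simp: conn_def)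
    then have "(a', a) \<in> (E \<inter> (V - D) \<times> (V - D))\<^sup>*"
      using rtrancl_mono[of "E \<inter> A \<times> A" "E \<inter> (V - D) \<times> (V - D)"] DV assms(5) by blast
    with a' show ?thesis by (meson rtrancl_trans)
  qed
  then show ?thesis unfolding D_def[symmetric] by (rule conn_if_reach[OF assms(1)])
qed

lemma bd_comp_Diff_subset:
  assumes "sym E" "E \<subseteq> V \<times> V" "A \<subseteq> V"
  shows "bd E (V - comp E (V - A) y) \<subseteq> bd E A"
proof (rule subrelI, unfold bd_iff)
  fix u v assume *: "(u, v) \<in> E \<and> u \<in> V - comp E (V - A) y \<and> v \<notin> V - comp E (V - A) y"
  then have v: "v \<in> comp E (V - A) y" using assms by blast
  then have "v \<notin> A" using comp_subset[of E "V - A" y] by blast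
  moreover have "u \<in> A" using comp_step[OF v, of u] * symD[OF assms(1)] by blast
  ultimately show "(u, v) \<in> E \<and> u \<in> A \<and> v \<notin> A" using * by blast
qed

lemma bd_comp_subset: "bd E (comp E U x) \<subseteq> bd E U"
  using comp_step comp_subset by (fastforce simp: bd_iff)

lemma bd_compl:
  assumes "sym E" "E \<subseteq> V \<times> V" "A \<subseteq> V"
  shows "bd E (V - A) = (bd E A)\<inverse>"
  using assms by (auto simp: bd_def sym_def)

section \<open>Cuts through an edge\<close>

definition cut :: "'v set \<Rightarrow> 'v rel \<Rightarrow> 'v set \<Rightarrow> bool" where
  "cut V E C \<longleftrightarrow> C \<subseteq> V \<and> C \<noteq> {} \<and> V - C \<noteq> {} \<and> conn E C \<and> conn E (V - C) \<and> finite (bd E C)"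

text \<open>The component \<open>D\<close> of \<open>y\<close> is connected, and so is its
  complement, since all other components of \<open>V - A\<close> hang on the connected set
  \<open>A\<close>. Neither step creates boundary edges, so any set with finite boundary yields a
  cut with no larger boundary.\<close>

lemma cut_off_component:
  assumes E: "sym E" "E \<subseteq> V \<times> V" "conn E V" and U: "U \<subseteq> V" "finite (bd E U)"
    and x: "x \<in> U" and y: "y \<in> V - U"
  defines "A \<equiv> comp E U x"
  defines "D \<equiv> comp E (V - A) y"
  shows "cut V E D" "cut V E (V - D)" "bd E (V - D) \<subseteq> bd E U" "A \<subseteq> V - D"
proof -
  have AU: "A \<subseteq> U" and DV: "D \<subseteq> V - A" by (simp_all add: A_def D_def comp_subset)
  have xA: "x \<in> A" using x by (simp add: A_def self_in_comp)
  have y': "y \<in> V - A" using y AU by blast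
  then have yD: "y \<in> D" by (simp add: D_def self_in_comp)
  have AV: "A \<subseteq> V" using AU U by blast
  then show AD: "A \<subseteq> V - D" using DV by blast
  have "conn E A" unfolding A_def using E(1) x by (rule conn_comp)
  then have con: "conn E D" "conn E (V - D)"
    using conn_comp[OF E(1) y'] conn_Diff_comp[OF E _ AV _ y'] xA unfolding D_def by blast+
  have "bd E (V - D) \<subseteq> bd E A" unfolding D_def by (rule bd_comp_Diff_subset[OF E(1,2) AV])
  also have "\<dots> \<subseteq> bd E U" unfolding A_def by (rule bd_comp_subset)
  finally show sub: "bd E (V - D) \<subseteq> bd E U" .
  have VD: "V - (V - D) = D" using DV by blast
  have fin: "finite (bd E (V - D))" using sub U(2) by (rule finite_subset)
  then have "finite (bd E D)" using bd_compl[OF E(1,2), of "V - D"] VD by simp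
  then show "cut V E D" "cut V E (V - D)"
    using fin con DV VD xA AD yD by (auto simp: cut_def)
qed

lemma ray_in_comp:
  assumes "\<And>i. i \<ge> n \<Longrightarrow> \<beta> i \<in> U" "\<And>i :: nat. (\<beta> i, \<beta> (Suc i)) \<in> E" "i \<ge> n"
  shows "\<beta> i \<in> comp E U (\<beta> n)"
  using assms(3)
proof (induction i rule: dec_induct)
  case base
  show ?case using assms(1) by (simp add: self_in_comp)
next
  case (step i)
  show ?case using comp_step[OF step.IH assms(2)] assms(1) step by simp
qed

text \<open>Used for the relation left after deletion of an edge, which may be disconnected; a cut
  with empty boundary is then one of its components.\<close>

lemma cut_eq_comp:
  assumes "sym E" "cut V E C" "u \<in> C" "bd E C = {}"
  shows "C = {x. (u, x) \<in> E\<^sup>*}"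
proof
  show "C \<subseteq> {x. (u, x) \<in> E\<^sup>*}"
    using assms rtrancl_mono[of "E \<inter> C \<times> C" E] unfolding cut_def conn_def by blast
  show "{x. (u, x) \<in> E\<^sup>*} \<subseteq> C"
  proof clarify
    fix x assume "(u, x) \<in> E\<^sup>*"
    then show "x \<in> C" using rtrancl_crossing[of u x E C] assms(3,4) by (auto simp: bd_def)
  qed
qed

text \<open>Deleting the edge lowers the boundary of the cuts through it. If its ends remain joined by a
  path, each of these cuts passes through one of the finitely many edges of the path; otherwise the
  cut is a component of what remains.\<close>

lemma finite_cuts_through_edge:
  assumes "sym E" "E \<subseteq> V \<times> V" "conn E V"
  shows "finite {C. cut V E C \<and> card (bd E C) \<le> k \<and> (u, v) \<in> bd E C}"
  using assms
proof (induction k arbitrary: E u v)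
  case 0
  have "{C. cut V E C \<and> card (bd E C) \<le> 0 \<and> (u, v) \<in> bd E C} = {}"
    by (auto simp: cut_def)
  then show ?case by (metis finite.emptyI)
next
  case (Suc k)
  define F where "F = E - {(u, v), (v, u)}"
  have F: "sym F" "F \<subseteq> V \<times> V" using Suc.prems by (auto simp: F_def sym_def)
  have cutF: "cut V F C" "bd F C = bd E C - {(u, v)}" if C: "cut V E C" "(u, v) \<in> bd E C" for C
  proof -
    \<comment> \<open>The deleted edge joins the two sides, so connectedness within either side is
      not affected.\<close>
    have "F \<inter> C \<times> C = E \<inter> C \<times> C" "F \<inter> (V - C) \<times> (V - C) = E \<inter> (V - C) \<times> (V - C)"
      using C by (auto simp: F_def bd_def)
    moreover show "bd F C = bd E C - {(u, v)}" using C by (auto simp: F_def bd_def)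
    ultimately show "cut V F C" using C by (simp add: cut_def conn_def)
  qed
  show ?case
  proof (cases "(u, v) \<in> F\<^sup>*")
    case False
    have "C = {x. (u, x) \<in> F\<^sup>*}" if C: "cut V E C" "(u, v) \<in> bd E C" for C
    proof -
      have uC: "u \<in> C" and vC: "v \<in> V - C" using C Suc.prems by (auto simp: bd_def)
      \<comment> \<open>A remaining edge from \<open>C\<close> to its complement would complete a
        path from \<open>u\<close> to \<open>v\<close> in \<open>F\<close>, as both sides are still
        connected.\<close>
      have "bd F C = {}"
      proof (rule ccontr)
        assume "bd F C \<noteq> {}"
        then obtain a b where ab: "(a, b) \<in> F" "a \<in> C" "b \<notin> C" by (auto simp: bd_def)
        have "(u, a) \<in> (F \<inter> C \<times> C)\<^sup>*" "(b, v) \<in> (F \<inter> (V - C) \<times> (V - C))\<^sup>*"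
          using cutF(1)[OF C] uC vC ab F(2) by (auto simp: cut_def conn_def)
        then have "(u, a) \<in> F\<^sup>*" "(b, v) \<in> F\<^sup>*" using rtrancl_mono[of _ F] by blast+
        with ab False show False by (meson rtrancl.rtrancl_into_rtrancl rtrancl_trans)
      qed
      with cut_eq_comp[OF F(1) cutF(1)[OF C] uC] show ?thesis by simp
    qed
    then have "{C. cut V E C \<and> card (bd E C) \<le> Suc k \<and> (u, v) \<in> bd E C} \<subseteq> {{x. (u, x) \<in> F\<^sup>*}}"
      by blast
    then show ?thesis by (meson finite.emptyI finite.insertI finite_subset)
  next
    case True
    then have True': "(v, u) \<in> F\<^sup>*" using sym_rtrancl[OF F(1)] by (auto dest: symD)
    have "E \<subseteq> F\<^sup>*" using True True' by (auto simp: F_def)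
    have FV: "F \<inter> V \<times> V = F" "E \<inter> V \<times> V = E" using F Suc.prems by auto
    have "E\<^sup>* \<subseteq> F\<^sup>*" using rtrancl_subset_rtrancl[OF \<open>E \<subseteq> F\<^sup>*\<close>] .
    then have "conn F V" using Suc.prems(3) FV by (auto simp: conn_def)
    obtain P where P: "finite P" "P \<subseteq> F" "(u, v) \<in> P\<^sup>*" using rtrancl_finite_subrel[OF True] by blast
    have "{C. cut V E C \<and> card (bd E C) \<le> Suc k \<and> (u, v) \<in> bd E C} \<subseteq>
      (\<Union>p\<in>P. {C. cut V F C \<and> card (bd F C) \<le> k \<and> (fst p, snd p) \<in> bd F C})"
    proof (clarify, unfold UN_iff mem_Collect_eq)
      fix C assume C: "cut V E C" "(u, v) \<in> bd E C" and card: "card (bd E C) \<le> Suc k"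
      obtain a b where "(a, b) \<in> P" "a \<in> C" "b \<notin> C"
        using rtrancl_crossing[OF P(3), of C] C by (auto simp: bd_def)
      moreover have "card (bd F C) \<le> k"
        using C card cutF(2)[OF C] by (auto simp: cut_def card_Diff_singleton_if)
      ultimately show "\<exists>p\<in>P. cut V F C \<and> card (bd F C) \<le> k \<and> (fst p, snd p) \<in> bd F C"
        using cutF(1)[OF C] P(2) by (intro bexI[of _ "(a, b)"]) (auto simp: bd_def)
    qed
    moreover have "finite \<dots>" using Suc.IH[OF F \<open>conn F V\<close>] P(1) by blast
    ultimately show ?thesis by (meson finite_subset)
  qed
qed

section \<open>Separating finite sets from rays by small cuts\<close>

text \<open>Absence of cycles becomes the statement that every edge is a bridge: a path joining the
  ends of an edge without using it would close up to a cycle.\<close>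

lemma undirected_tree_rel:
  assumes T: "undirected_tree (with_proj T) (swap_in (parcs T))"
  shows "parcs T \<subseteq> pverts T \<times> pverts T" "sym (parcs T)"
    and "\<And>s t. s \<in> pverts T \<Longrightarrow> t \<in> pverts T \<Longrightarrow> (s, t) \<in> (parcs T)\<^sup>*"
    and "\<And>s t. (s, t) \<in> parcs T \<Longrightarrow> (s, t) \<notin> (parcs T - {(s, t), (t, s)})\<^sup>*"
proof -
  interpret bidirected_digraph "with_proj T" "swap_in (parcs T)"
    using T by (simp add: undirected_tree_def)
  show sub: "parcs T \<subseteq> pverts T \<times> pverts T" using wellformed by fastforce
  show "sym (parcs T)" using sym_arcs by (simp add: symmetric_def)
  show "(s, t) \<in> (parcs T)\<^sup>*" if "s \<in> pverts T" "t \<in> pverts T" for s t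
  proof -
    have "s \<rightarrow>\<^sup>*\<^bsub>with_proj T\<^esub> t"
      using T that by (simp add: undirected_tree_def connected_graph_def)
    then show ?thesis by (simp add: reachable_def rtrancl_on_def rtrancl_on_rtranclI)
  qed
  show "(s, t) \<notin> (parcs T - {(s, t), (t, s)})\<^sup>*" if st: "(s, t) \<in> parcs T" for s t
  proof
    assume path: "(s, t) \<in> (parcs T - {(s, t), (t, s)})\<^sup>*"
    define T' where "T' = T\<lparr>parcs := parcs T - {(s, t), (t, s)}\<rparr>"
    interpret T': pair_wf_digraph T' using sub by unfold_locales (auto simp: T'_def)
    have "s \<rightarrow>\<^sup>*\<^bsub>with_proj T'\<^esub> t" if "(s, t) \<in> (parcs T')\<^sup>*" "s \<in> pverts T'" for s t
      using that
    proof (induction rule: rtrancl_induct)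
      case base then show ?case by simp
    next
      case (step y z)
      then show ?case using T'.reachable_adj_trans by simp
    qed
    then have "s \<rightarrow>\<^sup>*\<^bsub>with_proj T'\<^esub> t" using path st sub by (auto simp: T'_def)
    then obtain p where p: "T'.apath s p t" using T'.reachable_apath by blast
    then have *: "T'.awalk s p t" "distinct (pawalk_verts s p)" by (auto simp: T'.apath_def)
    have "parcs T' \<subseteq> parcs T" "pverts T' = pverts T" by (auto simp: T'_def)
    with * have p': "awalk s p t" "distinct (awalk_verts s p)" "set p \<subseteq> parcs T'"
      by (auto simp: T'.awalk_def awalk_def)
    have "awalk t [(t, s)] s" using st \<open>sym (parcs T)\<close> sub by (auto simp: awalk_simps sym_def)
    with p'(1) have w: "awalk s (p @ [(t, s)]) s" by (rule awalk_appendI)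
    have "awalk_verts s (p @ [(t, s)]) = awalk_verts s p @ [s]"
      using awalk_verts_append[OF w] by simp
    moreover obtain xs where "awalk_verts s p = s # xs" using p'(1) by (cases p) auto
    ultimately have "cycle (p @ [(t, s)])" using p' w unfolding cycle_def by (intro exI[of _ s]) auto
    \<comment> \<open>The only cycles of a tree are an edge followed by its reverse, so
      \<open>p\<close> would be the deleted edge.\<close>
    then obtain e where "p @ [(t, s)] = [e, swap_in (parcs T) e]"
      using T unfolding undirected_tree_def by blast
    then have "p = [e]" by (simp add: append_eq_Cons_conv)
    with p'(1) have "e = (s, t)" by (cases e) (auto simp: awalk_simps)
    with \<open>p = [e]\<close> p'(3) show False by (simp add: T'_def)
  qed
qed

text \<open>\<open>separate\<close> is the third condition of a tree decomposition, freed of paths: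
  a node \<open>t\<close> whose removal separates \<open>r\<close> from \<open>r'\<close> lies on
  the path between them.\<close>

locale tree_dec =
  fixes V :: "'v set" and E :: "'v rel" and W :: "'t set" and F :: "'t rel" and X :: "'t \<Rightarrow> 'v set"
    and m :: nat
  assumes E_sub: "E \<subseteq> V \<times> V" and sym_E: "sym E"
    and F_sub: "F \<subseteq> W \<times> W" and sym_F: "sym F"
    and F_conn: "\<And>s t. s \<in> W \<Longrightarrow> t \<in> W \<Longrightarrow> (s, t) \<in> F\<^sup>*"
    and bridge: "\<And>s t. (s, t) \<in> F \<Longrightarrow> (s, t) \<notin> (F - {(s, t), (t, s)})\<^sup>*"
    and cover: "\<And>v. v \<in> V \<Longrightarrow> \<exists>t\<in>W. v \<in> X t"
    and cover_edge: "\<And>u v. (u, v) \<in> E \<Longrightarrow> \<exists>t\<in>W. u \<in> X t \<and> v \<in> X t"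
    and separate: "\<And>v r r' t. \<lbrakk>v \<in> X r; v \<in> X r'; r \<in> W; r' \<in> W; t \<in> W; r \<noteq> t;
      (r, r') \<notin> (F \<inter> (- {t}) \<times> (- {t}))\<^sup>*\<rbrakk> \<Longrightarrow> v \<in> X t"
    and bag: "\<And>t. t \<in> W \<Longrightarrow> finite (X t) \<and> card (X t) \<le> m"
begin

text \<open>\<open>Br t s\<close> is the branch of the tree at \<open>t\<close> through its neighbour \<open>s\<close>. The vertices all of whose
  bags lie in this branch are cut off from the others by the bag of \<open>t\<close>.\<close>

definition Br :: "'t \<Rightarrow> 't \<Rightarrow> 't set" where
  "Br t s = {r. (s, r) \<in> (F \<inter> (- {t}) \<times> (- {t}))\<^sup>*}"

definition beyond :: "'t \<Rightarrow> 't \<Rightarrow> 'v set" where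
  "beyond t s = {v \<in> V. \<forall>r\<in>W. v \<in> X r \<longrightarrow> r \<in> Br t s}"

lemma F_irrefl: "(t, t) \<notin> F"
  using bridge by blast

lemma Br_not_self:
  assumes "(t, s) \<in> F" "r \<in> Br t s"
  shows "r \<noteq> t"
  using assms(2) F_irrefl assms(1) unfolding Br_def
  by (auto elim: rtranclE)

lemma Br_exists:
  assumes "t \<in> W" "r \<in> W" "r \<noteq> t"
  shows "\<exists>s. (t, s) \<in> F \<and> r \<in> Br t s"
proof -
  have "r = t \<or> (\<exists>s. (t, s) \<in> F \<and> r \<in> Br t s)" if "(t, r) \<in> F\<^sup>*" for r
    using that
  proof (induction rule: rtrancl_induct)
    case (step y z)
    show ?case
    proof (cases "y = t \<or> z = t")
      case True
      with step show ?thesis by (auto simp: Br_def)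
    next
      case False
      with step obtain s where "(t, s) \<in> F" "y \<in> Br t s" by blast
      with step False show ?thesis
        by (intro disjI2 exI[of _ s]) (auto simp: Br_def intro: rtrancl.rtrancl_into_rtrancl)
    qed
  qed simp
  with F_conn assms show ?thesis by blast
qed

lemma Br_mono_F: "(s, r) \<in> (F \<inter> (- {t}) \<times> (- {t}))\<^sup>* \<Longrightarrow> (s, r) \<in> (F - {(t, u), (u, t)})\<^sup>*"
  by (erule rtrancl_mono[THEN subsetD, rotated]) auto

lemma sym_F_minus: "(a, b) \<in> (F - {(t, u), (u, t)})\<^sup>* \<Longrightarrow> (b, a) \<in> (F - {(t, u), (u, t)})\<^sup>*"
proof -
  assume "(a, b) \<in> (F - {(t, u), (u, t)})\<^sup>*"
  moreover have "sym ((F - {(t, u), (u, t)})\<^sup>*)" by (rule sym_rtrancl) (use sym_F in \<open>auto simp: sym_def\<close>)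
  ultimately show ?thesis by (auto dest: symD)
qed

text \<open>A common node would give a route from \<open>t\<close> to \<open>s\<close> around the
  edge between them.\<close>

lemma Br_disjoint:
  assumes "(t, s) \<in> F"
  shows "Br t s \<inter> Br s t = {}"
proof -
  have False if "r \<in> Br t s" "r \<in> Br s t" for r
  proof -
    have "(s, r) \<in> (F - {(t, s), (s, t)})\<^sup>*" "(t, r) \<in> (F - {(s, t), (t, s)})\<^sup>*"
      using that Br_mono_F unfolding Br_def by blast+
    then have "(s, r) \<in> (F - {(t, s), (s, t)})\<^sup>*" "(t, r) \<in> (F - {(t, s), (s, t)})\<^sup>*"
      by (simp_all add: insert_commute)
    then have "(t, s) \<in> (F - {(t, s), (s, t)})\<^sup>*" using sym_F_minus rtrancl_trans by metis
    with bridge assms show False by blast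
  qed
  then show ?thesis by blast
qed

text \<open>Branches shrink along a walk that does not turn back: \<open>Br s s'\<close> cannot
  reach \<open>t\<close>, as this would bypass the edge from \<open>t\<close> to
  \<open>s\<close>.\<close>

lemma Br_subset:
  assumes "(t, s) \<in> F" "(s, s') \<in> F" "s' \<noteq> t"
  shows "Br s s' \<subseteq> Br t s"
proof
  have tBr: "t \<notin> Br s s'"
  proof
    assume "t \<in> Br s s'"
    then have "(s', t) \<in> (F - {(s, t), (t, s)})\<^sup>*" using Br_mono_F by (simp add: Br_def)
    moreover have "(s, s') \<in> F - {(s, t), (t, s)}" using assms F_irrefl by auto
    ultimately have "(s, t) \<in> (F - {(s, t), (t, s)})\<^sup>*" by (rule converse_rtrancl_into_rtrancl[rotated])
    with bridge assms symD[OF sym_F] show False by blast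
  qed
  fix r assume "r \<in> Br s s'"
  then have "(s', r) \<in> (F \<inter> (- {s}) \<times> (- {s}))\<^sup>*" by (simp add: Br_def)
  then show "r \<in> Br t s"
  proof (induction rule: rtrancl_induct)
    case base
    have "(s, s') \<in> F \<inter> (- {t}) \<times> (- {t})" using assms F_irrefl by auto
    then show ?case by (auto simp: Br_def)
  next
    case (step y z)
    have "y \<in> Br s s'" "z \<in> Br s s'" using step by (auto simp: Br_def intro: rtrancl.rtrancl_into_rtrancl)
    then have "y \<noteq> t" "z \<noteq> t" using tBr by auto
    then have "(y, z) \<in> F \<inter> (- {t}) \<times> (- {t})" using step by auto
    with step.IH show ?case by (auto simp: Br_def intro: rtrancl.rtrancl_into_rtrancl)
  qed
qed

text \<open>The nodes whose bags contain \<open>v\<close> span a subtree; if it avoids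
  \<open>t\<close>, it stays in a single branch at \<open>t\<close>.\<close>

lemma bags_in_Br:
  assumes "(t, s) \<in> F" "v \<in> X r" "r \<in> W" "r \<in> Br t s" "v \<notin> X t" "v \<in> V"
  shows "v \<in> beyond t s"
proof -
  have "r' \<in> Br t s" if "r' \<in> W" "v \<in> X r'" for r'
  proof (rule ccontr)
    assume "r' \<notin> Br t s"
    then have "(r, r') \<notin> (F \<inter> (- {t}) \<times> (- {t}))\<^sup>*" using assms(4) rtrancl_trans[of s r _ r'] by (auto simp: Br_def)
    with separate[of v r r' t] that assms Br_not_self F_sub show False by blast
  qed
  with assms(6) show ?thesis by (simp add: beyond_def)
qed

text \<open>A bag covering the edge contains \<open>v\<close>, hence belongs to the branch. So edges
  can leave \<open>beyond t s\<close> only into the bag of \<open>t\<close>.\<close>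

lemma beyond_step:
  assumes "(t, s) \<in> F" "v \<in> beyond t s" "(v, w) \<in> E" "w \<notin> X t"
  shows "w \<in> beyond t s"
proof -
  obtain r where r: "r \<in> W" "v \<in> X r" "w \<in> X r" using cover_edge assms(3) by blast
  then have "r \<in> Br t s" using assms(2) by (auto simp: beyond_def)
  with bags_in_Br[of t s w r] r assms E_sub show ?thesis by blast
qed

end

section \<open>The nodes of the decomposition tree that a ray follows\<close>

locale tree_dec_ray = tree_dec V E W F X m
  for V :: "'v set" and E and W :: "'t set" and F X m +
  fixes \<alpha> :: "nat \<Rightarrow> 'v"
  assumes inj_ray: "inj \<alpha>" and ray_step: "\<And>i. (\<alpha> i, \<alpha> (Suc i)) \<in> E"
begin

text \<open>An injective ray meets the finite bag of \<open>t\<close> only finitely often and cannot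
  change the branch afterwards.\<close>

lemma next_exists:
  assumes t: "t \<in> W"
  shows "\<exists>s. (t, s) \<in> F \<and> (\<exists>n. \<forall>i\<ge>n. \<alpha> i \<in> beyond t s)"
proof -
  have "finite (\<alpha> -` X t)" using bag t inj_ray by (auto intro: finite_vimageI)
  then obtain n where n: "\<And>i. i \<ge> n \<Longrightarrow> \<alpha> i \<notin> X t"
    unfolding finite_nat_iff_bounded by (metis lessThan_iff linorder_not_le subsetD vimageI)
  have aV: "\<alpha> i \<in> V" for i using ray_step E_sub by blast
  obtain r where r: "r \<in> W" "\<alpha> n \<in> X r" using cover aV by blast
  moreover have "r \<noteq> t" using n r by blast
  ultimately obtain s where s: "(t, s) \<in> F" "r \<in> Br t s" using Br_exists t by blast
  have "\<alpha> i \<in> beyond t s" if "i \<ge> n" for i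
    using that
  proof (induction i rule: dec_induct)
    case base
    then show ?case using bags_in_Br s r n aV by blast
  next
    case (step i)
    then show ?case using beyond_step[OF s(1) _ ray_step] n by simp
  qed
  with s show ?thesis by blast
qed

definition nxt :: "'t \<Rightarrow> 't" where
  "nxt t = (SOME s. (t, s) \<in> F \<and> (\<exists>n. \<forall>i\<ge>n. \<alpha> i \<in> beyond t s))"

lemma nxt:
  assumes "t \<in> W"
  shows "(t, nxt t) \<in> F" "\<exists>n. \<forall>i\<ge>n. \<alpha> i \<in> beyond t (nxt t)"
  using someI_ex[OF next_exists[OF assms]] unfolding nxt_def by blast+

text \<open>A tail of the ray cannot lie in both branches across one edge of the tree, so the
  sequence of nodes never turns back.\<close>

lemma nxt_nxt:
  assumes t: "t \<in> W"
  shows "nxt (nxt t) \<noteq> t"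
proof
  assume eq: "nxt (nxt t) = t"
  have s: "nxt t \<in> W" using nxt(1)[OF t] F_sub by blast
  obtain n n' where "\<forall>i\<ge>n. \<alpha> i \<in> beyond t (nxt t)" "\<forall>i\<ge>n'. \<alpha> i \<in> beyond (nxt t) t"
    using nxt(2)[OF t] nxt(2)[OF s] eq by auto
  then have *: "\<alpha> (max n n') \<in> beyond t (nxt t)" "\<alpha> (max n n') \<in> beyond (nxt t) t" by simp_all
  obtain r where "r \<in> W" "\<alpha> (max n n') \<in> X r"
    using cover[of "\<alpha> (max n n')"] * by (auto simp: beyond_def)
  with * have "r \<in> Br t (nxt t) \<inter> Br (nxt t) t" by (auto simp: beyond_def)
  with Br_disjoint nxt(1)[OF t] show False by blast
qed

definition node :: "nat \<Rightarrow> 't" where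
  "node i = (nxt ^^ i) (SOME t. t \<in> W)"

lemma node_in: "node i \<in> W"
proof (induction i)
  case 0
  obtain t where "t \<in> W" using cover ray_step[of 0] E_sub by blast
  then show ?case by (auto simp: node_def intro: someI)
next
  case (Suc i)
  then show ?case using nxt(1) F_sub by (auto simp: node_def)
qed

lemma node_Suc: "node (Suc i) = nxt (node i)"
  by (simp add: node_def)

lemma node_edge: "(node i, node (Suc i)) \<in> F"
  using nxt(1)[OF node_in] by (simp add: node_Suc)

abbreviation "B i \<equiv> Br (node i) (node (Suc i))"
abbreviation "U i \<equiv> beyond (node i) (node (Suc i))"

lemma B_Suc: "B (Suc i) \<subseteq> B i"
  using Br_subset[OF node_edge node_edge] nxt_nxt[OF node_in] by (simp add: node_Suc)

lemma B_anti: "i \<le> j \<Longrightarrow> B j \<subseteq> B i"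
  by (rule lift_Suc_antimono_le[where f = "\<lambda>i. B i", OF B_Suc])

lemma U_anti: "i \<le> j \<Longrightarrow> U j \<subseteq> U i"
  using B_anti unfolding beyond_def by blast

lemma inj_node: "inj node"
proof -
  have "node i \<noteq> node j" if ij: "i < j" for i j
  proof -
    obtain l where j: "j = Suc l" "i \<le> l" using ij by (cases j) auto
    have "node j \<in> B l" using j by (simp add: Br_def)
    then have "node j \<in> B i" using B_anti[OF j(2)] by blast
    with Br_not_self[OF node_edge] show ?thesis by metis
  qed
  then show ?thesis by (metis injI linorder_neqE_nat)
qed

text \<open>Otherwise a node \<open>r\<close> whose bag contains \<open>v\<close> lies in every
  branch \<open>B i\<close>. The finite path from \<open>r\<close> to \<open>node 0\<close> then has
  to pass through all of the infinitely many nodes \<open>node i\<close>.\<close>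

lemma not_all_beyond:
  assumes "v \<in> V"
  shows "\<exists>i. v \<notin> U i"
proof (rule ccontr)
  assume "\<not> ?thesis"
  then have all: "v \<in> U i" for i by blast
  obtain r where r: "r \<in> W" "v \<in> X r" using cover assms by blast
  have rB: "r \<in> B i" for i using all[of i] r by (auto simp: beyond_def)
  obtain P where P: "finite P" "P \<subseteq> F" "(r, node 0) \<in> P\<^sup>*"
    using rtrancl_finite_subrel[OF F_conn[OF r(1) node_in[of 0]]] by auto
  \<comment> \<open>A path avoiding \<open>node i\<close> would place \<open>node 0\<close> in
    \<open>B i\<close>, hence in \<open>B 0\<close>, a branch at \<open>node 0\<close>
    itself.\<close>
  have "node i \<in> Field P" for i
  proof (rule ccontr)
    assume "node i \<notin> Field P"
    then have "P \<subseteq> F \<inter> (- {node i}) \<times> (- {node i})" using P(2) by (auto simp: Field_def)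
    then have "(r, node 0) \<in> (F \<inter> (- {node i}) \<times> (- {node i}))\<^sup>*" using P(3) rtrancl_mono by blast
    then have "node 0 \<in> B i" using rB[of i] by (auto simp: Br_def intro: rtrancl_trans)
    then have "node 0 \<in> B 0" using B_anti by blast
    with Br_not_self[OF node_edge] show False by blast
  qed
  then have "range node \<subseteq> Field P" by blast
  moreover have "finite (Field P)" using P(1) by (rule finite_Field)
  ultimately have "finite (range node)" by (rule finite_subset)
  with inj_node show False using finite_imageD by blast
qed

lemma avoid_finite:
  assumes "finite S" "S \<subseteq> V"
  shows "\<exists>i. U i \<inter> S = {}"
  using assms
proof (induction S rule: finite_induct)
  case (insert x S)
  then obtain i where "U i \<inter> S = {}" by auto
  moreover obtain j where "x \<notin> U j" using not_all_beyond insert by blast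
  moreover have "U (max i j) \<subseteq> U i" "U (max i j) \<subseteq> U j" by (rule U_anti, simp)+
  ultimately show ?case by (intro exI[of _ "max i j"]) blast
qed auto

text \<open>One bag contains all outer neighbours of \<open>U\<close>. This bounds vertices rather
  than edges; degrees convert the bound later.\<close>

lemma separated:
  assumes "finite S" "S \<subseteq> V"
  shows "\<exists>U \<subseteq> V. U \<inter> S = {} \<and> (\<exists>n. \<forall>i\<ge>n. \<alpha> i \<in> U) \<and>
    finite (E `` U - U) \<and> card (E `` U - U) \<le> m"
proof -
  obtain i where i: "U i \<inter> S = {}" using avoid_finite assms by blast
  have sub: "E `` U i - U i \<subseteq> X (node i)" using beyond_step[OF node_edge] by blast
  have "U i \<subseteq> V" by (auto simp: beyond_def)
  with i sub nxt(2)[OF node_in, of i] bag[OF node_in, of i] show ?thesis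
    by (intro exI[of _ "U i"]) (auto simp: node_Suc intro: finite_subset card_mono order_trans)
qed

end

text \<open>The factor \<open>m * d\<close> arises because each boundary edge of \<open>U\<close>
  ends at one of at most \<open>m\<close> outer neighbours, each with at most \<open>d\<close>
  edges. Being connected and disjoint from \<open>U\<close>, the set \<open>S\<close> lies in one
  component of what remains outside the component of the tail.\<close>

lemma separated_by_cut:
  assumes E: "sym E" "E \<subseteq> V \<times> V" "conn E V"
    and deg: "\<And>v. v \<in> V \<Longrightarrow> finite (E `` {v}) \<and> card (E `` {v}) \<le> d"
    and U: "U \<subseteq> V" "U \<inter> S = {}" "\<And>i. i \<ge> n \<Longrightarrow> \<alpha> i \<in> U"
      "finite (E `` U - U)" "card (E `` U - U) \<le> m"
    and ray: "\<And>i. (\<alpha> i, \<alpha> (Suc i)) \<in> E"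
    and S: "S \<subseteq> V" "S \<noteq> {}" "conn E S"
  shows "\<exists>D. cut V E D \<and> card (bd E D) \<le> m * d \<and> S \<subseteq> D \<and> (\<forall>i\<ge>n. \<alpha> i \<in> V - D)"
proof -
  have EV: "E `` U - U \<subseteq> V" using E by blast
  have "bd E U \<subseteq> (\<lambda>(w, u). (u, w)) ` (SIGMA w:E `` U - U. E `` {w})"
    using symD[OF E(1)] by (fastforce simp: bd_def)
  moreover have fS: "finite (SIGMA w:E `` U - U. E `` {w})" using U deg EV by blast
  moreover have "card (SIGMA w:E `` U - U. E `` {w}) \<le> m * d"
  proof -
    have "card (SIGMA w:E `` U - U. E `` {w}) = (\<Sum>w\<in>E `` U - U. card (E `` {w}))"
      using U deg EV by (intro card_SigmaI) auto
    also have "\<dots> \<le> card (E `` U - U) * d" using deg EV by (intro sum_bounded_above[THEN order_trans]) auto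
    also have "\<dots> \<le> m * d" using U by simp
    finally show ?thesis .
  qed
  ultimately have bdU: "finite (bd E U)" "card (bd E U) \<le> m * d"
    by (auto intro: finite_subset dest: surj_card_le[OF fS])
  obtain y where y: "y \<in> S" using S by blast
  then have yU: "y \<in> V - U" using S U by blast
  define A where "A = comp E U (\<alpha> n)"
  define D where "D = comp E (V - A) y"
  note cut = cut_off_component[OF E U(1) bdU(1) U(3)[OF order_refl] yU, folded A_def, folded D_def]
  have "S \<subseteq> V - A" using S U comp_subset[of E U "\<alpha> n"] by (auto simp: A_def)
  then have "S \<subseteq> D" unfolding D_def
    by (intro comp_connected_subset[where a = y]) (use S y in \<open>auto intro: self_in_comp\<close>)
  moreover have "D \<subseteq> V" using cut(1) by (simp add: cut_def)
  then have "card (bd E D) \<le> m * d"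
    using card_mono[OF bdU(1) cut(3)] bdU(2) bd_compl[OF E(1,2), of D] by simp
  moreover have "\<alpha> i \<in> V - D" if "i \<ge> n" for i
    using ray_in_comp[of n \<alpha> U E, OF U(3) ray that] cut(4) by (auto simp: A_def)
  ultimately show ?thesis using cut(1) by blast
qed

text \<open>All that is retained of finite treewidth. The point is that \<open>k\<close> depends
  neither on the ray nor on \<open>S\<close>.\<close>

definition rays_separated :: "'v set \<Rightarrow> 'v rel \<Rightarrow> nat \<Rightarrow> bool" where
  "rays_separated V E k \<longleftrightarrow> (\<forall>\<alpha> S. inj \<alpha> \<and> (\<forall>i :: nat. (\<alpha> i, \<alpha> (Suc i)) \<in> E) \<and>
      finite S \<and> S \<subseteq> V \<and> S \<noteq> {} \<and> conn E S \<longrightarrow>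
    (\<exists>D. cut V E D \<and> card (bd E D) \<le> k \<and> S \<subseteq> D \<and> (\<exists>n. \<forall>i\<ge>n. \<alpha> i \<in> V - D)))"

lemma finite_treewidth_separates:
  fixes \<Gamma> :: "'v pair_pre_digraph"
  assumes tw: "finite_treewidth TYPE('t) \<Gamma>"
    and E: "sym (parcs \<Gamma>)" "parcs \<Gamma> \<subseteq> pverts \<Gamma> \<times> pverts \<Gamma>" "conn (parcs \<Gamma>) (pverts \<Gamma>)"
    and deg: "\<And>v. v \<in> pverts \<Gamma> \<Longrightarrow> finite (parcs \<Gamma> `` {v}) \<and> card (parcs \<Gamma> `` {v}) \<le> d"
  shows "\<exists>k. rays_separated (pverts \<Gamma>) (parcs \<Gamma>) k"
proof -
  obtain k T and X :: "'t \<Rightarrow> 'v set" where T: "tree_decomposition \<Gamma> T X"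
    and k: "\<And>t. t \<in> pverts T \<Longrightarrow> finite (X t) \<and> card (X t) \<le> k + 1"
    using tw by (auto simp: finite_treewidth_def)
  have tree: "undirected_tree (with_proj T) (swap_in (parcs T))"
    using T by (simp add: tree_decomposition_def)
  interpret T: bidirected_digraph "with_proj T" "swap_in (parcs T)"
    using tree by (simp add: undirected_tree_def)
  note rel = undirected_tree_rel[OF tree]
  have walk: "(r, z) \<in> (parcs T \<inter> (- {t}) \<times> (- {t}))\<^sup>*"
    if "T.awalk r p z" "t \<notin> set (T.awalk_verts r p)" for r p z t
    using that
  proof (induction p arbitrary: r)
    case (Cons e p)
    then have "(r, snd e) \<in> parcs T \<inter> (- {t}) \<times> (- {t})"
      by (cases e; cases p) (auto simp: T.awalk_simps)
    moreover have "(snd e, z) \<in> (parcs T \<inter> (- {t}) \<times> (- {t}))\<^sup>*"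
      using Cons by (auto simp: T.awalk_simps)
    ultimately show ?case by (rule converse_rtrancl_into_rtrancl)
  qed (auto simp: T.awalk_simps)
  \<comment> \<open>Tree decompositions speak of paths, so one path from \<open>r\<close> to
    \<open>r'\<close> is chosen; by \<open>walk\<close> it passes through \<open>t\<close>.\<close>
  have sep: "v \<in> X t" if "v \<in> X r" "v \<in> X r'" "r \<in> pverts T" "r' \<in> pverts T" "t \<in> pverts T"
    "(r, r') \<notin> (parcs T \<inter> (- {t}) \<times> (- {t}))\<^sup>*" for v r r' t
  proof -
    have "r \<rightarrow>\<^sup>*\<^bsub>with_proj T\<^esub> r'"
      using tree that by (simp add: undirected_tree_def connected_graph_def)
    then obtain p where p: "T.apath r p r'" using T.reachable_apath by blast
    then have "t \<in> set (T.awalk_verts r p)" using walk that(6) by (auto simp: T.apath_def)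
    with p T that show ?thesis unfolding tree_decomposition_def by blast
  qed
  have dec: "tree_dec (pverts \<Gamma>) (parcs \<Gamma>) (pverts T) (parcs T) X (k + 1)"
  proof
    show "\<exists>t\<in>pverts T. u \<in> X t \<and> v \<in> X t" if "(u, v) \<in> parcs \<Gamma>" for u v
      using T that unfolding tree_decomposition_def by blast
    show "\<exists>t\<in>pverts T. v \<in> X t" if "v \<in> pverts \<Gamma>" for v
      using T that unfolding tree_decomposition_def by blast
    show "finite (X t) \<and> card (X t) \<le> k + 1" if "t \<in> pverts T" for t
      using k that .
    show "v \<in> X t" if "v \<in> X r" "v \<in> X r'" "r \<in> pverts T" "r' \<in> pverts T" "t \<in> pverts T"
      "(r, r') \<notin> (parcs T \<inter> (- {t}) \<times> (- {t}))\<^sup>*" for v r r' t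
      using sep that .
  qed (fact E rel)+
  show ?thesis unfolding rays_separated_def
  \<comment> \<open>Bag size times degree bound.\<close>
  proof (intro exI[of _ "(k + 1) * d"] allI impI, elim conjE)
    fix \<alpha> :: "nat \<Rightarrow> 'v" and S :: "'v set"
    assume \<alpha>: "inj \<alpha>" "\<forall>i. (\<alpha> i, \<alpha> (Suc i)) \<in> parcs \<Gamma>"
      and S: "finite S" "S \<subseteq> pverts \<Gamma>" "S \<noteq> {}" "conn (parcs \<Gamma>) S"
    interpret tree_dec_ray "pverts \<Gamma>" "parcs \<Gamma>" "pverts T" "parcs T" X "k + 1" \<alpha>
      using dec \<alpha> by (simp add: tree_dec_ray_def tree_dec_ray_axioms_def)
    obtain U n where U: "U \<subseteq> pverts \<Gamma>" "U \<inter> S = {}" "\<And>i. i \<ge> n \<Longrightarrow> \<alpha> i \<in> U"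
      "finite (parcs \<Gamma> `` U - U)" "card (parcs \<Gamma> `` U - U) \<le> k + 1"
      using separated[OF S(1,2)] by blast
    show "\<exists>D. cut (pverts \<Gamma>) (parcs \<Gamma>) D \<and> card (bd (parcs \<Gamma>) D) \<le> (k + 1) * d \<and> S \<subseteq> D \<and>
      (\<exists>n. \<forall>i\<ge>n. \<alpha> i \<in> pverts \<Gamma> - D)"
      using separated_by_cut[of "parcs \<Gamma>" "pverts \<Gamma>" d U S n \<alpha> "k + 1", OF E deg U] \<alpha>(2) S(2-4) by blast
  qed
qed

section \<open>Bi-infinite geodesics\<close>

text \<open>A diagonal argument: for \<open>n\<close> in the infinite set \<open>S m\<close>, all
  \<open>q n\<close> agree on the positions of absolute value below \<open>m\<close>, and these
  index sets decrease.\<close>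

lemma diagonal_limit:
  fixes q :: "nat \<Rightarrow> int \<Rightarrow> 'a"
  assumes fin: "\<And>i. finite (F i)" and q: "\<And>n i. \<bar>i\<bar> \<le> int n \<Longrightarrow> q n i \<in> F i"
  shows "\<exists>p. \<forall>m. \<exists>n\<ge>m. \<forall>i. \<bar>i\<bar> \<le> int m \<longrightarrow> q n i = p i"
proof -
  let ?P = "\<lambda>m S. infinite S \<and> (\<forall>n\<in>S. \<forall>n'\<in>S. \<forall>i. \<bar>i\<bar> < int m \<longrightarrow> q n i = q n' i)"
  have "\<exists>S :: nat \<Rightarrow> nat set. \<forall>m. ?P m (S m) \<and> S (Suc m) \<subseteq> S m"
  proof (rule dependent_nat_choice)
    show "\<exists>S. ?P 0 S" by (intro exI[of _ UNIV]) auto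
    fix S m assume S: "?P m S"
    define I where "I = {- int m..int m}"
    \<comment> \<open>\<open>q n\<close> is controlled only up to absolute value \<open>n\<close>,
      so smaller indices are dropped before the pigeonhole principle is applied.\<close>
    define S' where "S' = S \<inter> {m..}"
    have "infinite S'"
    proof
      assume "finite S'"
      then have "finite (S' \<union> {..<m})" by simp
      moreover have "S \<subseteq> S' \<union> {..<m}" by (auto simp: S'_def)
      ultimately show False using S finite_subset by blast
    qed
    moreover have "finite ((\<lambda>n. restrict (q n) I) ` S')"
    proof (rule finite_subset)
      show "(\<lambda>n. restrict (q n) I) ` S' \<subseteq> (\<Pi>\<^sub>E i\<in>I. F i)" using q by (auto simp: S'_def I_def)
      show "finite (\<Pi>\<^sub>E i\<in>I. F i)" using fin by (intro finite_PiE) (auto simp: I_def)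
    qed
    ultimately obtain n0 where inf: "infinite {n \<in> S'. restrict (q n) I = restrict (q n0) I}"
      using pigeonhole_infinite[of S' "\<lambda>n. restrict (q n) I"] by blast
    show "\<exists>S'. ?P (Suc m) S' \<and> S' \<subseteq> S"
    proof (intro exI conjI ballI allI impI)
      show "infinite {n \<in> S'. restrict (q n) I = restrict (q n0) I}" by (rule inf)
      fix n n' i assume "n \<in> {n \<in> S'. restrict (q n) I = restrict (q n0) I}"
        "n' \<in> {n \<in> S'. restrict (q n) I = restrict (q n0) I}" "\<bar>i\<bar> < int (Suc m)"
      then have "restrict (q n) I i = restrict (q n') I i" "i \<in> I" by (auto simp: I_def)
      then show "q n i = q n' i" by simp
    qed (auto simp: S'_def)
  qed
  then obtain S where S: "\<forall>m. ?P m (S m) \<and> S (Suc m) \<subseteq> S m" by (rule exE)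
  have inf: "infinite (S m)" for m using S by simp
  have dec: "S (Suc m) \<subseteq> S m" for m using S by simp
  have agree: "q n i = q n' i" if "n \<in> S m" "n' \<in> S m" "\<bar>i\<bar> < int m" for n n' m i
    using conjunct2[OF conjunct1[OF spec[OF S, of m]]] that by blast
  have anti: "S m' \<subseteq> S m" if "m \<le> m'" for m m'
    using that by (rule lift_Suc_antimono_le[where f = S, OF dec])
  define p where "p i = q (SOME n. n \<in> S (Suc (nat \<bar>i\<bar>))) i" for i
  have p: "q n i = p i" if n: "n \<in> S (Suc (nat \<bar>i\<bar>))" for n i
  proof -
    have "(SOME n. n \<in> S (Suc (nat \<bar>i\<bar>))) \<in> S (Suc (nat \<bar>i\<bar>))" using n by (rule someI)
    from agree[OF n this, of i] show ?thesis by (simp add: p_def)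
  qed
  show ?thesis
  proof (intro exI[of _ p] allI)
    fix m
    obtain n where n: "n \<in> S (Suc m)" "m \<le> n" using inf by (meson infinite_nat_iff_unbounded_le)
    have "q n i = p i" if "\<bar>i\<bar> \<le> int m" for i
    proof -
      have "Suc (nat \<bar>i\<bar>) \<le> Suc m" using that by linarith
      then show ?thesis using p anti n(1) by blast
    qed
    with n show "\<exists>n\<ge>m. \<forall>i. \<bar>i\<bar> \<le> int m \<longrightarrow> q n i = p i" by blast
  qed
qed

lemma finite_relpow_Image:
  fixes A :: "'a rel"
  assumes "\<And>x. finite (A `` {x})" "finite S"
  shows "finite ((A ^^ m) `` S)"
proof (induction m)
  case 0
  then show ?case using assms by simp
next
  case (Suc m)
  have "(A ^^ Suc m) `` S = (\<Union>x\<in>(A ^^ m) `` S. A `` {x})" by auto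
  with Suc assms(1) show ?case by simp
qed

text \<open>Balls are finite, so the infinite set contains a point at distance more than
  \<open>n\<close> from \<open>b\<close>. A shortest walk to it admits no shortcut between any two
  of its points.\<close>

lemma long_geodesic:
  assumes fin: "\<And>x. finite (A `` {x})" and inf: "infinite B" and b: "\<And>x. x \<in> B \<Longrightarrow> (b, x) \<in> A\<^sup>*"
  shows "\<exists>f. (\<forall>i<n. (f i, f (Suc i)) \<in> A) \<and>
    (\<forall>i j m. i \<le> j \<and> j \<le> n \<and> (f i, f j) \<in> A ^^ m \<longrightarrow> j - i \<le> m)"
proof -
  have "finite (\<Union>m\<le>n. (A ^^ m) `` {b})" using finite_relpow_Image[OF fin] by blast
  then have "\<not> B \<subseteq> (\<Union>m\<le>n. (A ^^ m) `` {b})" using inf finite_subset by blast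
  then obtain x where x: "x \<in> B" "\<And>m. m \<le> n \<Longrightarrow> (b, x) \<notin> A ^^ m" by auto
  define N where "N = (LEAST m. (b, x) \<in> A ^^ m)"
  have "\<exists>m. (b, x) \<in> A ^^ m" using b[OF x(1)] rtrancl_imp_relpow by blast
  then have N: "(b, x) \<in> A ^^ N" unfolding N_def by (rule LeastI_ex)
  have least: "N \<le> m" if "(b, x) \<in> A ^^ m" for m using that unfolding N_def by (rule Least_le)
  have "n < N" using x(2)[of N] N by linarith
  obtain f where f: "f 0 = b" "f N = x" "\<And>i. i < N \<Longrightarrow> (f i, f (Suc i)) \<in> A"
    using N unfolding relpow_fun_conv by blast
  have sub: "(f i, f (i + l)) \<in> A ^^ l" if "i + l \<le> N" for i l
    using that f(3) unfolding relpow_fun_conv by (intro exI[of _ "\<lambda>t. f (i + t)"]) auto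
  have "j - i \<le> m" if "i \<le> j" "j \<le> n" "(f i, f j) \<in> A ^^ m" for i j m
  proof -
    have "(b, f i) \<in> A ^^ i" "(f j, x) \<in> A ^^ (N - j)"
      using sub[of 0 i] sub[of j "N - j"] that \<open>n < N\<close> f(1,2) by auto
    with that(3) have "(b, x) \<in> A ^^ (i + m + (N - j))" by (auto simp: relpow_add)
    from least[OF this] that \<open>n < N\<close> show ?thesis by linarith
  qed
  with f(3) \<open>n < N\<close> show ?thesis by (intro exI[of _ f]) auto
qed

text \<open>Long geodesic segments are translated so that their midpoints lie in a fixed finite set;
  by compactness they accumulate at a bi-infinite geodesic.\<close>

lemma biinfinite_geodesic:
  assumes fin: "\<And>x. finite (A `` {x})" and sym: "sym A" and sub: "A \<subseteq> B \<times> B" and inf: "infinite B"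
    and con: "\<And>x y. x \<in> B \<Longrightarrow> y \<in> B \<Longrightarrow> (x, y) \<in> A\<^sup>*"
    and Q: "finite Q" "\<And>x. x \<in> B \<Longrightarrow> \<exists>h\<in>H. h x \<in> Q"
    and H: "\<And>h x y m. h \<in> H \<Longrightarrow> x \<in> B \<Longrightarrow> y \<in> B \<Longrightarrow> (h x, h y) \<in> A ^^ m \<longleftrightarrow> (x, y) \<in> A ^^ m"
  shows "\<exists>p :: int \<Rightarrow> 'a. (\<forall>i. (p i, p (i + 1)) \<in> A) \<and>
    (\<forall>i j m. i \<le> j \<and> (p i, p j) \<in> A ^^ m \<longrightarrow> j - i \<le> int m)"
proof -
  obtain b where b: "b \<in> B" using inf by (metis finite.emptyI ex_in_conv)
  let ?geo = "\<lambda>n p. p 0 \<in> Q \<and> (\<forall>i. - int n \<le> i \<and> i < int n \<longrightarrow> (p i, p (i + 1)) \<in> A) \<and>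
    (\<forall>i j m. - int n \<le> i \<and> i \<le> j \<and> j \<le> int n \<and> (p i, p j) \<in> A ^^ m \<longrightarrow> j - i \<le> int m)"
  have "\<exists>p :: int \<Rightarrow> 'a. ?geo n p" for n
  proof -
    \<comment> \<open>A segment with \<open>2 * n\<close> edges is centred at \<open>f n\<close>;
      the additional edge ensures that \<open>f (2 * n)\<close> lies in \<open>B\<close> as
      well.\<close>
    obtain f where f: "\<And>i. i < 2 * n + 1 \<Longrightarrow> (f i, f (Suc i)) \<in> A"
      and geo: "\<And>i j m. i \<le> j \<Longrightarrow> j \<le> 2 * n + 1 \<Longrightarrow> (f i, f j) \<in> A ^^ m \<Longrightarrow> j - i \<le> m"
      using long_geodesic[of A B b "2 * n + 1", OF fin inf] con b by blast
    have fB: "f i \<in> B" if "i \<le> 2 * n" for i using f[of i] that sub by auto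
    obtain h where h: "h \<in> H" "h (f n) \<in> Q" using Q(2)[OF fB[of n]] by auto
    define p where "p i = h (f (nat (i + int n)))" for i
    have "(p i, p (i + 1)) \<in> A" if "- int n \<le> i" "i < int n" for i
    proof -
      have e: "nat (i + 1 + int n) = Suc (nat (i + int n))" using that by linarith
      have "nat (i + int n) < 2 * n" using that by linarith
      then have "(f (nat (i + int n)), f (nat (i + 1 + int n))) \<in> A ^^ 1"
        "f (nat (i + int n)) \<in> B" "f (nat (i + 1 + int n)) \<in> B"
        using f[of "nat (i + int n)"] fB unfolding e by auto
      then have "(p i, p (i + 1)) \<in> A ^^ 1" unfolding p_def using H[OF h(1)] by blast
      then show ?thesis by simp
    qed
    moreover have "j - i \<le> int m" if "- int n \<le> i" "i \<le> j" "j \<le> int n" "(p i, p j) \<in> A ^^ m" for i j m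
    proof -
      have le: "nat (i + int n) \<le> 2 * n" "nat (j + int n) \<le> 2 * n" "nat (i + int n) \<le> nat (j + int n)"
        using that by linarith+
      have "(f (nat (i + int n)), f (nat (j + int n))) \<in> A ^^ m"
        using that(4) H[OF h(1) fB[OF le(1)] fB[OF le(2)]] by (simp add: p_def)
      then have "nat (j + int n) - nat (i + int n) \<le> m" using geo[OF le(3)] le by simp
      then show ?thesis using that by linarith
    qed
    moreover have "p 0 \<in> Q" using h by (simp add: p_def)
    ultimately show ?thesis by (intro exI[of _ p]) blast
  qed
  then obtain q :: "nat \<Rightarrow> int \<Rightarrow> 'a" where q: "\<And>n. ?geo n (q n)" by metis
  \<comment> \<open>The ball of radius \<open>\<bar>i\<bar>\<close> about \<open>Q\<close>; it is
    finite and contains position \<open>i\<close> of every segment long enough to have one.\<close>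
  define F where "F i = (\<Union>m\<le>nat \<bar>i\<bar>. (A ^^ m) `` Q)" for i :: int
  have "finite (F i)" for i using finite_relpow_Image[OF fin Q(1)] by (simp add: F_def)
  moreover have "q n i \<in> F i" if i: "\<bar>i\<bar> \<le> int n" for n i
  proof -
    have up: "(q n 0, q n (int l)) \<in> A ^^ l" if "l \<le> n" for l
      using that
    proof (induction l)
      case (Suc l)
      moreover have "(q n (int l), q n (int l + 1)) \<in> A" using q[of n] Suc.prems by simp
      ultimately show ?case by (auto simp: add.commute intro: relpow_Suc_I)
    qed simp
    have down: "(q n 0, q n (- int l)) \<in> A ^^ l" if "l \<le> n" for l
      using that
    proof (induction l)
      case (Suc l)
      have "(q n (- int (Suc l)), q n (- int (Suc l) + 1)) \<in> A"
        using q[of n, THEN conjunct2, THEN conjunct1, rule_format, of "- int (Suc l)"] Suc.prems by simp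
      then have "(q n (- int l), q n (- int (Suc l))) \<in> A" using symD[OF sym] by simp
      with Suc show ?case by (auto intro: relpow_Suc_I)
    qed simp
    have "(q n 0, q n i) \<in> A ^^ nat \<bar>i\<bar>"
      using up[of "nat i"] down[of "nat (- i)"] i by (cases "i \<ge> 0") auto
    moreover have "q n 0 \<in> Q" using q by blast
    ultimately show ?thesis by (auto simp: F_def)
  qed
  ultimately obtain p where p: "\<And>m. \<exists>n\<ge>m. \<forall>i. \<bar>i\<bar> \<le> int m \<longrightarrow> q n i = p i"
    using diagonal_limit[of F q] by blast
  have "(p i, p (i + 1)) \<in> A" for i
  proof -
    obtain n where n: "nat \<bar>i\<bar> + 1 \<le> n" "\<forall>j. \<bar>j\<bar> \<le> int (nat \<bar>i\<bar> + 1) \<longrightarrow> q n j = p j"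
      using p[of "nat \<bar>i\<bar> + 1"] by blast
    then have "q n i = p i" "q n (i + 1) = p (i + 1)" "- int n \<le> i" "i < int n" by auto
    with q[of n] show ?thesis by metis
  qed
  moreover have "j - i \<le> int m" if "i \<le> j" "(p i, p j) \<in> A ^^ m" for i j m
  proof -
    obtain n where n: "nat (\<bar>i\<bar> + \<bar>j\<bar>) \<le> n" "\<forall>l. \<bar>l\<bar> \<le> int (nat (\<bar>i\<bar> + \<bar>j\<bar>)) \<longrightarrow> q n l = p l"
      using p[of "nat (\<bar>i\<bar> + \<bar>j\<bar>)"] by blast
    then have "q n i = p i" "q n j = p j" "- int n \<le> i" "j \<le> int n" by auto
    with q[of n] that show ?thesis by metis
  qed
  ultimately show ?thesis by blast
qed

section \<open>Cuts splitting a bi-infinite path\<close>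

lemma conn_iff_connected_graph: "connected_graph (with_proj \<Gamma> \<restriction> C) \<longleftrightarrow> conn (parcs \<Gamma>) C"
proof -
  have ends: "arcs_ends (with_proj \<Gamma> \<restriction> C) = parcs \<Gamma> \<inter> C \<times> C"
    by (auto simp: arcs_ends_def arc_to_ends_def induce_subgraph_def)
  have "(u, v) \<in> rtrancl_on C (parcs \<Gamma> \<inter> C \<times> C) \<longleftrightarrow> (u, v) \<in> (parcs \<Gamma> \<inter> C \<times> C)\<^sup>*" if "u \<in> C" for u v
  proof
    assume "(u, v) \<in> (parcs \<Gamma> \<inter> C \<times> C)\<^sup>*"
    then show "(u, v) \<in> rtrancl_on C (parcs \<Gamma> \<inter> C \<times> C)"
      by (induction rule: rtrancl_induct) (use that in \<open>auto intro: rtrancl_on_into_rtrancl_on\<close>)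
  qed (rule rtrancl_on_rtranclI)
  moreover have "verts (with_proj \<Gamma> \<restriction> C) = C" by (simp add: induce_subgraph_def)
  ultimately show ?thesis by (auto simp: connected_graph_def conn_def reachable_def ends)
qed

text \<open>An edge leaving \<open>C - S\<close> cannot leave \<open>C\<close>, since it would then
  leave \<open>S\<close> too. So it ends in \<open>C \<inter> S\<close>, and its reverse leaves
  \<open>S\<close> but not \<open>C\<close>. Orientation matters: a set and its complement have
  converse boundaries.\<close>

lemma bd_determines:
  assumes "sym E" "E \<subseteq> V \<times> V" "conn E V" "C \<subseteq> V" "S \<subseteq> V" "bd E C = bd E S" "C \<inter> S \<noteq> {}"
  shows "C = S"
proof -
  have *: "C - S = {}" if CS: "C \<subseteq> V" "S \<subseteq> V" "bd E C = bd E S" "C \<inter> S \<noteq> {}" for C S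
  proof (rule ccontr)
    assume "C - S \<noteq> {}"
    then obtain x y where "x \<in> C - S" "y \<in> C \<inter> S" using CS by blast
    then obtain a b where ab: "(a, b) \<in> E" "a \<in> C - S" "b \<notin> C - S"
      using conn_crossing[OF assms(3), of x "C - S" y] CS by blast
    then have "(a, b) \<notin> bd E C" using CS(3) by (auto simp: bd_def)
    then have "b \<in> C \<inter> S" using ab by (auto simp: bd_def)
    moreover have "(b, a) \<in> E" using symD[OF assms(1)] ab by blast
    ultimately have "(b, a) \<in> bd E S" "(b, a) \<notin> bd E C" using ab by (auto simp: bd_def)
    with CS(3) show False by blast
  qed
  from *[of C S] *[of S C] assms show ?thesis by blast
qed

section \<open>Tails of a ray\<close>

definition tail_in :: "(nat \<Rightarrow> 'v) \<Rightarrow> 'v set \<Rightarrow> bool" where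
  "tail_in \<beta> S \<longleftrightarrow> (\<exists>n. \<forall>i\<ge>n. \<beta> i \<in> S)"

lemma tail_in_Int: "tail_in \<beta> S \<Longrightarrow> tail_in \<beta> S' \<Longrightarrow> tail_in \<beta> (S \<inter> S')"
  unfolding tail_in_def by (metis IntI le_trans nle_le)

lemma tail_in_mono: "tail_in \<beta> S \<Longrightarrow> S \<subseteq> S' \<Longrightarrow> tail_in \<beta> S'"
  unfolding tail_in_def by blast

lemma tail_in_disjoint: "tail_in \<beta> S \<Longrightarrow> tail_in \<beta> S' \<Longrightarrow> S \<inter> S' = {} \<Longrightarrow> False"
  using tail_in_Int[of \<beta> S S'] by (auto simp: tail_in_def)

lemma tail_in_infinite:
  assumes "tail_in \<beta> S" "inj \<beta>"
  shows "infinite (range \<beta> \<inter> S)"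
proof
  assume fin: "finite (range \<beta> \<inter> S)"
  obtain n where "\<And>i. i \<ge> n \<Longrightarrow> \<beta> i \<in> S" using assms by (auto simp: tail_in_def)
  then have "\<beta> ` {n..} \<subseteq> range \<beta> \<inter> S" by auto
  with fin have "finite (\<beta> ` {n..})" by (rule rev_finite_subset)
  then have "finite {n..}" using assms(2) by (metis finite_imageD inj_on_subset top_greatest)
  then show False by (simp add: infinite_Ici)
qed

text \<open>An injective ray uses each arc at most once, so it changes sides only finitely
  often.\<close>

lemma tail_dichotomy:
  assumes "sym E" "finite (bd E S)" "inj \<beta>" "\<And>i. (\<beta> i, \<beta> (Suc i)) \<in> E"
  shows "tail_in \<beta> S \<or> tail_in \<beta> (- S)"
proof -
  define I where "I = {i. (\<beta> i \<in> S) \<noteq> (\<beta> (Suc i) \<in> S)}"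
  have "(\<lambda>i. (\<beta> i, \<beta> (Suc i))) ` I \<subseteq> bd E S \<union> (bd E S)\<inverse>"
    using assms(4) symD[OF assms(1)] by (auto simp: I_def bd_def)
  then have "finite ((\<lambda>i. (\<beta> i, \<beta> (Suc i))) ` I)" by (rule finite_subset) (simp add: assms(2))
  moreover have "inj_on (\<lambda>i. (\<beta> i, \<beta> (Suc i))) I" using assms(3) by (auto simp: inj_on_def)
  ultimately have "finite I" by (rule finite_imageD)
  then obtain n where n: "\<And>i. i \<ge> n \<Longrightarrow> i \<notin> I"
    unfolding finite_nat_iff_bounded by (metis lessThan_iff linorder_not_le subsetD)
  have "(\<beta> i \<in> S) = (\<beta> n \<in> S)" if "i \<ge> n" for i
    using that
  proof (induction i rule: dec_induct)
    case (step i)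
    with n[of i] show ?case by (simp add: I_def)
  qed simp
  then show ?thesis unfolding tail_in_def by (cases "\<beta> n \<in> S") auto
qed

section \<open>Balls and crossing cuts in a locally finite graph\<close>

locale lf_graph =
  fixes \<Gamma> :: "'v pair_pre_digraph"
  assumes bidir: "pair_bidirected_digraph \<Gamma>"
    and connected: "connected_graph (with_proj \<Gamma>)"
    and loc_fin: "locally_finite (with_proj \<Gamma>)"
begin

abbreviation V :: "'v set" where "V \<equiv> pverts \<Gamma>"
abbreviation E :: "'v rel" where "E \<equiv> parcs \<Gamma>"
abbreviation "bipath \<equiv> biinfinite_path \<Gamma>"
abbreviation "kcut \<equiv> is_k_cut \<Gamma>"
abbreviation "Cmin \<equiv> min_cuts_splitting \<Gamma>"
abbreviation "crossings \<equiv> crossing_number \<Gamma>"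
abbreviation "Copt \<equiv> opt_cuts_splitting \<Gamma>"

lemma E_sub: "E \<subseteq> V \<times> V"
proof -
  interpret pair_bidirected_digraph \<Gamma> by (rule bidir)
  show ?thesis using arc_fst_in_verts arc_snd_in_verts by fastforce
qed

lemma sym_E: "sym E"
proof -
  interpret pair_bidirected_digraph \<Gamma> by (rule bidir)
  show ?thesis using sym_arcs by (simp add: symmetric_def)
qed

lemma E_sym: "(u, v) \<in> E \<Longrightarrow> (v, u) \<in> E"
  using sym_E by (rule symD)

lemma conn_V: "conn E V"
proof -
  have "with_proj \<Gamma> \<restriction> V = with_proj \<Gamma>" using E_sub by (auto simp: induce_subgraph_def with_proj_def)
  with connected show ?thesis using conn_iff_connected_graph[of \<Gamma> V] by simp
qed

lemma finite_nbrs: "finite (E `` {v})"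
proof (cases "v \<in> V")
  case True
  then have "finite (out_arcs (with_proj \<Gamma>) v)" using loc_fin by (simp add: locally_finite_def)
  moreover have "E `` {v} = snd ` out_arcs (with_proj \<Gamma>) v"
    by (auto simp: out_arcs_def image_iff)
  ultimately show ?thesis by simp
next
  case False
  then have "E `` {v} = {}" using E_sub by auto
  then show ?thesis by simp
qed

lemma boundary_eq: "boundary \<Gamma> C = bd E C"
  using E_sub by (auto simp: boundary_def bd_def)

lemma is_cut_iff: "is_cut \<Gamma> C \<longleftrightarrow> cut V E C"
  by (simp add: is_cut_def cut_def conn_iff_connected_graph boundary_eq)

lemma is_cut_compl: "is_cut \<Gamma> C \<Longrightarrow> is_cut \<Gamma> (V - C)"
  using bd_compl[OF sym_E E_sub, of C] by (auto simp: is_cut_iff cut_def double_diff)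

lemma card_boundary_compl: "C \<subseteq> V \<Longrightarrow> card (boundary \<Gamma> (V - C)) = card (boundary \<Gamma> C)"
  using bd_compl[OF sym_E E_sub, of C] by (simp add: boundary_eq)

lemma finite_bd_compl: "C \<subseteq> V \<Longrightarrow> finite (bd E C) \<Longrightarrow> finite (bd E (V - C))"
  using bd_compl[OF sym_E E_sub, of C] by simp

lemma is_cutD:
  assumes "is_cut \<Gamma> C"
  shows "C \<subseteq> V" "C \<noteq> {}" "V - C \<noteq> {}" "conn E C" "conn E (V - C)" "finite (bd E C)"
  using assms by (auto simp: is_cut_iff cut_def)

lemma finite_k_cuts_through: "finite {C. kcut k C \<and> (u, v) \<in> bd E C}"
  using finite_cuts_through_edge[OF sym_E E_sub conn_V, of k u v]
  by (simp add: is_k_cut_def is_cut_iff boundary_eq conj_assoc)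

primrec nbhd :: "nat \<Rightarrow> 'v set \<Rightarrow> 'v set" where
  "nbhd 0 S = S" |
  "nbhd (Suc n) S = nbhd n S \<union> E `` nbhd n S"

lemma finite_nbhd: "finite S \<Longrightarrow> finite (nbhd n S)"
proof (induction n)
  case (Suc n)
  have "E `` nbhd n S = (\<Union>v\<in>nbhd n S. E `` {v})" by auto
  with Suc finite_nbrs show ?case by simp
qed simp

lemma nbhd_mono: "m \<le> n \<Longrightarrow> nbhd m S \<subseteq> nbhd n S"
  by (rule lift_Suc_mono_le[where f = "\<lambda>i. nbhd i S"]) auto

lemma subset_nbhd: "S \<subseteq> nbhd n S"
  using nbhd_mono[of 0 n S] by simp

lemma nbhd_subset_V: "S \<subseteq> V \<Longrightarrow> nbhd n S \<subseteq> V"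
  by (induction n) (use E_sub in auto)

lemma nbhd_mono_set: "S \<subseteq> S' \<Longrightarrow> nbhd n S \<subseteq> nbhd n S'"
  by (induction n) auto

lemma nbhd_nbhd: "nbhd m (nbhd n S) = nbhd (m + n) S"
  by (induction m) auto

lemma nbhd_reach:
  "x \<in> nbhd n S \<Longrightarrow> \<exists>s\<in>S. (x, s) \<in> (E \<inter> nbhd n S \<times> nbhd n S)\<^sup>*"
proof (induction n arbitrary: x)
  case 0 then show ?case by auto
next
  case (Suc n)
  have lift: "(E \<inter> nbhd n S \<times> nbhd n S)\<^sup>* \<subseteq> (E \<inter> nbhd (Suc n) S \<times> nbhd (Suc n) S)\<^sup>*"
    by (rule rtrancl_mono) auto
  show ?case
  proof (cases "x \<in> nbhd n S")
    case True
    with Suc.IH lift show ?thesis by blast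
  next
    case False
    with Suc.prems obtain y where y: "y \<in> nbhd n S" "(y, x) \<in> E" by auto
    then obtain s where s: "s \<in> S" "(y, s) \<in> (E \<inter> nbhd n S \<times> nbhd n S)\<^sup>*" using Suc.IH by blast
    have "(x, y) \<in> E \<inter> nbhd (Suc n) S \<times> nbhd (Suc n) S" using y Suc.prems E_sym by auto
    with s lift show ?thesis by (meson converse_rtrancl_into_rtrancl subsetD)
  qed
qed

lemma conn_nbhd:
  assumes "conn E S"
  shows "conn E (nbhd n S)"
proof (cases "S = {}")
  case True
  then have "nbhd n S = {}" using nbhd_reach by blast
  then show ?thesis by (simp add: conn_def)
next
  case False
  then obtain s where s: "s \<in> S" by blast
  show ?thesis
  proof (rule conn_if_reach[OF sym_E, of _ s])
    fix x assume "x \<in> nbhd n S"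
    then obtain s' where s': "s' \<in> S" "(x, s') \<in> (E \<inter> nbhd n S \<times> nbhd n S)\<^sup>*" using nbhd_reach by blast
    have "(E \<inter> S \<times> S)\<^sup>* \<subseteq> (E \<inter> nbhd n S \<times> nbhd n S)\<^sup>*"
      by (rule rtrancl_mono) (use subset_nbhd in blast)
    moreover have "(s', s) \<in> (E \<inter> S \<times> S)\<^sup>*" using assms s s' by (auto simp: conn_def)
    ultimately show "(x, s) \<in> (E \<inter> nbhd n S \<times> nbhd n S)\<^sup>*" using s'(2) by (meson rtrancl_trans subsetD)
  qed
qed

lemma conn_ball: "conn E (nbhd n {v})"
  by (rule conn_nbhd) (simp add: conn_def)

lemma reach_nbhd: "(x, y) \<in> E\<^sup>* \<Longrightarrow> \<exists>n. y \<in> nbhd n {x}"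
proof (induction rule: rtrancl_induct)
  case base
  show ?case using subset_nbhd by blast
next
  case (step y z)
  then obtain n where "y \<in> nbhd n {x}" by blast
  with step have "z \<in> nbhd (Suc n) {x}" by auto
  then show ?case by blast
qed

lemma reach_V:
  assumes "x \<in> V" "y \<in> V"
  shows "(x, y) \<in> E\<^sup>*"
proof -
  have "(x, y) \<in> (E \<inter> V \<times> V)\<^sup>*" using conn_V assms by (auto simp: conn_def)
  then show ?thesis by (rule rtrancl_mono[THEN subsetD, rotated]) auto
qed

lemma finite_in_ball:
  assumes "finite S" "S \<subseteq> V" "v \<in> V"
  shows "\<exists>n. S \<subseteq> nbhd n {v}"
  using assms(1,2)
proof (induction S rule: finite_induct)
  case (insert x S)
  then obtain n where "S \<subseteq> nbhd n {v}" by auto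
  moreover obtain n' where "x \<in> nbhd n' {v}" using reach_nbhd reach_V assms(3) insert by blast
  moreover have "nbhd n {v} \<subseteq> nbhd (max n n') {v}" "nbhd n' {v} \<subseteq> nbhd (max n n') {v}"
    by (rule nbhd_mono, simp)+
  ultimately show ?case by (intro exI[of _ "max n n'"]) blast
qed simp

text \<open>The vertices incident with boundary edges, on both sides; not the ends of a graph in the
  sense of rays.\<close>

definition ends :: "'v set \<Rightarrow> 'v set" where
  "ends C = Domain (bd E C) \<union> Range (bd E C)"

lemma ends_subset: "ends C \<subseteq> V"
  using E_sub by (auto simp: ends_def bd_def)

lemma finite_ends: "finite (bd E C) \<Longrightarrow> finite (ends C)"
  by (simp add: ends_def finite_Domain finite_Range)

lemma in_ends: "(u, v) \<in> E \<Longrightarrow> u \<in> C \<Longrightarrow> v \<notin> C \<Longrightarrow> u \<in> ends C \<and> v \<in> ends C"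
  by (auto simp: ends_def bd_def)

lemma ends_compl: "C \<subseteq> V \<Longrightarrow> ends (V - C) = ends C"
  using bd_compl[OF sym_E E_sub, of C] by (auto simp: ends_def)

lemma ends_meet:
  assumes "is_cut \<Gamma> C"
  shows "ends C \<inter> C \<noteq> {}"
proof -
  obtain x y where "x \<in> V \<inter> C" "y \<in> V - C" using is_cutD[OF assms] by blast
  then obtain a b where "(a, b) \<in> E" "a \<in> C" "b \<notin> C" using conn_crossing[OF conn_V] by blast
  then show ?thesis using in_ends by blast
qed

text \<open>If \<open>D\<close> crosses \<open>C\<close>, then \<open>D\<close> and its complement,
  being connected and meeting both sides of \<open>C\<close>, each contain an end of
  \<open>C\<close>. So \<open>D\<close> cuts an edge of any connected set containing
  \<open>ends C\<close>; a finite ball is such a set, and only finitely many \<open>k\<close>-cuts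
  pass through each of its edges.\<close>

lemma finite_non_nested:
  assumes "is_cut \<Gamma> C"
  shows "finite {D. kcut k D \<and> \<not> nested \<Gamma> C D}"
proof -
  note C = is_cutD[OF assms]
  obtain v where v: "v \<in> V" using C by blast
  obtain n where n: "ends C \<subseteq> nbhd n {v}"
    using finite_in_ball[OF finite_ends[OF C(6)] ends_subset v] by blast
  define S where "S = nbhd n {v}"
  have S: "finite S" "conn E S" "ends C \<subseteq> S" "S \<subseteq> V"
    using n v finite_nbhd conn_ball nbhd_subset_V[of "{v}"] by (auto simp: S_def)
  have "{D. kcut k D \<and> \<not> nested \<Gamma> C D} \<subseteq>
    (\<Union>(a, b)\<in>S \<times> S. {D. kcut k D \<and> (a, b) \<in> bd E D})"
  proof clarify
    fix D assume D: "kcut k D" and nn: "\<not> nested \<Gamma> C D"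
    have D': "D \<subseteq> V" "conn E D" "conn E (V - D)" using D is_cutD by (auto simp: is_k_cut_def)
    obtain x y where "x \<in> D \<inter> C" "y \<in> D - C" using nn D'(1) C(1) by (auto simp: nested_def)
    then obtain a b where "(a, b) \<in> E" "a \<in> D \<inter> C" "b \<in> D - C" using conn_crossing[OF D'(2)] by blast
    then have a: "a \<in> D \<inter> S" using in_ends S by blast
    obtain x y where "x \<in> (V - D) \<inter> C" "y \<in> (V - D) - C" using nn D'(1) C(1) by (auto simp: nested_def)
    then obtain a' b' where "(a', b') \<in> E" "a' \<in> (V - D) \<inter> C" "b' \<in> (V - D) - C"
      using conn_crossing[OF D'(3)] by blast
    then have "a' \<in> S - D" using in_ends S by blast
    with a conn_crossing[OF S(2), of a D a'] obtain c d where "(c, d) \<in> E" "c \<in> S \<inter> D" "d \<in> S - D"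
      by blast
    with D show "D \<in> (\<Union>(a, b)\<in>S \<times> S. {D. kcut k D \<and> (a, b) \<in> bd E D})"
      by (auto simp: bd_def)
  qed
  moreover have "finite \<dots>" using S(1) finite_k_cuts_through by (auto intro: finite_UN_I)
  ultimately show ?thesis by (rule finite_subset)
qed

section \<open>Separating the two tails of a bi-infinite path\<close>

definition fwd :: "(int \<Rightarrow> 'v) \<Rightarrow> nat \<Rightarrow> 'v" where "fwd \<alpha> i = \<alpha> (int i)"
definition bwd :: "(int \<Rightarrow> 'v) \<Rightarrow> nat \<Rightarrow> 'v" where "bwd \<alpha> i = \<alpha> (- int i)"

text \<open>Defined for arbitrary sets because it is applied to the corners of two cuts, whose
  connectedness is not known in advance.\<close>

definition splits :: "(int \<Rightarrow> 'v) \<Rightarrow> 'v set \<Rightarrow> bool" where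
  "splits \<alpha> S \<longleftrightarrow> infinite (range \<alpha> \<inter> S) \<and> infinite (range \<alpha> \<inter> (V - S))"

lemma splits_compl: "S \<subseteq> V \<Longrightarrow> splits \<alpha> (V - S) \<longleftrightarrow> splits \<alpha> S"
  by (auto simp: splits_def double_diff)

lemma cuts_splitting_iff: "C \<in> cuts_splitting \<Gamma> \<alpha> \<longleftrightarrow> is_cut \<Gamma> C \<and> splits \<alpha> C"
  by (simp add: cuts_splitting_def splits_def)

lemma ray_fwd:
  assumes "bipath \<alpha>"
  shows "inj (fwd \<alpha>)" "(fwd \<alpha> i, fwd \<alpha> (Suc i)) \<in> E"
proof -
  show "inj (fwd \<alpha>)" using assms by (intro injI) (auto simp: fwd_def biinfinite_path_def dest: injD)
  have "(\<alpha> (int i), \<alpha> (int i + 1)) \<in> E" using assms by (simp add: biinfinite_path_def)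
  then show "(fwd \<alpha> i, fwd \<alpha> (Suc i)) \<in> E" by (simp add: fwd_def add.commute)
qed

lemma ray_bwd:
  assumes "bipath \<alpha>"
  shows "inj (bwd \<alpha>)" "(bwd \<alpha> i, bwd \<alpha> (Suc i)) \<in> E"
proof -
  show "inj (bwd \<alpha>)" using assms by (intro injI) (auto simp: bwd_def biinfinite_path_def dest: injD)
  have "(\<alpha> (- int (Suc i)), \<alpha> (- int (Suc i) + 1)) \<in> E"
    using assms unfolding biinfinite_path_def by blast
  then show "(bwd \<alpha> i, bwd \<alpha> (Suc i)) \<in> E" using E_sym by (simp add: bwd_def)
qed

lemma biinfinite_in_V: "bipath \<alpha> \<Longrightarrow> \<alpha> i \<in> V"
  using E_sub by (auto simp: biinfinite_path_def)

lemma range_fwd_bwd: "range \<alpha> = range (fwd \<alpha>) \<union> range (bwd \<alpha>)"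
proof -
  have "\<alpha> i \<in> range (fwd \<alpha>) \<union> range (bwd \<alpha>)" for i
    by (cases i rule: int_cases2) (auto simp: fwd_def bwd_def intro!: rangeI)
  then show ?thesis by (auto simp: fwd_def bwd_def)
qed

lemma tail_fwd:
  assumes "bipath \<alpha>" "finite (bd E S)"
  shows "tail_in (fwd \<alpha>) S \<or> tail_in (fwd \<alpha>) (V - S)"
proof -
  have "tail_in (fwd \<alpha>) V" using biinfinite_in_V[OF assms(1)] by (auto simp: tail_in_def fwd_def)
  with tail_dichotomy[OF sym_E assms(2) ray_fwd[OF assms(1)]] tail_in_Int[of "fwd \<alpha>" "- S" V]
  show ?thesis by (auto simp: Diff_eq Int_commute)
qed

lemma tail_bwd:
  assumes "bipath \<alpha>" "finite (bd E S)"
  shows "tail_in (bwd \<alpha>) S \<or> tail_in (bwd \<alpha>) (V - S)"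
proof -
  have "tail_in (bwd \<alpha>) V" using biinfinite_in_V[OF assms(1)] by (auto simp: tail_in_def bwd_def)
  with tail_dichotomy[OF sym_E assms(2) ray_bwd[OF assms(1)]] tail_in_Int[of "bwd \<alpha>" "- S" V]
  show ?thesis by (auto simp: Diff_eq Int_commute)
qed

lemma tail_in_finite_rest:
  assumes "tail_in \<beta> S" "S \<inter> S' = {}"
  shows "finite (range \<beta> \<inter> S')"
proof -
  obtain n where "\<And>i. i \<ge> n \<Longrightarrow> \<beta> i \<in> S" using assms by (auto simp: tail_in_def)
  then have "range \<beta> \<inter> S' \<subseteq> \<beta> ` {..<n}" using assms(2) by (force simp: not_less[symmetric])
  then show ?thesis by (rule finite_subset) simp
qed

lemma splits_iff_tails:
  assumes "bipath \<alpha>" "finite (bd E S)" "S \<subseteq> V"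
  shows "splits \<alpha> S \<longleftrightarrow> tail_in (fwd \<alpha>) S \<and> tail_in (bwd \<alpha>) (V - S) \<or>
    tail_in (fwd \<alpha>) (V - S) \<and> tail_in (bwd \<alpha>) S" (is "_ \<longleftrightarrow> ?R")
proof
  assume "splits \<alpha> S"
  then have inf: "infinite (range (fwd \<alpha>) \<inter> S \<union> range (bwd \<alpha>) \<inter> S)"
     "infinite (range (fwd \<alpha>) \<inter> (V - S) \<union> range (bwd \<alpha>) \<inter> (V - S))"
    unfolding splits_def range_fwd_bwd Int_Un_distrib2 by blast+
  have disj: "S \<inter> (V - S) = {}" "(V - S) \<inter> S = {}" by auto
  note fin = tail_in_finite_rest[OF _ disj(1)] tail_in_finite_rest[OF _ disj(2)]
  show ?R using tail_fwd[OF assms(1,2)] tail_bwd[OF assms(1,2)] inf fin by blast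
next
  assume R: ?R
  have "infinite (range \<alpha> \<inter> S')" if "tail_in (fwd \<alpha>) S' \<or> tail_in (bwd \<alpha>) S'" for S'
    using that tail_in_infinite[of "fwd \<alpha>" S'] tail_in_infinite[of "bwd \<alpha>" S']
      ray_fwd(1)[OF assms(1)] ray_bwd(1)[OF assms(1)]
    unfolding range_fwd_bwd Int_Un_distrib2 by blast
  with R show "splits \<alpha> S" unfolding splits_def by blast
qed

text \<open>The second tail only has to lie in some set disjoint from \<open>S\<close>, for example
  in another corner of two cuts.\<close>

lemma splits_if_tails:
  assumes "bipath \<alpha>" "finite (bd E S)" "S \<subseteq> V" "S \<inter> S' = {}"
    and "tail_in (fwd \<alpha>) S \<and> tail_in (bwd \<alpha>) S' \<or> tail_in (fwd \<alpha>) S' \<and> tail_in (bwd \<alpha>) S"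
  shows "splits \<alpha> S"
proof -
  have *: "\<not> (tail_in \<beta> S' \<and> tail_in \<beta> S)" for \<beta> using tail_in_disjoint[of \<beta> S S'] assms(4) by blast
  show ?thesis
    using splits_iff_tails[OF assms(1-3)] tail_fwd[OF assms(1,2)] tail_bwd[OF assms(1,2)] assms(5) *
    by blast
qed

text \<open>Cutting off the component of the forward tail, then taking the component of the backward
  tail in the rest, keeps the tails apart and only loses boundary edges. If none is lost,
  \<open>bd_determines\<close> shows that \<open>S\<close> was already a cut.\<close>

lemma cut_within:
  assumes \<alpha>: "bipath \<alpha>" and S: "finite (bd E S)" "S \<subseteq> V" "tail_in (fwd \<alpha>) S"
    "tail_in (bwd \<alpha>) (V - S)"
  shows "\<exists>C. is_cut \<Gamma> C \<and> splits \<alpha> C \<and> bd E C \<subseteq> bd E S \<and> (bd E C = bd E S \<longrightarrow> C = S)"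
proof -
  obtain n where n: "\<And>i. i \<ge> n \<Longrightarrow> fwd \<alpha> i \<in> S" using S(3) by (auto simp: tail_in_def)
  obtain n' where n': "\<And>i. i \<ge> n' \<Longrightarrow> bwd \<alpha> i \<in> V - S" using S(4) by (auto simp: tail_in_def)
  define A where "A = comp E S (fwd \<alpha> n)"
  define D where "D = comp E (V - A) (bwd \<alpha> n')"
  have A: "fwd \<alpha> i \<in> A" if "i \<ge> n" for i
    unfolding A_def by (rule ray_in_comp[of n "fwd \<alpha>" S E, OF n ray_fwd(2)[OF \<alpha>] that])
  have AS: "A \<subseteq> S" by (simp add: A_def comp_subset)
  then have out: "bwd \<alpha> i \<in> V - A" if "i \<ge> n'" for i using n' that by blast
  have D: "bwd \<alpha> i \<in> D" if "i \<ge> n'" for i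
    unfolding D_def by (rule ray_in_comp[of n' "bwd \<alpha>" "V - A" E, OF out ray_bwd(2)[OF \<alpha>] that])
  note cut = cut_off_component[OF sym_E E_sub conn_V S(2,1) n[OF order_refl] n'[OF order_refl],
      folded A_def, folded D_def]
  have DV: "D \<subseteq> V" using cut(1) by (simp add: cut_def)
  have fin: "finite (bd E (V - D))" using cut(2) by (simp add: cut_def)
  have "tail_in (fwd \<alpha>) (V - D)" "tail_in (bwd \<alpha>) D"
    unfolding tail_in_def using D A cut(4) by blast+
  then have "splits \<alpha> (V - D)" by (intro splits_if_tails[OF \<alpha> fin, of D]) auto
  moreover have "V - D = S" if "bd E (V - D) = bd E S"
    by (rule bd_determines[OF sym_E E_sub conn_V _ S(2) that]) (use A[of n] AS cut(4) in auto)
  ultimately show ?thesis using cut(2,3) by (auto simp: is_cut_iff)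
qed

lemma cut_within':
  assumes \<alpha>: "bipath \<alpha>" and S: "finite (bd E S)" "S \<subseteq> V" "splits \<alpha> S"
  shows "\<exists>C. is_cut \<Gamma> C \<and> splits \<alpha> C \<and> card (bd E C) \<le> card (bd E S) \<and>
    (card (bd E C) = card (bd E S) \<longrightarrow> C = S)"
proof -
  have *: "\<exists>C. is_cut \<Gamma> C \<and> splits \<alpha> C \<and> card (bd E C) \<le> card (bd E S) \<and>
    (card (bd E C) = card (bd E S) \<longrightarrow> C = S)"
    if S: "finite (bd E S)" "S \<subseteq> V" "tail_in (fwd \<alpha>) S" "tail_in (bwd \<alpha>) (V - S)" for S
  proof -
    obtain C where C: "is_cut \<Gamma> C" "splits \<alpha> C" "bd E C \<subseteq> bd E S" "bd E C = bd E S \<longrightarrow> C = S"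
      using cut_within[OF \<alpha> S] by blast
    then show ?thesis using card_mono[OF S(1) C(3)] card_subset_eq[OF S(1) C(3)]
      by (intro exI[of _ C]) blast
  qed
  show ?thesis
  proof (cases "tail_in (fwd \<alpha>) S \<and> tail_in (bwd \<alpha>) (V - S)")
    case False
    then have tails: "tail_in (fwd \<alpha>) (V - S)" "tail_in (bwd \<alpha>) S"
      using splits_iff_tails[OF \<alpha> S(1,2)] S(3) by blast+
    have VV: "V - (V - S) = S" using S(2) by blast
    obtain C where C: "is_cut \<Gamma> C" "splits \<alpha> C" "card (bd E C) \<le> card (bd E (V - S))"
        "card (bd E C) = card (bd E (V - S)) \<longrightarrow> C = V - S"
      using *[OF finite_bd_compl[OF S(2,1)]] tails VV by auto
    have CV: "C \<subseteq> V" using C(1) is_cutD by blast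
    have "card (bd E (V - C)) = card (bd E C)" "card (bd E (V - S)) = card (bd E S)"
      using card_boundary_compl CV S(2) by (simp_all add: boundary_eq)
    moreover have "is_cut \<Gamma> (V - C)" "splits \<alpha> (V - C)"
      using C is_cut_compl splits_compl CV by blast+
    ultimately show ?thesis using C(3,4) VV by (intro exI[of _ "V - C"]) auto
  qed (use * S in blast)
qed

section \<open>Minimal and optimal cuts of a path\<close>

lemma min_cuts_iff: "C \<in> Cmin \<alpha> \<longleftrightarrow> is_cut \<Gamma> C \<and> splits \<alpha> C \<and>
  (\<forall>D. is_cut \<Gamma> D \<and> splits \<alpha> D \<longrightarrow> card (bd E C) \<le> card (bd E D))"
  by (auto simp: min_cuts_splitting_def is_arg_min_def cuts_splitting_iff boundary_eq not_less)

lemma opt_cuts_splitting_iff: "C \<in> Copt k \<alpha> \<longleftrightarrow> C \<in> Cmin \<alpha> \<and>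
  (\<forall>D \<in> Cmin \<alpha>. crossings k C \<le> crossings k D)"
  by (auto simp: opt_cuts_splitting_def is_arg_min_def not_less)

text \<open>By \<open>cut_within'\<close> a splitting set is dominated by a splitting cut, with
  equal sizes only if it is that cut. So corners may compete with cuts, and a corner with few enough
  boundary edges is automatically a minimal cut.\<close>

lemma min_cut_le:
  assumes \<alpha>: "bipath \<alpha>" and C: "C \<in> Cmin \<alpha>"
    and S: "finite (bd E S)" "S \<subseteq> V" "splits \<alpha> S"
  shows "card (bd E C) \<le> card (bd E S)"
    and "card (bd E S) \<le> card (bd E C) \<Longrightarrow> S \<in> Cmin \<alpha>"
proof -
  obtain D where D: "is_cut \<Gamma> D" "splits \<alpha> D" "card (bd E D) \<le> card (bd E S)"
    "card (bd E D) = card (bd E S) \<longrightarrow> D = S" using cut_within'[OF \<alpha> S] by blast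
  then have le: "card (bd E C) \<le> card (bd E D)" using C by (auto simp: min_cuts_iff)
  with D show "card (bd E C) \<le> card (bd E S)" by simp
  assume "card (bd E S) \<le> card (bd E C)"
  with le D have eq: "D = S" "card (bd E S) = card (bd E C)" by auto
  with D C show "S \<in> Cmin \<alpha>" by (auto simp: min_cuts_iff)
qed

lemma min_cuts_compl:
  assumes "C \<in> Cmin \<alpha>"
  shows "V - C \<in> Cmin \<alpha>"
proof -
  have "C \<subseteq> V" using assms is_cutD by (auto simp: min_cuts_iff)
  with assms show ?thesis using is_cut_compl splits_compl card_boundary_compl
    by (simp add: min_cuts_iff boundary_eq)
qed

lemma nested_compl_left: "C \<subseteq> V \<Longrightarrow> nested \<Gamma> (V - C) D \<longleftrightarrow> nested \<Gamma> C D"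
  by (auto simp: nested_def double_diff)

lemma nested_compl_right: "D \<subseteq> V \<Longrightarrow> nested \<Gamma> C (V - D) \<longleftrightarrow> nested \<Gamma> C D"
  by (auto simp: nested_def double_diff)

lemma nested_commute: "C \<subseteq> V \<Longrightarrow> D \<subseteq> V \<Longrightarrow> nested \<Gamma> C D \<longleftrightarrow> nested \<Gamma> D C"
  by (auto simp: nested_def)

lemma crossing_number_compl: "C \<subseteq> V \<Longrightarrow> crossings k (V - C) = crossings k C"
  by (simp add: crossing_number_def nested_compl_left)

lemma opt_cuts_splitting_compl:
  assumes "C \<in> Copt k \<alpha>"
  shows "V - C \<in> Copt k \<alpha>"
proof -
  have "C \<subseteq> V" using assms is_cutD by (auto simp: min_cuts_iff opt_cuts_splitting_iff)
  with assms show ?thesis by (auto simp: opt_cuts_splitting_iff min_cuts_compl crossing_number_compl)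
qed

section \<open>Optimal cuts are nested\<close>

text \<open>Each element counts on the left at most as often as on the right; the count is strict if
  one is missed on the left altogether. Applied to boundaries and to sets of crossing cuts.\<close>

lemma card_two_covered:
  assumes "A \<union> B \<subseteq> C \<union> D" "A \<inter> B \<subseteq> C \<inter> D" "finite C" "finite D"
  shows "card A + card B \<le> card C + card D"
    and "A \<union> B \<noteq> C \<union> D \<Longrightarrow> card A + card B < card C + card D"
proof -
  have fin: "finite (C \<union> D)" "finite (C \<inter> D)" "finite A" "finite B"
    using assms by (auto intro: finite_subset[of _ "C \<union> D"])
  have eq: "card A + card B = card (A \<union> B) + card (A \<inter> B)"
    "card C + card D = card (C \<union> D) + card (C \<inter> D)"
    using card_Un_Int fin assms by blast+
  have int: "card (A \<inter> B) \<le> card (C \<inter> D)" by (rule card_mono) (use fin assms in auto)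
  moreover have "card (A \<union> B) \<le> card (C \<union> D)" by (rule card_mono) (use fin assms in auto)
  ultimately show "card A + card B \<le> card C + card D" using eq by linarith
  assume "A \<union> B \<noteq> C \<union> D"
  then have "card (A \<union> B) < card (C \<union> D)" by (intro psubset_card_mono) (use fin assms in auto)
  with int show "card A + card B < card C + card D" using eq by linarith
qed

text \<open>Submodularity of the boundary, in the form for opposite corners: the union is replaced
  by its complement, which has equally many boundary edges.\<close>

lemma card_bd_corners:
  assumes "C \<subseteq> V" "D \<subseteq> V" "finite (bd E C)" "finite (bd E D)"
  shows "finite (bd E (C \<inter> D))" "finite (bd E (V - (C \<union> D)))"
    "card (bd E (C \<inter> D)) + card (bd E (V - (C \<union> D))) \<le> card (bd E C) + card (bd E D)"
proof -
  have CD: "C \<union> D \<subseteq> V" using assms by blast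
  have sub: "bd E (C \<inter> D) \<union> bd E (C \<union> D) \<subseteq> bd E C \<union> bd E D" by (auto simp: bd_def)
  then show "finite (bd E (C \<inter> D))" using assms by (auto intro: finite_subset)
  have "finite (bd E (C \<union> D))" using assms sub by (auto intro: finite_subset)
  then show "finite (bd E (V - (C \<union> D)))" by (rule finite_bd_compl[OF CD])
  have "card (bd E (C \<inter> D)) + card (bd E (C \<union> D)) \<le> card (bd E C) + card (bd E D)"
    by (rule card_two_covered(1)[OF sub]) (use assms in \<open>auto simp: bd_def\<close>)
  then show "card (bd E (C \<inter> D)) + card (bd E (V - (C \<union> D))) \<le> card (bd E C) + card (bd E D)"
    using card_boundary_compl[OF CD] by (simp add: boundary_eq)
qed

text \<open>A cut nested with both \<open>C\<close> and \<open>D\<close> is nested with both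
  corners, and one nested with \<open>C\<close> or \<open>D\<close> is nested with at least one
  corner. The inequality is strict because \<open>C\<close> itself crosses \<open>D\<close> but is
  nested with both corners.\<close>

lemma crossing_number_corners:
  assumes C: "kcut k C" and D: "kcut k D" and nn: "\<not> nested \<Gamma> C D"
  shows "crossings k (C \<inter> D) + crossings k (V - (C \<union> D))
    < crossings k C + crossings k D"
  unfolding crossing_number_def
proof (rule card_two_covered(2))
  have CV: "C \<subseteq> V" "D \<subseteq> V" using C D is_cutD by (auto simp: is_k_cut_def)
  have F: "F \<subseteq> V" if "kcut k F" for F using that is_cutD by (auto simp: is_k_cut_def)
  let ?X = "\<lambda>C. {F. kcut k F \<and> \<not> nested \<Gamma> C F}"
  have both: "nested \<Gamma> (C \<inter> D) F \<and> nested \<Gamma> (V - (C \<union> D)) F"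
    if "F \<subseteq> V" "nested \<Gamma> C F" "nested \<Gamma> D F" for F
    using that CV nn unfolding nested_def by blast
  show "?X (C \<inter> D) \<union> ?X (V - (C \<union> D)) \<subseteq> ?X C \<union> ?X D"
    using both F by blast
  have one: "nested \<Gamma> (C \<inter> D) F \<or> nested \<Gamma> (V - (C \<union> D)) F"
    if "F \<subseteq> V" "nested \<Gamma> C F \<or> nested \<Gamma> D F" for F
    using that CV unfolding nested_def by blast
  show "?X (C \<inter> D) \<inter> ?X (V - (C \<union> D)) \<subseteq> ?X C \<inter> ?X D"
    using one F by blast
  have "\<not> nested \<Gamma> D C" using nn nested_commute CV by blast
  moreover have "nested \<Gamma> (C \<inter> D) C" "nested \<Gamma> (V - (C \<union> D)) C" by (auto simp: nested_def)
  ultimately show "?X (C \<inter> D) \<union> ?X (V - (C \<union> D)) \<noteq> ?X C \<union> ?X D"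
    using C by blast
qed (use C D finite_non_nested in \<open>auto simp: is_k_cut_def\<close>)

text \<open>Hence crossing optimal cuts are counted in each other's crossing numbers.\<close>

lemma min_cut_is_k_cut:
  assumes "accessible_bound \<Gamma> k" "bipath \<alpha>" "C \<in> Cmin \<alpha>"
  shows "kcut k C"
proof -
  have "cuts_splitting \<Gamma> \<alpha> \<noteq> {}" using assms(3) by (auto simp: cuts_splitting_iff min_cuts_iff)
  then obtain D where D: "D \<in> cuts_splitting \<Gamma> \<alpha>" "kcut k D"
    using assms(1,2) by (auto simp: accessible_bound_def)
  then have "card (bd E C) \<le> card (bd E D)"
    using assms(3) by (auto simp: cuts_splitting_iff min_cuts_iff)
  with D assms(3) show ?thesis by (auto simp: is_k_cut_def boundary_eq min_cuts_iff)
qed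

text \<open>If opposite corners can replace \<open>C\<close> and \<open>D\<close>, submodularity
  makes both corners minimal, and the strict drop of the crossing numbers contradicts optimality. In
  the third case both corners replace \<open>C\<close> for \<alpha>.\<close>

lemma corner_contradiction:
  assumes \<alpha>: "bipath \<alpha>" and \<beta>: "bipath \<beta>"
    and k: "accessible_bound \<Gamma> k"
    and C: "C \<in> Copt k \<alpha>" and D: "D \<in> Copt k \<beta>"
    and nn: "\<not> nested \<Gamma> C D"
  shows "\<not> (splits \<alpha> (C \<inter> D) \<and> splits \<beta> (V - (C \<union> D)))"
    and "\<not> (splits \<beta> (C \<inter> D) \<and> splits \<alpha> (V - (C \<union> D)))"
    and "\<not> (splits \<alpha> (C \<inter> D) \<and> splits \<alpha> (V - (C \<union> D)) \<and> splits \<alpha> D \<and> splits \<beta> C)"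
proof -
  have Cm: "C \<in> Cmin \<alpha>" and Dm: "D \<in> Cmin \<beta>"
    using C D by (auto simp: opt_cuts_splitting_iff)
  have kc: "kcut k C" "kcut k D" using min_cut_is_k_cut k \<alpha> \<beta> Cm Dm by blast+
  have C': "C \<subseteq> V" "finite (bd E C)" "splits \<alpha> C" and D': "D \<subseteq> V" "finite (bd E D)" "splits \<beta> D"
    using Cm Dm is_cutD by (auto simp: min_cuts_iff)
  note corner = card_bd_corners[OF C'(1) D'(1) C'(2) D'(2)]
  note less = crossing_number_corners[OF kc nn]
  have sub: "C \<inter> D \<subseteq> V" "V - (C \<union> D) \<subseteq> V" using C'(1) by auto
  let ?m = "crossings k"
  \<comment> \<open>\<open>F\<close> and \<open>F'\<close> supply only the optimal values for the
    two paths; in the third case both are \<open>C\<close> and both paths are \<alpha>.\<close>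
  have key: False if F: "F \<in> Copt k \<gamma>" "F' \<in> Copt k \<gamma>'"
    and \<gamma>: "bipath \<gamma>" "bipath \<gamma>'"
    and sum: "card (bd E F) + card (bd E F') = card (bd E C) + card (bd E D)" "?m F + ?m F' = ?m C + ?m D"
    and sp: "splits \<gamma> (C \<inter> D)" "splits \<gamma>' (V - (C \<union> D))" for F F' \<gamma> \<gamma>'
  proof -
    have Fm: "F \<in> Cmin \<gamma>" "F' \<in> Cmin \<gamma>'"
      using F by (auto simp: opt_cuts_splitting_iff)
    note 1 = min_cut_le[OF \<gamma>(1) Fm(1) corner(1) sub(1) sp(1)]
      and 2 = min_cut_le[OF \<gamma>(2) Fm(2) corner(2) sub(2) sp(2)]
    have "C \<inter> D \<in> Cmin \<gamma>" "V - (C \<union> D) \<in> Cmin \<gamma>'"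
      using 1 2 corner(3) sum(1) by auto
    then have "?m F \<le> ?m (C \<inter> D)" "?m F' \<le> ?m (V - (C \<union> D))"
      using F by (auto simp: opt_cuts_splitting_iff)
    with less sum(2) show False by linarith
  qed
  show "\<not> (splits \<alpha> (C \<inter> D) \<and> splits \<beta> (V - (C \<union> D)))" using key[OF C D \<alpha> \<beta>] by blast
  show "\<not> (splits \<beta> (C \<inter> D) \<and> splits \<alpha> (V - (C \<union> D)))" using key[OF D C \<beta> \<alpha>] by auto
  show "\<not> (splits \<alpha> (C \<inter> D) \<and> splits \<alpha> (V - (C \<union> D)) \<and> splits \<alpha> D \<and> splits \<beta> C)"
  proof
    assume *: "splits \<alpha> (C \<inter> D) \<and> splits \<alpha> (V - (C \<union> D)) \<and> splits \<alpha> D \<and> splits \<beta> C"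
    \<comment> \<open>Each of the two cuts splits the path of the other, so their sizes agree, each
      is minimal for both paths, and their crossing numbers agree as well.\<close>
    note CD = min_cut_le[OF \<alpha> Cm D'(2,1)] and DC = min_cut_le[OF \<beta> Dm C'(2,1)]
    have "D \<in> Cmin \<alpha>" "C \<in> Cmin \<beta>"
      and eq: "card (bd E C) = card (bd E D)"
      using CD DC * by auto
    then have "?m C = ?m D"
      using C D by (auto simp: opt_cuts_splitting_iff intro: antisym)
    with * eq show False using key[OF C C \<alpha> \<alpha>] by simp
  qed
qed

text \<open>One tail lies in a corner inside \<open>C\<close>, the other in a corner outside. The
  first two cases are the pairs of opposite corners, in which \<open>D\<close> separates the tails
  too; the last two are pairs on one side of \<open>D\<close>.\<close>

lemma corner_tails:
  assumes \<alpha>: "bipath \<alpha>" and C: "C \<subseteq> V" "finite (bd E C)" and D: "D \<subseteq> V" "finite (bd E D)"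
    and "splits \<alpha> C"
  shows "splits \<alpha> (C \<inter> D) \<and> splits \<alpha> (V - (C \<union> D)) \<and> splits \<alpha> D \<or>
    splits \<alpha> (C \<inter> (V - D)) \<and> splits \<alpha> (V - (C \<union> (V - D))) \<and> splits \<alpha> D \<or>
    splits \<alpha> (C \<inter> D) \<and> splits \<alpha> (V - (C \<union> (V - D))) \<or>
    splits \<alpha> (C \<inter> (V - D)) \<and> splits \<alpha> (V - (C \<union> D))"
proof -
  let ?a = "C \<inter> D" and ?b = "V - (C \<union> D)" and ?c = "C \<inter> (V - D)" and ?d = "V - (C \<union> (V - D))"
  note D' = Diff_subset[of V D] finite_bd_compl[OF D]
  note f1 = card_bd_corners(1,2)[OF C(1) D(1) C(2) D(2)] and f2 = card_bd_corners(1,2)[OF C(1) D'(1) C(2) D'(2)]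
  have e: "(V - C) \<inter> D = ?d" "(V - C) \<inter> (V - D) = ?b" using D by auto
  have sp: "splits \<alpha> S \<and> splits \<alpha> S'"
    if "finite (bd E S)" "finite (bd E S')" "S \<subseteq> V" "S' \<subseteq> V" "S \<inter> S' = {}"
      "tail_in (fwd \<alpha>) S \<and> tail_in (bwd \<alpha>) S' \<or> tail_in (fwd \<alpha>) S' \<and> tail_in (bwd \<alpha>) S" for S S'
    using splits_if_tails[OF \<alpha> that(1,3,5)] splits_if_tails[OF \<alpha> that(2,4), of S] that by blast
  have corner: "tail_in \<gamma> ?a \<or> tail_in \<gamma> ?c" if "tail_in \<gamma> C" "\<gamma> = fwd \<alpha> \<or> \<gamma> = bwd \<alpha>" for \<gamma>
    using that tail_in_Int[of \<gamma> C D] tail_in_Int[of \<gamma> C "V - D"] tail_fwd[OF \<alpha> D(2)] tail_bwd[OF \<alpha> D(2)] by blast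
  have corner': "tail_in \<gamma> ?d \<or> tail_in \<gamma> ?b"
    if "tail_in \<gamma> (V - C)" "\<gamma> = fwd \<alpha> \<or> \<gamma> = bwd \<alpha>" for \<gamma>
    using that tail_in_Int[of \<gamma> "V - C" D] tail_in_Int[of \<gamma> "V - C" "V - D"]
      tail_fwd[OF \<alpha> D(2)] tail_bwd[OF \<alpha> D(2)] unfolding e by blast
  let ?t = "\<lambda>S S'. tail_in (fwd \<alpha>) S \<and> tail_in (bwd \<alpha>) S' \<or> tail_in (fwd \<alpha>) S' \<and> tail_in (bwd \<alpha>) S"
  have tails: "?t C (V - C)" using splits_iff_tails[OF \<alpha> C(2,1)] assms(6) by blast
  then consider "?t ?a ?b" | "?t ?c ?d"
    | "?t ?a ?d" | "?t ?c ?b"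
    using corner corner' by metis
  then show ?thesis
  proof cases
    case 1
    then have "?t D (V - D)"
      using tail_in_mono[of _ ?a D] tail_in_mono[of _ ?b "V - D"] by blast
    then have "splits \<alpha> D" using splits_iff_tails[OF \<alpha> D(2,1)] by blast
    moreover have "splits \<alpha> ?a \<and> splits \<alpha> ?b"
      by (rule sp[OF f1 _ _ _ 1]) (use C in auto)
    ultimately show ?thesis by blast
  next
    case 2
    then have "?t D (V - D)"
      using tail_in_mono[of _ ?c "V - D"] tail_in_mono[of _ ?d D] by blast
    then have "splits \<alpha> D" using splits_iff_tails[OF \<alpha> D(2,1)] by blast
    moreover have "splits \<alpha> ?c \<and> splits \<alpha> ?d"
      by (rule sp[OF f2 _ _ _ 2]) (use C in auto)
    ultimately show ?thesis by blast
  next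
    case 3
    have "splits \<alpha> ?a \<and> splits \<alpha> ?d"
      by (rule sp[OF f1(1) f2(2) _ _ _ 3]) (use C in auto)
    then show ?thesis by blast
  next
    case 4
    have "splits \<alpha> ?c \<and> splits \<alpha> ?b"
      by (rule sp[OF f2(1) f1(2) _ _ _ 4]) (use C in auto)
    then show ?thesis by blast
  qed
qed

lemma opt_cut_is_cut: "C \<in> opt_cuts \<Gamma> k \<Longrightarrow> is_cut \<Gamma> C"
  by (auto simp: opt_cuts_def opt_cuts_splitting_iff min_cuts_iff)

lemma opt_cuts_compl: "C \<in> opt_cuts \<Gamma> k \<Longrightarrow> V - C \<in> opt_cuts \<Gamma> k"
  using opt_cuts_splitting_compl by (auto simp: opt_cuts_def)

lemma opt_cut_is_k_cut:
  "accessible_bound \<Gamma> k \<Longrightarrow> C \<in> opt_cuts \<Gamma> k \<Longrightarrow> kcut k C"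
  using min_cut_is_k_cut by (auto simp: opt_cuts_def opt_cuts_splitting_iff)

text \<open>The ends of \<open>\<alpha>\<close> lie in two of the four corners of \<open>C\<close> and \<open>D\<close>, as do those of \<open>\<beta>\<close>. Unless
  \<open>\<alpha>\<close> occupies one pair of opposite corners and \<open>\<beta>\<close> the other one, some end of \<open>\<alpha>\<close> and some end
  of \<open>\<beta>\<close> lie in opposite corners.\<close>

theorem opt_cuts_nested:
  assumes k: "accessible_bound \<Gamma> k" and "C \<in> opt_cuts \<Gamma> k" "D \<in> opt_cuts \<Gamma> k"
  shows "nested \<Gamma> C D"
proof (rule ccontr)
  assume nn: "\<not> nested \<Gamma> C D"
  obtain \<alpha> \<beta> where \<alpha>: "bipath \<alpha>" and C: "C \<in> Copt k \<alpha>"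
    and \<beta>: "bipath \<beta>" and D: "D \<in> Copt k \<beta>"
    using assms by (auto simp: opt_cuts_def)
  have C': "C \<subseteq> V" "finite (bd E C)" "splits \<alpha> C" and D': "D \<subseteq> V" "finite (bd E D)" "splits \<beta> D"
    using C D is_cutD by (auto simp: min_cuts_iff opt_cuts_splitting_iff)
  have nn': "\<not> nested \<Gamma> C (V - D)" using nn nested_compl_right D'(1) by blast
  have e: "D \<inter> C = C \<inter> D" "V - (D \<union> C) = V - (C \<union> D)" "D \<inter> (V - C) = V - (C \<union> (V - D))"
    "V - (D \<union> (V - C)) = C \<inter> (V - D)" using C' D' by auto
  have spD: "splits \<alpha> (V - D) = splits \<alpha> D" using splits_compl D'(1) .
  \<comment> \<open>Adjacent or equal positions of the paths fall under the first two conclusions of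
    \<open>corner_contradiction\<close>, for \<open>D\<close> or for \<open>V - D\<close>; different
    opposite pairs fall under the third.\<close>
  show False
    using corner_tails[OF \<alpha> C'(1,2) D'(1,2) C'(3)] corner_tails[OF \<beta> D'(1,2) C'(1,2) D'(3)]
      corner_contradiction[OF \<alpha> \<beta> k C D nn]
      corner_contradiction[OF \<alpha> \<beta> k C opt_cuts_splitting_compl[OF D] nn']
    unfolding e spD by argo
qed

lemma ray_cut_from_ball:
  assumes sep: "rays_separated V E K" and ray: "inj \<beta>" "\<And>i. (\<beta> i, \<beta> (Suc i)) \<in> E" and v: "v \<in> V"
  shows "\<exists>D m. cut V E D \<and> card (bd E D) \<le> K \<and> nbhd n {v} \<subseteq> D \<and> (\<forall>i\<ge>m. \<beta> i \<in> V - D)"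
proof -
  have "finite (nbhd n {v})" by (simp add: finite_nbhd)
  moreover have "nbhd n {v} \<subseteq> V" using v by (simp add: nbhd_subset_V)
  moreover have "nbhd n {v} \<noteq> {}" using subset_nbhd[of "{v}" n] by auto
  moreover have "conn E (nbhd n {v})" by (rule conn_ball)
  ultimately have "\<exists>D. cut V E D \<and> card (bd E D) \<le> K \<and> nbhd n {v} \<subseteq> D \<and> (\<exists>m. \<forall>i\<ge>m. \<beta> i \<in> V - D)"
    using sep[unfolded rays_separated_def, rule_format, of \<beta> "nbhd n {v}"] ray by simp
  then show ?thesis by metis
qed

text \<open>A cut with a large finite set on one side, and with a tail of the path on the other, is
  eventually nested with any given cut, hence splits every path which that cut splits.\<close>

lemma accessible_if_rays_separated:
  assumes sep: "rays_separated V E K"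
  shows "accessible_bound \<Gamma> K"
  unfolding accessible_bound_def
proof (intro allI impI disjCI)
  fix \<alpha> assume \<alpha>: "bipath \<alpha>" and none: "\<not> (\<exists>C\<in>cuts_splitting \<Gamma> \<alpha>. kcut K C)"
  have "\<not> (is_cut \<Gamma> C \<and> tail_in (fwd \<alpha>) C \<and> tail_in (bwd \<alpha>) (V - C))" for C
  proof
    assume "is_cut \<Gamma> C \<and> tail_in (fwd \<alpha>) C \<and> tail_in (bwd \<alpha>) (V - C)"
    then have C: "is_cut \<Gamma> C" and tails: "tail_in (fwd \<alpha>) C" "tail_in (bwd \<alpha>) (V - C)" by auto
    obtain v where v: "v \<in> V" using is_cutD(1,2)[OF C] by blast
    obtain n where n: "ends C \<subseteq> nbhd n {v}"
      using finite_in_ball[OF finite_ends[OF is_cutD(6)[OF C]] ends_subset v] by blast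
    obtain D m where D: "cut V E D" "card (bd E D) \<le> K" "nbhd n {v} \<subseteq> D"
      and m: "\<forall>i\<ge>m. fwd \<alpha> i \<in> V - D"
      using ray_cut_from_ball[OF sep ray_fwd[OF \<alpha>] v] by metis
    have cD: "is_cut \<Gamma> D" using D by (simp add: is_cut_iff)
    have tD: "tail_in (fwd \<alpha>) (V - D)" using m by (auto simp: tail_in_def)
    \<comment> \<open>\<open>V - D\<close> is connected and meets \<open>C\<close>, but contains no
      end of \<open>C\<close>, as these lie in the ball inside \<open>D\<close>.\<close>
    have "V - D \<subseteq> C"
    proof (rule ccontr)
      assume "\<not> V - D \<subseteq> C"
      then obtain y where y: "y \<in> (V - D) - C" by blast
      obtain x where x: "x \<in> (V - D) \<inter> C"
        using tail_in_disjoint[OF tD tails(1)] by blast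
      obtain a b where "(a, b) \<in> E" "a \<in> (V - D) \<inter> C" "b \<in> (V - D) - C"
        using conn_crossing[OF is_cutD(5)[OF cD] x y] by blast
      then have "a \<in> ends C" "a \<notin> D" using in_ends by blast+
      with n D(3) show False by blast
    qed
    then have "tail_in (bwd \<alpha>) D" using tail_in_mono[OF tails(2)] by blast
    then have "splits \<alpha> D"
      by (intro splits_if_tails[OF \<alpha> is_cutD(6)[OF cD] is_cutD(1)[OF cD], of "V - D"]) (use tD in auto)
    with cD D none show False by (auto simp: cuts_splitting_iff is_k_cut_def boundary_eq)
  qed
  note * = this
  have "\<not> (is_cut \<Gamma> C \<and> splits \<alpha> C)" for C
  proof
    assume C: "is_cut \<Gamma> C \<and> splits \<alpha> C"
    then have "C \<subseteq> V" "finite (bd E C)" "V - (V - C) = C" using is_cutD by blast+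
    with C show False using splits_iff_tails[OF \<alpha>, of C] *[of C] *[of "V - C"] is_cut_compl by auto
  qed
  then show "cuts_splitting \<Gamma> \<alpha> = {}" by (auto simp: cuts_splitting_iff)
qed

end

section \<open>The structure tree\<close>

locale opt_graph = lf_graph +
  fixes k :: nat
  assumes acc: "accessible_bound \<Gamma> k"
begin

abbreviation Opt :: "'a set set" where "Opt \<equiv> opt_cuts \<Gamma> k"
abbreviation R :: "'a set rel" where "R \<equiv> cut_rel \<Gamma> k"
abbreviation cls :: "'a set \<Rightarrow> 'a set set" where "cls \<equiv> cut_class \<Gamma> k"

lemma Opt_sub: "C \<in> Opt \<Longrightarrow> C \<subseteq> V"
  and Opt_nonempty: "C \<in> Opt \<Longrightarrow> C \<noteq> {}"
  and Opt_proper: "C \<in> Opt \<Longrightarrow> V - C \<noteq> {}"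
  using opt_cut_is_cut is_cutD by blast+

lemma Opt_compl: "C \<in> Opt \<Longrightarrow> V - C \<in> Opt"
  by (rule opt_cuts_compl)

lemma Opt_compl_compl: "C \<in> Opt \<Longrightarrow> V - (V - C) = C"
  using Opt_sub by blast

lemma Opt_nested:
  assumes "C \<in> Opt" "D \<in> Opt"
  shows "C \<subseteq> D \<or> C \<subseteq> V - D \<or> V - C \<subseteq> D \<or> D \<subseteq> C"
  using opt_cuts_nested[OF acc assms] Opt_sub assms unfolding nested_def by blast

text \<open>All these cuts separate a fixed vertex of \<open>C\<close> from a fixed vertex outside
  \<open>D\<close>, hence pass through one of finitely many edges. This discreteness provides
  immediate successors among optimal cuts.\<close>

lemma finite_Opt_between:
  assumes "C \<in> Opt" "D \<in> Opt"
  shows "finite {F \<in> Opt. C \<subseteq> F \<and> F \<subseteq> D}"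
proof -
  obtain x y where xy: "x \<in> C" "y \<in> V - D" using Opt_nonempty Opt_proper assms by blast
  have "x \<in> V" using xy Opt_sub assms by blast
  then obtain P where P: "finite P" "P \<subseteq> E" "(x, y) \<in> P\<^sup>*"
    using rtrancl_finite_subrel[OF reach_V] xy by blast
  have "{F \<in> Opt. C \<subseteq> F \<and> F \<subseteq> D} \<subseteq> (\<Union>(a, b)\<in>P. {F. kcut k F \<and> (a, b) \<in> bd E F})"
  proof clarify
    fix F assume F: "F \<in> Opt" "C \<subseteq> F" "F \<subseteq> D"
    then obtain a b where "(a, b) \<in> P" "a \<in> F" "b \<notin> F" using rtrancl_crossing[OF P(3), of F] xy by blast
    with P(2) F(1) show "F \<in> (\<Union>(a, b)\<in>P. {F. kcut k F \<and> (a, b) \<in> bd E F})"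
      using opt_cut_is_k_cut[OF acc] by (auto simp: bd_def)
  qed
  moreover have "finite \<dots>" using P(1) finite_k_cuts_through by (auto intro: finite_UN_I)
  ultimately show ?thesis by (rule finite_subset)
qed

section \<open>The equivalence of optimal cuts\<close>

lemma cut_rel_iff: "(C, D) \<in> R \<longleftrightarrow> C \<in> Opt \<and> D \<in> Opt \<and>
    (C = D \<or> V - C \<subset> D \<and> (\<forall>F\<in>Opt. V - C \<subset> F \<and> F \<subseteq> D \<longrightarrow> D = F))"
  by (auto simp: cut_rel_def)

text \<open>Complementation reverses inclusion and turns a cut between \<open>V - D\<close> and
  \<open>C\<close> into one between \<open>V - C\<close> and \<open>D\<close>.\<close>

lemma cut_rel_sym:
  assumes "(C, D) \<in> R"
  shows "(D, C) \<in> R"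
proof (cases "C = D")
  case False
  with assms have CD: "C \<in> Opt" "D \<in> Opt" "V - C \<subset> D"
    "\<And>F. F \<in> Opt \<Longrightarrow> V - C \<subset> F \<Longrightarrow> F \<subseteq> D \<Longrightarrow> D = F" by (auto simp: cut_rel_iff)
  have sub: "C \<subseteq> V" "D \<subseteq> V" using CD Opt_sub by blast+
  have "C = F" if F: "F \<in> Opt" "V - D \<subset> F" "F \<subseteq> C" for F
  proof (rule ccontr)
    assume "C \<noteq> F"
    have "F \<subseteq> V" using F Opt_sub by blast
    have "V - C \<subset> V - F" "V - F \<subseteq> D" using F \<open>C \<noteq> F\<close> sub by blast+
    then have "D = V - F" using CD(4)[OF Opt_compl[OF F(1)]] by blast
    with F \<open>F \<subseteq> V\<close> show False by blast
  qed
  moreover have "V - D \<subset> C" using CD(3) sub by blast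
  ultimately show ?thesis using CD by (auto simp: cut_rel_iff)
qed (use assms in simp)

text \<open>Both \<open>C\<close> and \<open>F\<close> lie minimally above \<open>V - D\<close>, so
  they are incomparable if distinct, and they are not disjoint. Nestedness leaves only that they
  cover \<open>V\<close>.\<close>

lemma cut_rel_trans:
  assumes "(C, D) \<in> R" "(D, F) \<in> R"
  shows "(C, F) \<in> R"
proof (cases "C = D \<or> D = F \<or> C = F")
  case True
  with assms show ?thesis by (auto simp: cut_rel_iff)
next
  case False
  with assms have CD: "C \<in> Opt" "D \<in> Opt" "V - C \<subset> D"
    "\<And>H. H \<in> Opt \<Longrightarrow> V - C \<subset> H \<Longrightarrow> H \<subseteq> D \<Longrightarrow> D = H" by (auto simp: cut_rel_iff)
  from False assms have DF: "F \<in> Opt" "V - D \<subset> F"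
    "\<And>H. H \<in> Opt \<Longrightarrow> V - D \<subset> H \<Longrightarrow> H \<subseteq> F \<Longrightarrow> F = H" by (auto simp: cut_rel_iff)
  note sub = Opt_sub[OF CD(1)] Opt_sub[OF CD(2)] Opt_sub[OF DF(1)]
  note pr = Opt_proper[OF CD(1)] Opt_proper[OF CD(2)] Opt_proper[OF DF(1)]
  have DC: "V - D \<subset> C" using CD(3) sub by blast
  have "\<not> C \<subseteq> F" using DF(3)[OF CD(1) DC] False by blast
  moreover have "\<not> F \<subseteq> C"
  proof
    assume "F \<subseteq> C"
    moreover have "\<And>H. H \<in> Opt \<Longrightarrow> V - D \<subset> H \<Longrightarrow> H \<subseteq> C \<Longrightarrow> C = H"
      using cut_rel_sym[OF assms(1)] False by (auto simp: cut_rel_iff)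
    ultimately show False using DF False by blast
  qed
  moreover have "\<not> C \<subseteq> V - F" using DC DF(2) pr by blast
  ultimately have "V - C \<subseteq> F" using Opt_nested[OF CD(1) DF(1)] by blast
  moreover have "V - C \<noteq> F" using CD(3) DF(2) pr by blast
  ultimately have lt: "V - C \<subset> F" by blast
  have "F = H" if H: "H \<in> Opt" "V - C \<subset> H" "H \<subseteq> F" for H
  proof -
    have "\<not> H \<subseteq> D" using CD(4)[OF H(1,2)] H(3) DF(2) sub pr by blast
    moreover have "\<not> D \<subseteq> H" using H(3) DF(2) sub pr by blast
    moreover have "\<not> H \<subseteq> V - D" using H(2) CD(3) sub pr by blast
    ultimately have "V - D \<subseteq> H" using Opt_nested[OF CD(2) H(1)] Opt_sub[OF H(1)] by blast
    moreover have "V - D \<noteq> H" using H(2) CD(3) sub pr by blast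
    ultimately show ?thesis using DF(3)[OF H(1)] H(3) by blast
  qed
  with lt CD DF show ?thesis by (auto simp: cut_rel_iff)
qed

lemma equiv_cut_rel: "equiv Opt R"
proof (rule equivI)
  show "R \<subseteq> Opt \<times> Opt" by (auto simp: cut_rel_iff)
  show "refl_on Opt R" by (auto simp: refl_on_def cut_rel_iff)
  show "sym R" using cut_rel_sym by (auto simp: sym_def)
  show "trans R" using cut_rel_trans by (auto simp: trans_def)
qed

lemma cls_eq_iff: "C \<in> Opt \<Longrightarrow> D \<in> Opt \<Longrightarrow> cls C = cls D \<longleftrightarrow> (C, D) \<in> R"
  unfolding cut_class_def by (rule eq_equiv_class_iff[OF equiv_cut_rel])

lemma in_cls_iff: "D \<in> cls C \<longleftrightarrow> (C, D) \<in> R"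
  by (simp add: cut_class_def)

lemma cls_in_quotient: "C \<in> Opt \<Longrightarrow> cls C \<in> Opt // R"
  unfolding cut_class_def by (rule quotientI)

lemma quotient_obtain:
  assumes "X \<in> Opt // R"
  obtains C where "C \<in> Opt" "X = cls C" "C \<in> X"
proof -
  obtain C where "C \<in> Opt" "X = R `` {C}" using assms by (rule quotientE)
  then show thesis using that[of C] by (auto simp: cut_class_def cut_rel_iff)
qed

section \<open>The structure graph is a tree\<close>

abbreviation T :: "('a set set, 'a set) pre_digraph" where "T \<equiv> structure_tree \<Gamma> k"
abbreviation "T_rev \<equiv> structure_tree_rev \<Gamma> k"

lemma T_simps: "verts T = Opt // R" "arcs T = Opt" "tail T = cls" "head T C = cls (V - C)"
  by (simp_all add: structure_tree_def)

lemma bidirected_T: "bidirected_digraph T (T_rev)"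
proof -
  interpret wf_digraph T
    by unfold_locales (auto simp: T_simps cls_in_quotient Opt_compl)
  show ?thesis
  proof (rule bidirected_digraphI)
    fix C assume C: "C \<in> arcs T"
    then show "T_rev C \<noteq> C"
      using Opt_nonempty Opt_proper by (auto simp: structure_tree_rev_def T_simps)
    from C show "T_rev (T_rev C) = C"
      using Opt_compl Opt_compl_compl by (auto simp: structure_tree_rev_def T_simps)
    from C show "tail T (T_rev C) = head T C"
      by (simp add: structure_tree_rev_def T_simps)
  qed (simp add: structure_tree_rev_def T_simps)
qed

sublocale T: bidirected_digraph T "T_rev"
  by (rule bidirected_T)

text \<open>If no optimal cut lies strictly between \<open>C\<close> and \<open>D\<close>, then
  \<open>V - C\<close> and \<open>D\<close> are equivalent, so the arc \<open>C\<close> leads from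
  \<open>[C]\<close> to \<open>[D]\<close>. In general finitely many such steps suffice.\<close>

lemma reach_subset:
  assumes "C \<in> Opt" "D \<in> Opt" "C \<subseteq> D"
  shows "cls C \<rightarrow>\<^sup>*\<^bsub>T\<^esub> cls D"
  using assms
proof (induction "card {F \<in> Opt. C \<subseteq> F \<and> F \<subseteq> D}" arbitrary: C D rule: less_induct)
  case less
  have cC: "cls C \<in> verts T" using less.prems by (simp add: T_simps cls_in_quotient)
  show ?case
  proof (cases "\<exists>F\<in>Opt. C \<subset> F \<and> F \<subset> D")
    case True
    then obtain F where F: "F \<in> Opt" "C \<subset> F" "F \<subset> D" by blast
    have "card {H \<in> Opt. C \<subseteq> H \<and> H \<subseteq> F} < card {H \<in> Opt. C \<subseteq> H \<and> H \<subseteq> D}"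
      by (rule psubset_card_mono[OF finite_Opt_between]) (use less.prems F in auto)
    moreover have "card {H \<in> Opt. F \<subseteq> H \<and> H \<subseteq> D} < card {H \<in> Opt. C \<subseteq> H \<and> H \<subseteq> D}"
      by (rule psubset_card_mono[OF finite_Opt_between]) (use less.prems F in auto)
    ultimately have "cls C \<rightarrow>\<^sup>*\<^bsub>T\<^esub> cls F" "cls F \<rightarrow>\<^sup>*\<^bsub>T\<^esub> cls D"
      using less.hyps less.prems F by blast+
    then show ?thesis by (rule T.reachable_trans)
  next
    case False
    show ?thesis
    proof (cases "C = D")
      case True
      with cC show ?thesis by simp
    next
      case ne: False
      have VV: "V - (V - C) = C" using Opt_compl_compl less.prems by blast
      have "(V - C, D) \<in> R" unfolding cut_rel_iff VV using False less.prems ne Opt_compl by blast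
      then have "head T C = cls D" using cls_eq_iff Opt_compl less.prems by (simp add: T_simps)
      moreover have "C \<in> arcs T" "tail T C = cls C" using less.prems by (simp_all add: T_simps)
      ultimately have "cls C \<rightarrow>\<^bsub>T\<^esub> cls D" by (metis T.dominatesI arc_to_ends_def)
      then show ?thesis by (rule T.reachable_adjI)
    qed
  qed
qed

lemma reach_compl:
  assumes "C \<in> Opt"
  shows "cls C \<rightarrow>\<^sup>*\<^bsub>T\<^esub> cls (V - C)"
proof -
  have "C \<in> arcs T" "arc_to_ends T C = (cls C, cls (V - C))"
    using assms by (simp_all add: T_simps arc_to_ends_def)
  then have "cls C \<rightarrow>\<^bsub>T\<^esub> cls (V - C)" by (rule T.dominatesI[rotated])
  then show ?thesis by (rule T.reachable_adjI)
qed

lemma connected_T: "connected_graph T"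
  unfolding connected_graph_def
proof (intro ballI)
  fix X Y assume "X \<in> verts T" "Y \<in> verts T"
  then obtain C D where C: "C \<in> Opt" "X = cls C" and D: "D \<in> Opt" "Y = cls D"
    unfolding T_simps by (metis quotient_obtain)
  have r: "cls F \<rightarrow>\<^sup>*\<^bsub>T\<^esub> cls H \<Longrightarrow> cls H \<rightarrow>\<^sup>*\<^bsub>T\<^esub> cls F" for F H
    by (rule T.symmetric_reachable')
  consider "C \<subseteq> D" | "C \<subseteq> V - D" | "V - C \<subseteq> D" | "D \<subseteq> C" using Opt_nested C D by blast
  then show "X \<rightarrow>\<^sup>*\<^bsub>T\<^esub> Y" unfolding C D
  proof cases
    case 1 then show "cls C \<rightarrow>\<^sup>*\<^bsub>T\<^esub> cls D" using reach_subset C D by blast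
  next
    case 2 then show "cls C \<rightarrow>\<^sup>*\<^bsub>T\<^esub> cls D"
      using reach_subset[OF C(1) Opt_compl[OF D(1)]] r[OF reach_compl[OF D(1)]] T.reachable_trans by blast
  next
    case 3 then show "cls C \<rightarrow>\<^sup>*\<^bsub>T\<^esub> cls D"
      using reach_subset[OF Opt_compl[OF C(1)] D(1)] reach_compl[OF C(1)] T.reachable_trans by blast
  next
    case 4 then show "cls C \<rightarrow>\<^sup>*\<^bsub>T\<^esub> cls D" using reach_subset r C D by blast
  qed
qed

lemma consecutive:
  assumes "C \<in> Opt" "D \<in> Opt" "head T C = tail T D"
  shows "D = V - C \<or> C \<subset> D"
proof -
  have "(V - C, D) \<in> R" using assms cls_eq_iff Opt_compl by (simp add: T_simps)
  with Opt_compl_compl[OF assms(1)] show ?thesis by (auto simp: cut_rel_iff)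
qed

lemma walk_increasing:
  assumes "T.awalk u (C # p) v" "successively (\<lambda>C D. D \<noteq> V - C) (C # p)"
  shows "C \<subseteq> last (C # p) \<and> (p \<noteq> [] \<longrightarrow> C \<subset> last (C # p))"
  using assms
proof (induction p arbitrary: u C)
  case (Cons D p)
  have "C \<in> Opt" "D \<in> Opt" "head T C = tail T D" "T.awalk (tail T D) (D # p) v"
    using Cons.prems by (auto simp: T.awalk_simps T_simps)
  moreover have "D \<subseteq> last (D # p)" using Cons.IH[OF calculation(4)] Cons.prems by auto
  ultimately show ?case using consecutive[of C D] Cons.prems by auto
qed simp

text \<open>Along a walk without backtracking the cuts grow strictly, so such a walk cannot close
  up.\<close>

lemma cycle_T:
  assumes "T.cycle p"
  shows "\<exists>C. p = [C, T_rev C]"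
proof (rule ccontr)
  assume neg: "\<not> ?thesis"
  obtain u where w: "T.awalk u p u" and d: "distinct (tl (T.awalk_verts u p))" and ne: "p \<noteq> []"
    using assms by (auto simp: T.cycle_def)
  have sub: "set p \<subseteq> Opt" using w by (auto simp: T.awalk_def T_simps)
  obtain C q where p: "p = C # q" using ne by (cases p) auto
  have tC: "cls C = u" using w unfolding p by (simp add: T.awalk_simps T_simps)
  have hl: "head T (last p) = u"
    using w ne T.awalk_verts_conv[of u p] T.awalk_ends[OF w]
    by (metis T.awalkE last_snoc)
  have tails: "distinct (map cls p)"
    using d T.awalk_verts_conv[of u p] ne hl tC by (simp add: p T_simps)
  \<comment> \<open>Backtracking along \<open>D\<close> returns to the class of \<open>D\<close>. As
    tails are distinct on a cycle, this can only happen at its end, and then the whole cycle is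
    \<open>D\<close> and its reverse.\<close>
  have no_back: "successively (\<lambda>C D. D \<noteq> V - C) p"
  proof (rule ccontr)
    assume "\<not> successively (\<lambda>C D. D \<noteq> V - C) p"
    then obtain xs D ys where D: "p = xs @ D # (V - D) # ys"
      by (auto simp: successively_conv_nth) (metis (no_types, lifting) Cons_nth_drop_Suc Suc_lessD append_take_drop_id)
    have "D \<in> Opt" using D sub by auto
    then have h: "head T (V - D) = cls D" using Opt_compl_compl by (simp add: T_simps)
    show False
    proof (cases ys)
      case Nil
      then have "cls D = cls C" using hl h tC D by simp
      then have "xs = []" using tails p D by (cases xs) auto
      with D Nil neg \<open>D \<in> Opt\<close> show False by (auto simp: structure_tree_rev_def)
    next
      case (Cons H zs)
      have "T.awalk u ((xs @ [D, V - D]) @ H # zs) u" using w D Cons by simp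
      then have "head T (V - D) = tail T H" by (auto simp: T.awalk_simps T.awalk_append_iff)
      then have "cls D = cls H" using h by (simp add: T_simps)
      with tails D Cons show False by simp
    qed
  qed
  have inc: "C \<subseteq> last p" "q \<noteq> [] \<Longrightarrow> C \<subset> last p" using walk_increasing[of u C q u] w no_back by (auto simp: p)
  have Opt: "last p \<in> Opt" "C \<in> Opt" using sub p by (auto split: if_splits)
  then consider "C = V - last p" | "last p \<subset> C"
    using consecutive[of "last p" C] hl tC by (auto simp: T_simps)
  then show False
  proof cases
    case 1
    show False using inc(1) 1 Opt Opt_nonempty by blast
  qed (use inc in blast)
qed

lemma tree_T: "undirected_tree T (T_rev)"
  using bidirected_T connected_T cycle_T by (simp add: undirected_tree_def)

text \<open>\<open>D\<close> is the first edge on the way from the vertex \<open>X\<close> to the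
  edge \<open>F\<close>: starting from a member \<open>C\<close> that does not serve already, a
  minimal optimal cut above \<open>V - C\<close> and inside the far side of \<open>F\<close> is
  equivalent to \<open>C\<close>.\<close>

lemma edge_towards:
  assumes "X \<in> Opt // R" "F \<in> Opt"
  shows "\<exists>D\<in>X. D \<subseteq> F \<or> D \<subseteq> V - F"
proof -
  obtain C where C: "C \<in> Opt" "X = cls C" "C \<in> X" using assms(1) by (rule quotient_obtain)
  have *: "\<exists>D\<in>X. D \<subseteq> F \<or> D \<subseteq> V - F" if F: "F \<in> Opt" "F \<subset> C" for F
  proof -
    define S where "S = {H \<in> Opt. V - C \<subset> H \<and> H \<subseteq> V - F}"
    have "S \<subseteq> {H \<in> Opt. V - C \<subseteq> H \<and> H \<subseteq> V - F}" by (auto simp: S_def)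
    moreover have "finite {H \<in> Opt. V - C \<subseteq> H \<and> H \<subseteq> V - F}"
      using finite_Opt_between[OF Opt_compl[OF C(1)] Opt_compl[OF F(1)]] .
    ultimately have "finite S" by (rule finite_subset)
    moreover have "V - F \<in> S" using F Opt_compl[OF F(1)] Opt_sub[OF C(1)] by (auto simp: S_def)
    ultimately obtain D where "D \<in> S" and min: "\<And>H. H \<in> S \<Longrightarrow> H \<subseteq> D \<Longrightarrow> D = H"
      using finite_has_minimal[of S] by auto
    then have D: "D \<in> Opt" "V - C \<subset> D" "D \<subseteq> V - F" by (auto simp: S_def)
    have "D = H" if "H \<in> Opt" "V - C \<subset> H" "H \<subseteq> D" for H
      using min[of H] that D by (auto simp: S_def)
    then have "(C, D) \<in> R" using C(1) D by (auto simp: cut_rel_iff)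
    with D C(2) show ?thesis by (auto simp: in_cls_iff)
  qed
  consider "C \<subseteq> F \<or> C \<subseteq> V - F" | "F \<subset> C" | "V - F \<subset> C" using Opt_nested[OF C(1) assms(2)] Opt_sub assms(2) C(1) by blast
  then show ?thesis
  proof cases
    case 3
    then show ?thesis using *[OF Opt_compl[OF assms(2)]] Opt_compl_compl[OF assms(2)] by auto
  qed (use C * assms in blast)+
qed

text \<open>A common point \<open>w\<close> produces \<open>D0\<close> in \<open>Y\<close>, inside
  it \<open>D\<close> in \<open>X\<close>, and inside that \<open>D1\<close> in \<open>Y\<close>.
  Distinct members of a class cover \<open>V\<close>, which forces all three to coincide. Later this
  shows that an element moving a point of \<open>\<Inter>X\<close> within \<open>\<Inter>X\<close>
  stabilizes \<open>X\<close>.\<close>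

lemma block_unique:
  assumes X: "X \<in> Opt // R" and Y: "Y \<in> Opt // R" and w: "w \<in> \<Inter>X" "w \<in> \<Inter>Y"
  shows "X = Y"
proof -
  obtain D0 where D0: "D0 \<in> Opt" "Y = cls D0" "D0 \<in> Y" using Y by (rule quotient_obtain)
  obtain C0 where C0: "C0 \<in> Opt" "X = cls C0" "C0 \<in> X" using X by (rule quotient_obtain)
  obtain D where D: "D \<in> X" "D \<subseteq> D0" using edge_towards[OF X D0(1)] w D0(3) by blast
  then have DR: "(C0, D) \<in> R" using C0 by (simp add: in_cls_iff)
  then have DO: "D \<in> Opt" by (simp add: cut_rel_iff)
  obtain D1 where D1: "D1 \<in> Y" "D1 \<subseteq> D" using edge_towards[OF Y DO] w D(1) by blast
  then have "(D0, D1) \<in> R" using D0 by (simp add: in_cls_iff)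
  then have "D0 = D1" using D1 D Opt_proper[OF D0(1)] by (auto simp: cut_rel_iff)
  then have "D = D0" using D1 D by blast
  then show ?thesis using DR C0 D0 cls_eq_iff by blast
qed

section \<open>Automorphisms\<close>

text \<open>The inverse is carried along so that each converse inclusion follows by
  \<open>aut_sym\<close>.\<close>

definition aut :: "('a \<Rightarrow> 'a) \<Rightarrow> ('a \<Rightarrow> 'a) \<Rightarrow> bool" where
  "aut f f' \<longleftrightarrow> (\<forall>x\<in>V. f x \<in> V \<and> f' x \<in> V \<and> f' (f x) = x \<and> f (f' x) = x) \<and>
    (\<forall>u v. (u, v) \<in> E \<longrightarrow> (f u, f v) \<in> E \<and> (f' u, f' v) \<in> E)"

lemma aut_sym: "aut f f' \<Longrightarrow> aut f' f"
  by (simp add: aut_def)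

lemma aut_inj: "aut f f' \<Longrightarrow> inj_on f V"
  unfolding aut_def by (metis inj_on_inverseI)

lemma aut_V: "aut f f' \<Longrightarrow> f ` V = V"
  unfolding aut_def by force

lemma aut_sub: "aut f f' \<Longrightarrow> C \<subseteq> V \<Longrightarrow> f ` C \<subseteq> V"
  using aut_V by blast

lemma aut_image_inv:
  assumes "aut f f'" "C \<subseteq> V"
  shows "f' ` f ` C = C"
proof -
  have "f' (f x) = x" if "x \<in> C" for x using assms that by (auto simp: aut_def)
  then show ?thesis by (simp add: image_image)
qed

lemma aut_compl: "aut f f' \<Longrightarrow> C \<subseteq> V \<Longrightarrow> f ` (V - C) = V - f ` C"
  using inj_on_image_set_diff[of f V V C] aut_inj aut_V by (metis Diff_subset)

lemma aut_subset_iff: "aut f f' \<Longrightarrow> C \<subseteq> V \<Longrightarrow> D \<subseteq> V \<Longrightarrow> f ` C \<subseteq> f ` D \<longleftrightarrow> C \<subseteq> D"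
  by (metis aut_image_inv image_mono)

lemma aut_eq_iff: "aut f f' \<Longrightarrow> C \<subseteq> V \<Longrightarrow> D \<subseteq> V \<Longrightarrow> f ` C = f ` D \<longleftrightarrow> C = D"
  using inj_on_image_eq_iff[OF aut_inj] by blast

lemma aut_bd:
  assumes "aut f f'" "C \<subseteq> V"
  shows "bd E (f ` C) = map_prod f f ` bd E C"
proof
  show "bd E (f ` C) \<subseteq> map_prod f f ` bd E C"
  proof (rule subrelI)
    fix a b assume ab: "(a, b) \<in> bd E (f ` C)"
    then have V: "a \<in> V" "b \<in> V" using E_sub by (auto simp: bd_def)
    then have eq: "f (f' a) = a" "f (f' b) = b" using assms(1) by (auto simp: aut_def)
    have "f' a \<in> C" using ab aut_image_inv[OF assms] by (auto simp: bd_def)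
    moreover have "f' b \<notin> C" using ab imageI[of "f' b" C f] eq(2) by (auto simp: bd_def)
    moreover have "(f' a, f' b) \<in> E" using ab assms(1) by (auto simp: aut_def bd_def)
    ultimately have "(f' a, f' b) \<in> bd E C" by (simp add: bd_def)
    then show "(a, b) \<in> map_prod f f ` bd E C" using eq by (metis map_prod_imageI)
  qed
  show "map_prod f f ` bd E C \<subseteq> bd E (f ` C)"
  proof clarsimp
    fix a b assume "(a, b) \<in> bd E C"
    moreover then have "b \<in> V" using E_sub by (auto simp: bd_def)
    ultimately show "(f a, f b) \<in> bd E (f ` C)" using assms inj_on_image_mem_iff[OF aut_inj[OF assms(1)], of b C]
      by (auto simp: bd_def aut_def)
  qed
qed

lemma aut_conn:
  assumes "aut f f'" "conn E C"
  shows "conn E (f ` C)"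
  unfolding conn_def
proof (clarify)
  fix x y assume "x \<in> C" "y \<in> C"
  then have "(x, y) \<in> (E \<inter> C \<times> C)\<^sup>*" using assms by (auto simp: conn_def)
  then show "(f x, f y) \<in> (E \<inter> f ` C \<times> f ` C)\<^sup>*"
  proof (induction rule: rtrancl_induct)
    case (step y z)
    then have "(f y, f z) \<in> E \<inter> f ` C \<times> f ` C" using assms(1) by (auto simp: aut_def)
    with step.IH show ?case by (rule rtrancl.rtrancl_into_rtrancl)
  qed simp
qed

lemma aut_is_cut:
  assumes "aut f f'" "is_cut \<Gamma> C"
  shows "is_cut \<Gamma> (f ` C)"
proof -
  note C = is_cutD[OF assms(2)]
  show ?thesis unfolding is_cut_iff cut_def
    using C aut_sub[OF assms(1) C(1)] aut_conn[OF assms(1)] aut_bd[OF assms(1) C(1)]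
    by (simp flip: aut_compl[OF assms(1) C(1)])
qed

lemma aut_card_bd:
  assumes "aut f f'" "C \<subseteq> V"
  shows "card (bd E (f ` C)) = card (bd E C)"
proof -
  have "bd E C \<subseteq> V \<times> V" using E_sub by (auto simp: bd_def)
  then have "inj_on (map_prod f f) (bd E C)"
    by (rule inj_on_subset[OF map_prod_inj_on[OF aut_inj[OF assms(1)] aut_inj[OF assms(1)]]])
  then show ?thesis unfolding aut_bd[OF assms] by (rule card_image)
qed

lemma aut_is_k_cut: "aut f f' \<Longrightarrow> kcut n C \<Longrightarrow> kcut n (f ` C)"
  using aut_is_cut aut_card_bd is_cutD(1) by (auto simp: is_k_cut_def boundary_eq)

lemma aut_nested:
  assumes "aut f f'" "C \<subseteq> V" "D \<subseteq> V"
  shows "nested \<Gamma> (f ` C) (f ` D) \<longleftrightarrow> nested \<Gamma> C D"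
  unfolding nested_def
  using aut_subset_iff[OF assms(1)] assms(2,3)
  by (simp flip: aut_compl[OF assms(1,2)] aut_compl[OF assms(1,3)])

lemma aut_crossing_number:
  assumes "aut f f'" "C \<subseteq> V"
  shows "crossings n (f ` C) = crossings n C"
proof -
  let ?X = "\<lambda>C. {D. kcut n D \<and> \<not> nested \<Gamma> C D}"
  have *: "f ` D \<in> ?X (f ` C)"
    if "aut f f'" "C \<subseteq> V" "D \<in> ?X C" for f f' C D
    using that aut_is_k_cut[OF that(1)] aut_nested[OF that(1)] is_cutD(1)[of D] by (auto simp: is_k_cut_def)
  have sub: "D \<subseteq> V" if "kcut n D" for D using that is_cutD by (auto simp: is_k_cut_def)
  have "bij_betw (image f) (?X C) (?X (f ` C))"
  proof (rule bij_betw_byWitness[where f' = "image f'"])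
    show "image f ` ?X C \<subseteq> ?X (f ` C)"
      using *[OF assms] by blast
    show "image f' ` ?X (f ` C) \<subseteq> ?X C"
      using *[OF aut_sym[OF assms(1)] aut_sub[OF assms]] aut_image_inv[OF assms] by auto
    show "\<forall>D\<in>?X C. f' ` f ` D = D"
      using sub aut_image_inv[OF assms(1)] by simp
    show "\<forall>D\<in>?X (f ` C). f ` f' ` D = D"
      using sub aut_image_inv[OF aut_sym[OF assms(1)]] by simp
  qed
  then show ?thesis unfolding crossing_number_def by (rule bij_betw_same_card[symmetric])
qed

lemma aut_biinfinite:
  assumes "aut f f'" "bipath \<alpha>"
  shows "bipath (f \<circ> \<alpha>)"
proof -
  have "inj_on f (range \<alpha>)" using aut_inj[OF assms(1)] biinfinite_in_V[OF assms(2)] by (auto intro: inj_on_subset)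
  then show ?thesis using assms by (auto simp: biinfinite_path_def aut_def comp_inj_on)
qed

lemma aut_splits:
  assumes "aut f f'" "bipath \<alpha>" "C \<subseteq> V" "splits \<alpha> C"
  shows "splits (f \<circ> \<alpha>) (f ` C)"
proof -
  have r: "range \<alpha> \<subseteq> V" using biinfinite_in_V[OF assms(2)] by auto
  have *: "infinite (range (f \<circ> \<alpha>) \<inter> f ` S)" if "S \<subseteq> V" "infinite (range \<alpha> \<inter> S)" for S
  proof -
    have "range (f \<circ> \<alpha>) \<inter> f ` S = f ` (range \<alpha> \<inter> S)"
      using inj_on_image_Int[OF aut_inj[OF assms(1)] r that(1)] by (simp add: image_comp)
    moreover have "inj_on f (range \<alpha> \<inter> S)" using aut_inj[OF assms(1)] that(1) by (auto intro: inj_on_subset)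
    ultimately show ?thesis using that(2) by (simp add: finite_image_iff)
  qed
  show ?thesis using assms(4) *[OF assms(3)] *[of "V - C"]
    by (simp add: splits_def aut_compl[OF assms(1,3)])
qed

lemma aut_back:
  assumes "aut f f'" "bipath \<alpha>"
  shows "f' \<circ> (f \<circ> \<alpha>) = \<alpha>"
  using assms biinfinite_in_V[OF assms(2)] by (auto simp: aut_def)

lemma aut_min_cuts:
  assumes "aut f f'" "bipath \<alpha>" "C \<in> Cmin \<alpha>"
  shows "f ` C \<in> Cmin (f \<circ> \<alpha>)"
proof -
  have C: "is_cut \<Gamma> C" "splits \<alpha> C" "C \<subseteq> V" using assms(3) is_cutD(1) by (auto simp: min_cuts_iff)
  have "card (bd E (f ` C)) \<le> card (bd E D)" if D: "is_cut \<Gamma> D" "splits (f \<circ> \<alpha>) D" for D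
  proof -
    note f' = aut_sym[OF assms(1)]
    have DV: "D \<subseteq> V" using D is_cutD(1) by blast
    have "splits \<alpha> (f' ` D)"
      using aut_splits[OF f' aut_biinfinite[OF assms(1,2)] DV D(2)] aut_back[OF assms(1,2)] by simp
    then have "card (bd E C) \<le> card (bd E (f' ` D))"
      using assms(3) aut_is_cut[OF f' D(1)] by (auto simp: min_cuts_iff)
    then show ?thesis using aut_card_bd[OF f' DV] aut_card_bd[OF assms(1) C(3)] by simp
  qed
  then show ?thesis using aut_is_cut[OF assms(1) C(1)] aut_splits[OF assms(1,2) C(3,2)]
    by (simp add: min_cuts_iff)
qed

lemma aut_opt_cuts_splitting:
  assumes "aut f f'" "bipath \<alpha>" "C \<in> Copt n \<alpha>"
  shows "f ` C \<in> Copt n (f \<circ> \<alpha>)"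
proof -
  have C: "C \<in> Cmin \<alpha>" "C \<subseteq> V"
    using assms(3) is_cutD(1) by (auto simp: min_cuts_iff opt_cuts_splitting_iff)
  have "crossings n (f ` C) \<le> crossings n D" if D: "D \<in> Cmin (f \<circ> \<alpha>)" for D
  proof -
    note f' = aut_sym[OF assms(1)]
    have DV: "D \<subseteq> V" using D is_cutD(1) by (auto simp: min_cuts_iff)
    have "f' ` D \<in> Cmin \<alpha>"
      using aut_min_cuts[OF f' aut_biinfinite[OF assms(1,2)] D] aut_back[OF assms(1,2)] by simp
    then have "crossings n C \<le> crossings n (f' ` D)"
      using assms(3) by (auto simp: opt_cuts_splitting_iff)
    then show ?thesis using aut_crossing_number[OF f' DV] aut_crossing_number[OF assms(1) C(2)] by simp
  qed
  then show ?thesis using aut_min_cuts[OF assms(1,2) C(1)] by (simp add: opt_cuts_splitting_iff)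
qed

lemma aut_Opt:
  assumes "aut f f'" "C \<in> Opt"
  shows "f ` C \<in> Opt"
  using assms(2) aut_opt_cuts_splitting[OF assms(1)] aut_biinfinite[OF assms(1)]
  unfolding opt_cuts_def by blast

lemma aut_cut_rel:
  assumes f: "aut f f'" and "(C, D) \<in> R"
  shows "(f ` C, f ` D) \<in> R"
proof (cases "C = D")
  case True
  with assms show ?thesis using aut_Opt[OF f] by (auto simp: cut_rel_iff)
next
  case False
  with assms have CD: "C \<in> Opt" "D \<in> Opt" "V - C \<subset> D"
    "\<And>F. F \<in> Opt \<Longrightarrow> V - C \<subset> F \<Longrightarrow> F \<subseteq> D \<Longrightarrow> D = F" by (auto simp: cut_rel_iff)
  have sub: "C \<subseteq> V" "D \<subseteq> V" using CD Opt_sub by blast+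
  have less: "V - f ` C \<subset> f ` A \<longleftrightarrow> V - C \<subset> A" if "A \<subseteq> V" for A
    using aut_subset_iff[OF f] aut_eq_iff[OF f] that
    by (simp flip: aut_compl[OF f sub(1)] add: psubset_eq)
  have "f ` D = F" if F: "F \<in> Opt" "V - f ` C \<subset> F" "F \<subseteq> f ` D" for F
  proof -
    have FV: "F \<subseteq> V" using F Opt_sub by blast
    have F': "f ` f' ` F = F" "f' ` F \<in> Opt" "f' ` F \<subseteq> V"
      using aut_image_inv[OF aut_sym[OF f] FV] aut_Opt[OF aut_sym[OF f] F(1)] aut_sub[OF aut_sym[OF f] FV] by auto
    then have "D = f' ` F"
      using CD(4)[OF F'(2)] less[OF F'(3)] aut_subset_iff[OF f F'(3) sub(2)] F by auto
    then show ?thesis using F' by simp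
  qed
  then show ?thesis using CD less[OF sub(2)] aut_Opt[OF f] by (auto simp: cut_rel_iff)
qed

lemma aut_cls:
  assumes f: "aut f f'" and C: "C \<in> Opt"
  shows "cls (f ` C) = image f ` cls C"
proof
  show "image f ` cls C \<subseteq> cls (f ` C)"
    using aut_cut_rel[OF f] by (auto simp: in_cls_iff)
  show "cls (f ` C) \<subseteq> image f ` cls C"
  proof
    fix D assume "D \<in> cls (f ` C)"
    then have R: "(f ` C, D) \<in> R" by (simp add: in_cls_iff)
    then have DV: "D \<subseteq> V" using Opt_sub by (auto simp: cut_rel_iff)
    have "(f' ` f ` C, f' ` D) \<in> R" using aut_cut_rel[OF aut_sym[OF f] R] .
    then have "f' ` D \<in> cls C" using aut_image_inv[OF f] Opt_sub C by (simp add: in_cls_iff)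
    then show "D \<in> image f ` cls C"
      using aut_image_inv[OF aut_sym[OF f] DV] by (intro image_eqI[of _ _ "f' ` D"]) auto
  qed
qed

lemma aut_Image_E:
  assumes "aut f f'" "S \<subseteq> V"
  shows "E `` (f ` S) = f ` (E `` S)"
proof
  show "f ` (E `` S) \<subseteq> E `` (f ` S)" using assms(1) by (fastforce simp: aut_def)
  show "E `` (f ` S) \<subseteq> f ` (E `` S)"
  proof clarify
    fix s y assume s: "s \<in> S" "(f s, y) \<in> E"
    then have "(f' (f s), f' y) \<in> E" "f' (f s) = s" "f (f' y) = y"
      using assms E_sub by (auto simp: aut_def)
    with s show "y \<in> f ` (E `` S)" by (metis ImageI image_eqI)
  qed
qed

lemma aut_nbhd:
  assumes "aut f f'" "S \<subseteq> V"
  shows "nbhd n (f ` S) = f ` nbhd n S"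
  by (induction n) (simp_all add: aut_Image_E[OF assms(1) nbhd_subset_V[OF assms(2)]] image_Un)

lemma aut_ends:
  assumes "aut f f'" "C \<subseteq> V"
  shows "ends (f ` C) = f ` ends C"
  unfolding ends_def aut_bd[OF assms] by force

text \<open>The oriented boundary is fixed pointwise and some end in \<open>C\<close> stays in
  \<open>C\<close>, so \<open>bd_determines\<close> applies.\<close>

lemma aut_Opt_fixed:
  assumes f: "aut f f'" and C: "C \<in> Opt" and fixed: "\<And>x. x \<in> ends C \<Longrightarrow> f x = x"
  shows "f ` C = C"
proof -
  have CV: "C \<subseteq> V" using C Opt_sub by blast
  have "\<forall>p\<in>bd E C. map_prod f f p = p" using fixed in_ends unfolding bd_def by fastforce
  then have "bd E (f ` C) = bd E C" unfolding aut_bd[OF f CV] by (simp add: image_cong)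
  moreover obtain x where x: "x \<in> ends C" "x \<in> C" using ends_meet[OF opt_cut_is_cut[OF C]] by blast
  then have "x \<in> f ` C \<inter> C" using fixed[of x] by force
  ultimately show ?thesis
    using bd_determines[OF sym_E E_sub conn_V aut_sub[OF f CV] CV] by blast
qed

end

section \<open>The action on the structure tree\<close>

lemma group_actionI:
  fixes G (structure)
  assumes G: "group G"
    and closed: "\<And>g x. g \<in> carrier G \<Longrightarrow> x \<in> S \<Longrightarrow> f g x \<in> S"
    and one: "\<And>x. x \<in> S \<Longrightarrow> f \<one> x = x"
    and mult: "\<And>g h x. g \<in> carrier G \<Longrightarrow> h \<in> carrier G \<Longrightarrow> x \<in> S \<Longrightarrow> f (g \<otimes> h) x = f g (f h x)"
  shows "group_action G S (\<lambda>g. restrict (f g) S)"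
proof -
  interpret group G by (rule G)
  have bij: "restrict (f g) S \<in> Bij S" if g: "g \<in> carrier G" for g
  proof -
    have "bij_betw (f g) S S"
    proof (rule bij_betw_byWitness[where f' = "f (inv g)"])
      show "\<forall>x\<in>S. f (inv g) (f g x) = x" "\<forall>x\<in>S. f g (f (inv g) x) = x"
        using g mult[of "inv g" g] mult[of g "inv g"] one by auto
    qed (use g closed in auto)
    then show ?thesis by (simp add: Bij_def)
  qed
  have "(\<lambda>g. restrict (f g) S) \<in> hom G (BijGroup S)"
  proof (rule homI)
    fix g h assume gh: "g \<in> carrier G" "h \<in> carrier G"
    have "restrict (f (g \<otimes> h)) S = compose S (restrict (f g) S) (restrict (f h) S)"
      using gh closed mult by (auto simp: compose_def fun_eq_iff)
    then show "restrict (f (g \<otimes> h)) S = restrict (f g) S \<otimes>\<^bsub>BijGroup S\<^esub> restrict (f h) S"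
      using bij gh by (simp add: BijGroup_def)
  qed (use bij in \<open>simp add: BijGroup_def\<close>)
  then show ?thesis
    using G group_BijGroup by (simp add: group_action_def group_hom_def group_hom_axioms_def)
qed

lemma (in group_action) finite_orbitsI:
  assumes "finite Q" "\<And>x. x \<in> E \<Longrightarrow> \<exists>g\<in>carrier G. \<phi> g x \<in> Q"
  shows "finite (orbits G E \<phi>)"
proof -
  interpret group G using group_hom group_hom.axioms(1) by auto
  have "orbits G E \<phi> \<subseteq> orbit G \<phi> ` (Q \<inter> E)"
  proof
    fix Y assume "Y \<in> orbits G E \<phi>"
    then obtain x where x: "x \<in> E" "Y = orbit G \<phi> x" by (auto simp: orbits_def)
    obtain g where g: "g \<in> carrier G" "\<phi> g x \<in> Q" using assms(2) x by blast
    have gx: "\<phi> g x \<in> E" using element_image g x by blast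
    have "\<phi> h (\<phi> g x) = \<phi> (h \<otimes> g) x" if "h \<in> carrier G" for h
      using composition_rule[OF x(1) that g(1)] by simp
    moreover have "\<phi> h x = \<phi> (h \<otimes> inv g) (\<phi> g x)" if "h \<in> carrier G" for h
      using composition_rule[OF gx that, of "inv g"] orbit_sym_aux[OF g(1) x(1)] g by simp
    ultimately have "orbit G \<phi> (\<phi> g x) = orbit G \<phi> x"
      using g(1) unfolding orbit_def by (safe; metis m_closed inv_closed)
    then show "Y \<in> orbit G \<phi> ` (Q \<inter> E)" using x g gx by auto
  qed
  then show ?thesis using assms(1) by (auto intro: finite_subset)
qed

lemma (in group_action) finite_orbitsE:
  assumes "finite (orbits G E \<phi>)"
  obtains Q where "finite Q" "Q \<subseteq> E" "\<And>x. x \<in> E \<Longrightarrow> \<exists>g\<in>carrier G. \<phi> g x \<in> Q"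
proof
  define rep where "rep Y = (SOME x. x \<in> Y \<and> x \<in> E)" for Y
  have rep: "rep (orbit G \<phi> x) \<in> orbit G \<phi> x \<and> rep (orbit G \<phi> x) \<in> E" if "x \<in> E" for x
    unfolding rep_def by (rule someI[of _ x]) (simp add: orbit_refl that)
  show "finite (rep ` orbits G E \<phi>)" using assms by simp
  show "\<exists>g\<in>carrier G. \<phi> g x \<in> rep ` orbits G E \<phi>" if xE: "x \<in> E" for x
  proof -
    obtain g where "g \<in> carrier G" "\<phi> g x = rep (orbit G \<phi> x)"
      using rep[OF xE] by (auto simp: orbit_def)
    then show ?thesis using xE by (auto simp: orbits_def)
  qed
  show "rep ` orbits G E \<phi> \<subseteq> E" using rep by (auto simp: orbits_def)
qed

text \<open>\<open>S\<close> need not be invariant: each representative that is reached from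
  \<open>S\<close> is pulled back to a point of \<open>S\<close>.\<close>

lemma (in group_action) finite_reps_subset:
  assumes Q: "finite Q" "\<And>x. x \<in> E \<Longrightarrow> \<exists>g\<in>carrier G. \<phi> g x \<in> Q" and S: "S \<subseteq> E"
  shows "\<exists>Q'. finite Q' \<and> Q' \<subseteq> S \<and> (\<forall>x\<in>S. \<exists>g\<in>carrier G. \<phi> g x \<in> Q')"
proof -
  define rep where "rep q = (SOME x. x \<in> S \<and> (\<exists>g\<in>carrier G. \<phi> g x = q))" for q
  have rep: "rep q \<in> S \<and> (\<exists>g\<in>carrier G. \<phi> g (rep q) = q)" if "\<exists>x\<in>S. \<exists>g\<in>carrier G. \<phi> g x = q" for q
    unfolding rep_def by (rule someI_ex) (use that in blast)
  interpret group G using group_hom group_hom.axioms(1) by auto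
  let ?Q = "rep ` {q \<in> Q. \<exists>x\<in>S. \<exists>g\<in>carrier G. \<phi> g x = q}"
  have "\<exists>g\<in>carrier G. \<phi> g x \<in> ?Q" if x: "x \<in> S" for x
  proof -
    obtain g where g: "g \<in> carrier G" "\<phi> g x \<in> Q" using Q x S by blast
    then obtain h where h: "h \<in> carrier G" "\<phi> h (rep (\<phi> g x)) = \<phi> g x" "rep (\<phi> g x) \<in> S"
      using rep[of "\<phi> g x"] x by blast
    have "\<phi> (inv h) (\<phi> g x) = rep (\<phi> g x)" using orbit_sym_aux[OF h(1) _ h(2)] h(3) S by blast
    then have "\<phi> (inv h \<otimes> g) x = rep (\<phi> g x)" using composition_rule x S g h by auto
    then show ?thesis using g h x by (intro bexI[of _ "inv h \<otimes> g"]) auto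
  qed
  then show ?thesis using Q(1) rep by (intro exI[of _ ?Q]) auto
qed

lemma (in group_action) setwise_stabilizer_subgroup:
  assumes "A \<subseteq> E"
  shows "subgroup {g \<in> carrier G. \<phi> g ` A = A} G"
proof -
  interpret group G using group_hom group_hom.axioms(1) by auto
  have comp: "\<phi> (g \<otimes> h) ` A = \<phi> g ` \<phi> h ` A" if "g \<in> carrier G" "h \<in> carrier G" for g h
    using composition_rule that assms by (auto simp: image_image intro!: image_cong)
  have one: "\<phi> \<one> ` A = A" using id_eq_one[symmetric] assms by (auto simp: image_iff)
  show ?thesis
  proof (rule subgroupI)
    show "{g \<in> carrier G. \<phi> g ` A = A} \<noteq> {}" using one by blast
    fix g assume g: "g \<in> {g \<in> carrier G. \<phi> g ` A = A}"
    then show "inv g \<in> {g \<in> carrier G. \<phi> g ` A = A}" using comp[of "inv g" g] one by auto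
    fix h assume "h \<in> {g \<in> carrier G. \<phi> g ` A = A}"
    with g show "g \<otimes> h \<in> {g \<in> carrier G. \<phi> g ` A = A}" using comp by auto
  qed auto
qed

locale acting = opt_graph \<Gamma> k + group G
  for \<Gamma> :: "'v pair_pre_digraph" and k and G :: "'g monoid" (structure) +
  fixes \<phi> :: "'g \<Rightarrow> 'v \<Rightarrow> 'v"
  assumes action: "group_action G (pverts \<Gamma>) \<phi>"
    and act_edge: "\<And>g u v. g \<in> carrier G \<Longrightarrow> (u, v) \<in> parcs \<Gamma> \<Longrightarrow> (\<phi> g u, \<phi> g v) \<in> parcs \<Gamma>"
    and cofinite: "finite (orbits G (pverts \<Gamma>) \<phi>)"
begin

abbreviation "cut_act \<equiv> cut_action \<Gamma> k \<phi>"
abbreviation "cls_act \<equiv> cut_class_action \<Gamma> k \<phi>"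

lemma act_V: "g \<in> carrier G \<Longrightarrow> x \<in> V \<Longrightarrow> \<phi> g x \<in> V"
  by (rule group_action.element_image[OF action]) auto

lemma act_mult: "g \<in> carrier G \<Longrightarrow> h \<in> carrier G \<Longrightarrow> x \<in> V \<Longrightarrow> \<phi> (g \<otimes> h) x = \<phi> g (\<phi> h x)"
  by (rule group_action.composition_rule[OF action])

lemma act_one: "x \<in> V \<Longrightarrow> \<phi> \<one> x = x"
  using group_action.id_eq_one[OF action] by (metis restrict_apply')

lemma act_inv: "g \<in> carrier G \<Longrightarrow> x \<in> V \<Longrightarrow> \<phi> (inv g) (\<phi> g x) = x \<and> \<phi> g (\<phi> (inv g) x) = x"
  using act_mult[of "inv g" g x] act_mult[of g "inv g" x] act_one by auto

lemma act_aut: "g \<in> carrier G \<Longrightarrow> aut (\<phi> g) (\<phi> (inv g))"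
  using act_V act_inv act_edge by (auto simp: aut_def)

lemma act_image_mult:
  assumes "g \<in> carrier G" "h \<in> carrier G" "C \<subseteq> V"
  shows "\<phi> (g \<otimes> h) ` C = \<phi> g ` \<phi> h ` C"
  using act_mult assms by (auto simp: image_image intro!: image_cong)

lemma act_image_one: "C \<subseteq> V \<Longrightarrow> \<phi> \<one> ` C = C"
  using act_one by (auto simp: image_iff subset_iff)

lemma act_Opt: "g \<in> carrier G \<Longrightarrow> C \<in> Opt \<Longrightarrow> \<phi> g ` C \<in> Opt"
  using aut_Opt act_aut by blast

lemma action_Opt: "group_action G Opt (cut_act)"
proof -
  have "group_action G Opt (\<lambda>g. restrict (image (\<phi> g)) Opt)"
    using act_Opt act_image_one act_image_mult Opt_sub by (intro group_actionI) (auto simp: is_group)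
  then show ?thesis by (simp add: cut_action_def[abs_def])
qed

lemma class_action_cls:
  assumes g: "g \<in> carrier G" and C: "C \<in> Opt"
  shows "cls_act g (cls C) = cls (\<phi> g ` C)"
proof -
  have "cls (\<phi> g ` D) = cls (\<phi> g ` C)" if "D \<in> cls C" for D
  proof -
    have "(C, D) \<in> R" using that by (simp add: in_cls_iff)
    then have "(\<phi> g ` C, \<phi> g ` D) \<in> R" using aut_cut_rel act_aut g by blast
    then show ?thesis using cls_eq_iff by (metis cut_rel_iff)
  qed
  moreover have "C \<in> cls C" using C by (simp add: in_cls_iff cut_rel_iff)
  ultimately have "(\<Union>D\<in>cls C. cls (\<phi> g ` D)) = cls (\<phi> g ` C)" by blast
  then show ?thesis using cls_in_quotient[OF C] by (simp add: cut_class_action_def)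
qed

lemma class_action_image:
  assumes g: "g \<in> carrier G" and X: "X \<in> Opt // R"
  shows "cls_act g X = image (\<phi> g) ` X"
proof -
  obtain C where C: "C \<in> Opt" "X = cls C" using X by (rule quotient_obtain)
  then show ?thesis using class_action_cls[OF g] aut_cls[OF act_aut[OF g]] by simp
qed

lemma action_classes: "group_action G (Opt // R) (cls_act)"
proof -
  let ?f = "\<lambda>g X. \<Union>C\<in>X. cls (\<phi> g ` C)"
  have f: "?f g (cls C) = cls (\<phi> g ` C)" if "g \<in> carrier G" "C \<in> Opt" for g C
    using class_action_cls[OF that] cls_in_quotient[OF that(2)] by (simp add: cut_class_action_def)
  have "group_action G (Opt // R) (\<lambda>g. restrict (?f g) (Opt // R))"
  proof (rule group_actionI[OF is_group])
    fix X assume X: "X \<in> Opt // R"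
    obtain C where C: "C \<in> Opt" "X = cls C" using X by (rule quotient_obtain)
    show "?f \<one> X = X" using C f act_image_one Opt_sub by simp
    show "?f g X \<in> Opt // R" if "g \<in> carrier G" for g
      using C f act_Opt cls_in_quotient that by simp
    show "?f (g \<otimes> h) X = ?f g (?f h X)" if "g \<in> carrier G" "h \<in> carrier G" for g h
      using C f act_Opt act_image_mult Opt_sub that by simp
  qed
  then show ?thesis by (simp add: cut_class_action_def[abs_def])
qed

lemma acts_on_T:
  "acts_on_graph G T (T_rev) (cls_act) (cut_act)"
  unfolding acts_on_graph_def T_simps
proof (intro conjI ballI)
  fix g C assume g: "g \<in> carrier G" and C: "C \<in> Opt"
  note simps = g C act_Opt Opt_compl class_action_cls
  have compl: "\<phi> g ` (V - C) = V - \<phi> g ` C" using aut_compl[OF act_aut[OF g]] Opt_sub C by blast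
  show "cls (cut_act g C) = cls_act g (cls C)"
    by (simp add: simps cut_action_def)
  show "cls (V - cut_act g C) = cls_act g (cls (V - C))"
    by (simp add: simps cut_action_def compl)
  show "cut_act g (T_rev C) = T_rev (cut_act g C)"
    by (simp add: simps cut_action_def structure_tree_rev_def compl)
qed (rule action_Opt action_classes)+

lemma finite_reps_V:
  obtains Q where "finite Q" "Q \<subseteq> V" "\<And>x. x \<in> V \<Longrightarrow> \<exists>g\<in>carrier G. \<phi> g x \<in> Q"
  using group_action.finite_orbitsE[OF action cofinite] by blast

text \<open>A boundary edge can be moved so that it starts in a finite set of vertex
  representatives, and only finitely many \<open>k\<close>-cuts pass through the edges at
  these.\<close>

lemma finite_reps_Opt:
  obtains Q where "finite Q" "Q \<subseteq> Opt" "\<And>C. C \<in> Opt \<Longrightarrow> \<exists>g\<in>carrier G. \<phi> g ` C \<in> Q"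
proof -
  obtain Q where Q: "finite Q" "Q \<subseteq> V" "\<And>x. x \<in> V \<Longrightarrow> \<exists>g\<in>carrier G. \<phi> g x \<in> Q"
    by (rule finite_reps_V) blast
  let ?Q = "Opt \<inter> (\<Union>(a, b)\<in>Q \<times> E `` Q. {C. kcut k C \<and> (a, b) \<in> bd E C})"
  have "E `` Q = (\<Union>v\<in>Q. E `` {v})" by auto
  then have "finite (E `` Q)" using Q(1) finite_nbrs by simp
  then have "finite ?Q" using Q(1) finite_k_cuts_through by (intro finite_Int disjI2 finite_UN_I) auto
  moreover have "\<exists>g\<in>carrier G. \<phi> g ` C \<in> ?Q" if C: "C \<in> Opt" for C
  proof -
    have CV: "C \<subseteq> V" using C Opt_sub by blast
    obtain a b where ab: "(a, b) \<in> bd E C"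
      using ends_meet[OF opt_cut_is_cut[OF C]] by (auto simp: ends_def)
    then have "a \<in> V" using E_sub by (auto simp: bd_def)
    then obtain g where g: "g \<in> carrier G" "\<phi> g a \<in> Q" using Q by blast
    have "(\<phi> g a, \<phi> g b) \<in> bd E (\<phi> g ` C)"
      unfolding aut_bd[OF act_aut[OF g(1)] CV] using ab by (rule map_prod_imageI)
    moreover have "kcut k (\<phi> g ` C)" using opt_cut_is_k_cut[OF acc] act_Opt g C by blast
    moreover have "\<phi> g b \<in> E `` Q" using calculation(1) g by (auto simp: bd_def)
    ultimately show ?thesis using g act_Opt C by blast
  qed
  ultimately show thesis using that[of ?Q] by blast
qed

lemma finite_orbits_Opt: "finite (orbits G Opt (cut_act))"
proof -
  interpret A: group_action G Opt "cut_act" by (rule action_Opt)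
  obtain Q where "finite Q" "Q \<subseteq> Opt" "\<And>C. C \<in> Opt \<Longrightarrow> \<exists>g\<in>carrier G. \<phi> g ` C \<in> Q"
    by (rule finite_reps_Opt) blast
  then show ?thesis by (intro A.finite_orbitsI[of Q]) (auto simp: cut_action_def)
qed

lemma finite_orbits_classes: "finite (orbits G (Opt // R) (cls_act))"
proof -
  interpret A: group_action G "Opt // R" "cls_act" by (rule action_classes)
  obtain Q where Q: "finite Q" "Q \<subseteq> Opt" "\<And>C. C \<in> Opt \<Longrightarrow> \<exists>g\<in>carrier G. \<phi> g ` C \<in> Q"
    by (rule finite_reps_Opt) blast
  show ?thesis
  proof (rule A.finite_orbitsI)
    show "finite (cls ` Q)" using Q by simp
    fix X assume "X \<in> Opt // R"
    then obtain C where C: "C \<in> Opt" "X = cls C" by (rule quotient_obtain)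
    then show "\<exists>g\<in>carrier G. cls_act g X \<in> cls ` Q"
      using Q(3) class_action_cls by fastforce
  qed
qed

section \<open>Stabilizers\<close>

definition fixer :: "'v set \<Rightarrow> 'g set" where
  "fixer P = {g \<in> carrier G. \<forall>x\<in>P. \<phi> g x = x}"

lemma fixer_inv:
  assumes "P \<subseteq> V" "g \<in> fixer P"
  shows "inv g \<in> fixer P"
proof -
  have "\<phi> (inv g) x = x" if "x \<in> P" for x
    using assms that act_inv[of g x] by (auto simp: fixer_def)
  with assms show ?thesis by (auto simp: fixer_def)
qed

lemma fixer_subgroup:
  assumes "P \<subseteq> V"
  shows "subgroup (fixer P) G"
proof (rule subgroupI)
  show "fixer P \<noteq> {}" using act_one assms by (auto simp: fixer_def intro!: exI[of _ \<one>])
  fix g h assume "g \<in> fixer P" "h \<in> fixer P"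
  then show "g \<otimes> h \<in> fixer P" using act_mult assms by (auto simp: fixer_def)
qed (use fixer_inv[OF assms] in \<open>auto simp: fixer_def\<close>)

text \<open>A right coset is determined by what the inverses of its elements do on \<open>P\<close>,
  so cosets can be counted by functions on \<open>P\<close>.\<close>

lemma fixer_coset:
  assumes P: "P \<subseteq> V" and a: "a \<in> carrier G"
  shows "fixer P #> a = {g \<in> carrier G. \<forall>x\<in>P. \<phi> (inv g) x = \<phi> (inv a) x}"
proof (intro equalityI subsetI)
  fix g assume "g \<in> fixer P #> a"
  then obtain n where n: "n \<in> fixer P" "g = n \<otimes> a" by (auto simp: r_coset_def)
  then have nG: "n \<in> carrier G" and inv: "inv n \<in> fixer P" using fixer_inv[OF P] by (auto simp: fixer_def)
  have "\<phi> (inv g) x = \<phi> (inv a) x" if "x \<in> P" for x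
    using that inv P act_mult[of "inv a" "inv n" x] a nG by (auto simp: n(2) inv_mult_group fixer_def)
  with n a nG show "g \<in> {g \<in> carrier G. \<forall>x\<in>P. \<phi> (inv g) x = \<phi> (inv a) x}" by simp
next
  fix g assume g: "g \<in> {g \<in> carrier G. \<forall>x\<in>P. \<phi> (inv g) x = \<phi> (inv a) x}"
  have "\<phi> (a \<otimes> inv g) x = x" if "x \<in> P" for x
    using that g P a act_mult[of a "inv g" x] act_inv[of a x] by auto
  then have "a \<otimes> inv g \<in> fixer P" using g a by (auto simp: fixer_def)
  then have "g \<otimes> inv a \<in> fixer P" using fixer_inv[OF P, of "a \<otimes> inv g"] g a by (simp add: inv_mult_group)
  moreover have "g = (g \<otimes> inv a) \<otimes> a" using g a by (simp add: m_assoc)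
  ultimately show "g \<in> fixer P #> a" by (auto simp: r_coset_def)
qed

lemma finite_index_fixer:
  assumes K: "subgroup K G" and P: "finite P" "P \<subseteq> V"
    and Q: "finite Q" "\<And>g x. g \<in> K \<Longrightarrow> x \<in> P \<Longrightarrow> \<phi> g x \<in> Q"
  shows "finite (rcosets\<^bsub>G\<lparr>carrier := K\<rparr>\<^esub> fixer P)"
proof -
  have KG: "K \<subseteq> carrier G" using K by (rule subgroup.subset)
  have "rcosets\<^bsub>G\<lparr>carrier := K\<rparr>\<^esub> fixer P \<subseteq>
    (\<lambda>f. {g \<in> carrier G. \<forall>x\<in>P. \<phi> (inv g) x = f x}) ` (P \<rightarrow>\<^sub>E Q)"
  proof
    fix Y assume "Y \<in> rcosets\<^bsub>G\<lparr>carrier := K\<rparr>\<^esub> fixer P"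
    then obtain a where a: "a \<in> K" "Y = fixer P #> a" by (auto simp: RCOSETS_def r_coset_def)
    have "inv a \<in> K" by (rule subgroup.m_inv_closed[OF K a(1)])
    then have "restrict (\<phi> (inv a)) P \<in> P \<rightarrow>\<^sub>E Q" using Q(2) by auto
    moreover have "Y = {g \<in> carrier G. \<forall>x\<in>P. \<phi> (inv g) x = restrict (\<phi> (inv a)) P x}"
      using fixer_coset[OF P(2), of a] a KG by auto
    ultimately show "Y \<in> (\<lambda>f. {g \<in> carrier G. \<forall>x\<in>P. \<phi> (inv g) x = f x}) ` (P \<rightarrow>\<^sub>E Q)" by blast
  qed
  moreover have "finite (P \<rightarrow>\<^sub>E Q)" using P Q by (simp add: finite_PiE)
  ultimately show ?thesis by (auto intro: finite_subset)
qed

lemma subgroup_vertex_stabilizer: "v \<in> V \<Longrightarrow> subgroup (stabilizer G \<phi> v) G"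
  by (rule group_action.stabilizer_subgroup[OF action])

text \<open>The stabilizer of \<open>v\<close> preserves balls around \<open>v\<close>, so
  conjugation by it preserves their pointwise stabilizers. Normality is the reason for using balls
  instead of \<open>ends C\<close>.\<close>

lemma fixer_ball_normal:
  assumes v: "v \<in> V"
  shows "fixer (nbhd n {v}) \<lhd> G\<lparr>carrier := stabilizer G \<phi> v\<rparr>"
proof -
  let ?P = "nbhd n {v}" and ?H = "G\<lparr>carrier := stabilizer G \<phi> v\<rparr>"
  have P: "?P \<subseteq> V" using nbhd_subset_V v by simp
  have sub: "subgroup (stabilizer G \<phi> v) G" using v by (rule subgroup_vertex_stabilizer)
  interpret H: group ?H using subgroup_imp_group[OF sub] .
  have vP: "v \<in> ?P" using subset_nbhd by blast
  have "subgroup (fixer ?P) ?H"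
    by (rule subgroup_incl[OF fixer_subgroup[OF P] sub]) (use vP in \<open>auto simp: fixer_def stabilizer_def\<close>)
  moreover have "x \<otimes> h \<otimes> inv x \<in> fixer ?P" if x: "x \<in> stabilizer G \<phi> v" and h: "h \<in> fixer ?P" for x h
  proof -
    have c: "x \<in> carrier G" "h \<in> carrier G" using x h by (auto simp: stabilizer_def fixer_def)
    have "\<phi> (inv x) v = v" using act_inv[OF c(1) v] x by (auto simp: stabilizer_def)
    then have img: "\<phi> (inv x) ` ?P = ?P"
      using aut_nbhd[OF act_aut[of "inv x"], of "{v}" n] c v by simp
    have "\<phi> (x \<otimes> h \<otimes> inv x) y = y" if y: "y \<in> ?P" for y
    proof -
      have y': "\<phi> (inv x) y \<in> ?P" using img y by blast
      then have "\<phi> h (\<phi> (inv x) y) = \<phi> (inv x) y" using h by (simp add: fixer_def)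
      moreover have V: "y \<in> V" "\<phi> (inv x) y \<in> V" using y y' P by blast+
      ultimately show ?thesis using c act_mult[of "x \<otimes> h" "inv x" y] act_mult[of x h "\<phi> (inv x) y"]
          act_inv[OF c(1) V(1)] by simp
    qed
    with c show ?thesis by (simp add: fixer_def)
  qed
  ultimately show ?thesis
    unfolding H.normal_inv_iff using m_inv_consistent[OF sub] by simp
qed

text \<open>The pointwise stabilizer of the ball is a common subgroup of finite index: in the
  stabilizer of \<open>v\<close> it is normal, hence in \<G>, and in \<open>K\<close> its index is
  finite because \<open>K\<close> moves the ball only within \<open>nbhd n S\<close>.\<close>

lemma virtually_stabilizer:
  assumes cl: "closed_under_finite_index_normal \<G>"
    and st: "\<And>v. v \<in> V \<Longrightarrow> G\<lparr>carrier := stabilizer G \<phi> v\<rparr> \<in> \<G>"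
    and K: "subgroup K G" and v: "v \<in> V"
    and orb: "finite S" "\<And>g. g \<in> K \<Longrightarrow> \<phi> g v \<in> S"
    and fixes_K: "fixer (nbhd n {v}) \<subseteq> K"
  shows "virtually \<G> (G\<lparr>carrier := K\<rparr>)"
proof -
  let ?P = "nbhd n {v}"
  have P: "finite ?P" "?P \<subseteq> V" using finite_nbhd nbhd_subset_V v by simp_all
  have move: "\<phi> g x \<in> nbhd n S'" if "x \<in> ?P" "g \<in> carrier G" "\<phi> g v \<in> S'" for g x S'
    using that aut_nbhd[OF act_aut[OF that(2)], of "{v}" n] nbhd_mono_set[of "{\<phi> g v}" S' n] v by auto
  have KG: "K \<subseteq> carrier G" using K by (rule subgroup.subset)
  have "finite (rcosets\<^bsub>G\<lparr>carrier := stabilizer G \<phi> v\<rparr>\<^esub> fixer ?P)"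
    by (rule finite_index_fixer[OF subgroup_vertex_stabilizer[OF v] P P(1)])
      (use move[where S' = "{v}"] in \<open>auto simp: stabilizer_def\<close>)
  then have "G\<lparr>carrier := stabilizer G \<phi> v, carrier := fixer ?P\<rparr> \<in> \<G>"
    using cl st[OF v] fixer_ball_normal[OF v, of n] unfolding closed_under_finite_index_normal_def by blast
  moreover have "finite (rcosets\<^bsub>G\<lparr>carrier := K\<rparr>\<^esub> fixer ?P)"
    by (rule finite_index_fixer[OF K P finite_nbhd[OF orb(1), of n]]) (use move KG orb(2) in auto)
  moreover have "subgroup (fixer ?P) (G\<lparr>carrier := K\<rparr>)"
    by (rule subgroup_incl[OF fixer_subgroup[OF P(2)] K fixes_K])
  ultimately show ?thesis unfolding virtually_def by (intro exI[of _ "fixer ?P"]) simp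
qed

lemma fixer_ball_fixes_cut:
  assumes "C \<in> Opt" "v \<in> V"
  shows "\<exists>n. \<forall>g\<in>fixer (nbhd n {v}). \<phi> g ` C = C"
proof -
  obtain n where n: "ends C \<subseteq> nbhd n {v}"
    using finite_in_ball[OF finite_ends ends_subset assms(2)] is_cutD(6)[OF opt_cut_is_cut[OF assms(1)]] by blast
  have "\<phi> g ` C = C" if g: "g \<in> fixer (nbhd n {v})" for g
    by (rule aut_Opt_fixed[OF act_aut assms(1)]) (use g n in \<open>auto simp: fixer_def\<close>)
  then show ?thesis by blast
qed

text \<open>The finite invariant set \<open>B\<close> bounds the \<open>K\<close>-orbit of an end of
  \<open>C\<close>, while fixing a large ball fixes \<open>C\<close> and so forces membership in
  \<open>K\<close>.\<close>

lemma virtually_setwise_stabilizer: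
  assumes cl: "closed_under_finite_index_normal \<G>"
    and st: "\<And>v. v \<in> V \<Longrightarrow> G\<lparr>carrier := stabilizer G \<phi> v\<rparr> \<in> \<G>"
    and K: "subgroup K G" and C: "C \<in> Opt"
    and B: "finite B" "ends C \<subseteq> B" "\<And>g. g \<in> K \<Longrightarrow> \<phi> g ` B = B"
    and fix_C: "\<And>g. g \<in> carrier G \<Longrightarrow> \<phi> g ` C = C \<Longrightarrow> g \<in> K"
  shows "virtually \<G> (G\<lparr>carrier := K\<rparr>)"
proof -
  obtain v where v: "v \<in> ends C" using ends_meet[OF opt_cut_is_cut[OF C]] by blast
  then have vV: "v \<in> V" using ends_subset by blast
  obtain n where n: "\<forall>g\<in>fixer (nbhd n {v}). \<phi> g ` C = C" using fixer_ball_fixes_cut[OF C vV] by blast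
  show ?thesis
    by (rule virtually_stabilizer[OF cl st K vV B(1), of n]) (use B v n fix_C in \<open>auto simp: fixer_def\<close>)
qed

text \<open>The second claim admits inversions of the edge; \<open>ends C\<close> is invariant under
  these too, being the same for both sides.\<close>

lemma virtually_cut_stabilizer:
  assumes cl: "closed_under_finite_index_normal \<G>"
    and st: "\<And>v. v \<in> V \<Longrightarrow> G\<lparr>carrier := stabilizer G \<phi> v\<rparr> \<in> \<G>"
    and C: "C \<in> Opt"
  shows "virtually \<G> (G\<lparr>carrier := stabilizer G (cut_act) C\<rparr>)"
    and "virtually \<G> (G\<lparr>carrier := stabilizer G (\<lambda>g. image (cut_act g)) {C, T_rev C}\<rparr>)"
proof -
  interpret A: group_action G Opt "cut_act" by (rule action_Opt)
  have act: "cut_act g D = \<phi> g ` D" if "D \<in> Opt" for g D using that by (simp add: cut_action_def)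
  have fin: "finite (ends C)" using finite_ends is_cutD(6)[OF opt_cut_is_cut[OF C]] by blast
  have CV: "C \<subseteq> V" and C': "V - C \<in> Opt" using C Opt_sub Opt_compl by blast+
  have inv: "\<phi> g ` ends C = ends C" if "g \<in> carrier G" "\<phi> g ` C = C \<or> \<phi> g ` C = V - C" for g
    using aut_ends[OF act_aut[OF that(1)] CV] that(2) ends_compl[OF CV] by auto
  show "virtually \<G> (G\<lparr>carrier := stabilizer G (cut_act) C\<rparr>)"
    by (rule virtually_setwise_stabilizer[OF cl st A.stabilizer_subgroup[OF C] C fin order_refl])
      (use inv act C in \<open>auto simp: stabilizer_def\<close>)
  have rev: "T_rev C = V - C" using C by (simp add: structure_tree_rev_def)
  have eq: "stabilizer G (\<lambda>g. image (cut_act g)) {C, V - C} =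
    {g \<in> carrier G. cut_act g ` {C, V - C} = {C, V - C}}"
    by (simp add: stabilizer_def)
  show "virtually \<G> (G\<lparr>carrier := stabilizer G (\<lambda>g. image (cut_act g)) {C, T_rev C}\<rparr>)"
    unfolding rev eq
  proof (rule virtually_setwise_stabilizer[OF cl st A.setwise_stabilizer_subgroup C fin order_refl])
    show "{C, V - C} \<subseteq> Opt" using C C' by blast
    fix g
    { assume g: "g \<in> {g \<in> carrier G. cut_act g ` {C, V - C} = {C, V - C}}"
      then have "cut_act g C \<in> {C, V - C}" by blast
      with g inv show "\<phi> g ` ends C = ends C" by (simp add: act[OF C]) }
    assume "g \<in> carrier G" "\<phi> g ` C = C"
    then show "g \<in> {g \<in> carrier G. cut_act g ` {C, V - C} = {C, V - C}}"
      using act[OF C] act[OF C'] aut_compl[OF act_aut CV, of g] by auto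
  qed
qed

section \<open>Vertices of the structure tree have finite blocks\<close>

text \<open>The radius \<open>r\<close> is chosen later such that each thickened boundary is
  connected and can replace detours outside a member of \<open>X\<close>.\<close>

definition block :: "nat \<Rightarrow> 'v set set \<Rightarrow> 'v set" where
  "block r X = \<Inter>X \<union> (\<Union>D\<in>X. nbhd r (ends D))"

lemma classD:
  assumes "X \<in> Opt // R" "C \<in> X"
  shows "C \<in> Opt" "X = cls C"
proof -
  obtain D where D: "D \<in> Opt" "X = cls D" using assms(1) by (rule quotient_obtain)
  then have "(D, C) \<in> R" using assms by (simp add: in_cls_iff)
  then show "C \<in> Opt" "X = cls C" using D cls_eq_iff by (auto simp: cut_rel_iff)
qed

lemma class_cover:
  assumes "X \<in> Opt // R" "C \<in> X" "D \<in> X" "C \<noteq> D"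
  shows "V - C \<subset> D"
proof -
  have "(C, D) \<in> R" using classD[OF assms(1,2)] assms(3) by (simp add: in_cls_iff)
  with assms(4) show ?thesis by (simp add: cut_rel_iff)
qed

lemma class_nonempty:
  assumes "X \<in> Opt // R"
  obtains C where "C \<in> X"
  using assms by (rule quotient_obtain)

lemma block_subset:
  assumes "X \<in> Opt // R"
  shows "block r X \<subseteq> V"
proof -
  obtain C where "C \<in> X" using assms by (rule class_nonempty)
  then have "\<Inter>X \<subseteq> V" using classD[OF assms] Opt_sub by blast
  then show ?thesis using nbhd_subset_V[OF ends_subset] by (auto simp: block_def)
qed

text \<open>Each boundary needs some radius, and finitely many orbits of cuts allow a common one;
  enlarging a radius keeps neighbourhoods connected.\<close>

lemma connecting_radius:
  obtains r where "\<And>C. C \<in> Opt \<Longrightarrow> conn E (nbhd r (ends C))"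
proof -
  obtain Q where Q: "finite Q" "Q \<subseteq> Opt" "\<And>C. C \<in> Opt \<Longrightarrow> \<exists>g\<in>carrier G. \<phi> g ` C \<in> Q"
    by (rule finite_reps_Opt) blast
  have ex: "\<exists>n. conn E (nbhd n (ends C))" if C: "C \<in> Opt" for C
  proof -
    obtain v where v: "v \<in> ends C" using ends_meet[OF opt_cut_is_cut[OF C]] by blast
    then have "v \<in> V" using ends_subset by blast
    then obtain n where n: "ends C \<subseteq> nbhd n {v}"
      using finite_in_ball[OF finite_ends[OF is_cutD(6)[OF opt_cut_is_cut[OF C]]] ends_subset] by blast
    have ball: "nbhd n {v} \<subseteq> nbhd n (ends C)" using v by (intro nbhd_mono_set) simp
    have "(x, v) \<in> (E \<inter> nbhd n (ends C) \<times> nbhd n (ends C))\<^sup>*" if x: "x \<in> nbhd n (ends C)" for x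
    proof -
      obtain s where s: "s \<in> ends C" "(x, s) \<in> (E \<inter> nbhd n (ends C) \<times> nbhd n (ends C))\<^sup>*"
        using nbhd_reach[OF x] by blast
      have "v \<in> nbhd n {v}" using subset_nbhd by blast
      then have "(s, v) \<in> (E \<inter> nbhd n {v} \<times> nbhd n {v})\<^sup>*"
        using conn_ball n s(1) unfolding conn_def by blast
      moreover have "(E \<inter> nbhd n {v} \<times> nbhd n {v})\<^sup>* \<subseteq> (E \<inter> nbhd n (ends C) \<times> nbhd n (ends C))\<^sup>*"
        by (rule rtrancl_mono) (use ball in blast)
      ultimately show ?thesis using s(2) by (meson rtrancl_trans subsetD)
    qed
    then show ?thesis using conn_if_reach[OF sym_E] by blast
  qed
  define rad where "rad C = (SOME n. conn E (nbhd n (ends C)))" for C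
  have rad: "conn E (nbhd (rad C) (ends C))" if "C \<in> Opt" for C
    using someI_ex[OF ex[OF that]] by (simp add: rad_def)
  \<comment> \<open>The inserted \<open>0\<close> covers the case that there are no optimal
    cuts.\<close>
  define r where "r = Max (insert 0 (rad ` Q))"
  have Qr: "conn E (nbhd r (ends C))" if "C \<in> Q" for C
  proof -
    have "rad C \<le> r" using that Q(1) by (simp add: r_def)
    then have "nbhd r (ends C) = nbhd (r - rad C) (nbhd (rad C) (ends C))" by (simp add: nbhd_nbhd)
    then show ?thesis using conn_nbhd[OF rad] that Q(2) by auto
  qed
  have "conn E (nbhd r (ends C))" if C: "C \<in> Opt" for C
  proof -
    have CV: "C \<subseteq> V" using C Opt_sub by blast
    obtain g where g: "g \<in> carrier G" "\<phi> g ` C \<in> Q" using Q(3)[OF C] by blast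
    note f = act_aut[OF g(1)]
    have "conn E (\<phi> g ` nbhd r (ends C))"
      using Qr[OF g(2)] aut_ends[OF f CV] aut_nbhd[OF f ends_subset] by simp
    then have "conn E (\<phi> (inv g) ` \<phi> g ` nbhd r (ends C))" by (rule aut_conn[OF aut_sym[OF f]])
    then show ?thesis using aut_image_inv[OF f nbhd_subset_V[OF ends_subset]] by simp
  qed
  then show thesis by (rule that)
qed

text \<open>A path in \<open>\<Gamma>\<close> leaving \<open>D \<in> X\<close> returns to it through the boundary of \<open>D\<close>, whose ends are
  joined within the block.\<close>

lemma conn_block:
  assumes X: "X \<in> Opt // R" and r: "\<And>C. C \<in> Opt \<Longrightarrow> conn E (nbhd r (ends C))"
  shows "conn E (block r X)"
proof -
  define B where "B = block r X"
  define A where "A = (E \<inter> B \<times> B)\<^sup>*"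
  have A_trans: "(x, z) \<in> A" if "(x, y) \<in> A" "(y, z) \<in> A" for x y z
    using that unfolding A_def by (rule rtrancl_trans)
  have nb: "(x, y) \<in> A" if D: "D \<in> X" and xy: "x \<in> nbhd r (ends D)" "y \<in> nbhd r (ends D)" for D x y
  proof -
    have "(x, y) \<in> (E \<inter> nbhd r (ends D) \<times> nbhd r (ends D))\<^sup>*"
      using r classD(1)[OF X D] xy by (auto simp: conn_def)
    moreover have "(E \<inter> nbhd r (ends D) \<times> nbhd r (ends D))\<^sup>* \<subseteq> A"
      unfolding A_def by (rule rtrancl_mono) (use D in \<open>auto simp: B_def block_def\<close>)
    ultimately show ?thesis by blast
  qed
  have ends_nb: "e \<in> nbhd r (ends D)" if "e \<in> ends D" for e D using that subset_nbhd by blast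
  have ends_A: "(x, y) \<in> A" if "D \<in> X" "x \<in> ends D" "y \<in> ends D" for D x y
    using nb[OF that(1)] ends_nb that by blast
  have interB: "z \<in> B" if "z \<in> \<Inter>X" for z using that by (simp add: B_def block_def)
  have dis: "D = D'" if "D \<in> X" "D' \<in> X" "z \<in> V" "z \<notin> D" "z \<notin> D'" for D D' z
    using class_cover[OF X that(1,2)] that by blast
  \<comment> \<open>Invariant along a path in \<Gamma>: inside \<open>\<Inter>X\<close> the current
    vertex \<open>z\<close> is joined to \<open>x\<close> within the block; outside some
    \<open>D\<close> in \<open>X\<close>, all ends of \<open>D\<close> are, wherever the path
    reenters.\<close>
  define P where "P x z \<longleftrightarrow> z \<in> \<Inter>X \<and> (x, z) \<in> A \<or>
    (\<exists>D\<in>X. z \<notin> D \<and> (\<forall>e\<in>ends D. (x, e) \<in> A))" for x z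
  have step: "P x z'" if P: "P x z" and zz: "(z, z') \<in> E" for x z z'
  proof -
    have V: "z \<in> V" "z' \<in> V" "(z', z) \<in> E" using zz E_sub E_sym by blast+
    show ?thesis
    proof (cases "z \<in> \<Inter>X")
      case True
      then have xz: "(x, z) \<in> A" using P by (auto simp: P_def)
      show ?thesis
      proof (cases "z' \<in> \<Inter>X")
        case z': True
        have "(z, z') \<in> A" unfolding A_def using zz True z' interB by (intro r_into_rtrancl) blast
        then show ?thesis using z' A_trans[OF xz] by (simp add: P_def)
      next
        case False
        then obtain D where D: "D \<in> X" "z' \<notin> D" by blast
        then have e: "z \<in> ends D" using in_ends[OF zz, of D] True by blast
        then have "\<forall>e\<in>ends D. (x, e) \<in> A" using A_trans[OF xz ends_A[OF D(1) e]] by blast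
        then show ?thesis using D unfolding P_def by blast
      qed
    next
      case False
      then obtain D where D: "D \<in> X" "z \<notin> D" "\<And>e. e \<in> ends D \<Longrightarrow> (x, e) \<in> A"
        using P by (auto simp: P_def)
      show ?thesis
      proof (cases "z' \<in> D")
        case z'D: True
        then have "z' \<in> ends D" using in_ends[OF V(3), of D] D(2) by blast
        then have xz': "(x, z') \<in> A" using D(3) by blast
        show ?thesis
        proof (cases "z' \<in> \<Inter>X")
          case True
          with xz' show ?thesis by (simp add: P_def)
        next
          case False
          then obtain D' where D': "D' \<in> X" "z' \<notin> D'" by blast
          then have "z \<in> D'" using dis[OF D(1) D'(1) V(1) D(2)] z'D by blast
          then have e: "z' \<in> ends D'" using in_ends[OF zz, of D'] D' by blast
          then have "\<forall>e\<in>ends D'. (x, e) \<in> A" using A_trans[OF xz' ends_A[OF D'(1) e]] by blast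
          then show ?thesis using D' unfolding P_def by blast
        qed
      next
        case False
        then show ?thesis using D unfolding P_def by blast
      qed
    qed
  qed
  \<comment> \<open>An end of \<open>D\<close> outside \<open>D\<close> is a vertex at which the
    invariant speaks about \<open>D\<close> and about no other member.\<close>
  have outer: "\<exists>e. e \<in> ends D \<and> e \<notin> D \<and> e \<in> V" if "D \<in> X" for D
  proof -
    have D: "D \<in> Opt" using classD(1)[OF X that] .
    have "ends (V - D) \<inter> (V - D) \<noteq> {}" using ends_meet opt_cut_is_cut Opt_compl D by blast
    then show ?thesis using ends_compl[OF Opt_sub[OF D]] by blast
  qed
  have start: "\<exists>z\<in>V. P x z" if x: "x \<in> B" for x
  proof (cases "x \<in> \<Inter>X")
    case True
    then have "P x x" by (simp add: P_def A_def)
    moreover have "x \<in> V" using x block_subset[OF X] by (auto simp: B_def)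
    ultimately show ?thesis by blast
  next
    case False
    then obtain D where D: "D \<in> X" "x \<in> nbhd r (ends D)" using x by (auto simp: B_def block_def)
    obtain e where e: "e \<in> ends D" "e \<notin> D" "e \<in> V" using outer[OF D(1)] by blast
    have "(x, e') \<in> A" if "e' \<in> ends D" for e' using nb[OF D] ends_nb that by blast
    then have "P x e" using D e unfolding P_def by blast
    with e show ?thesis by blast
  qed
  have all: "P x z" if x: "x \<in> B" and z: "z \<in> V" for x z
  proof -
    obtain z0 where "z0 \<in> V" "P x z0" using start[OF x] by blast
    have "(z0, z) \<in> E\<^sup>*" using reach_V \<open>z0 \<in> V\<close> z .
    then show "P x z" by (induction rule: rtrancl_induct) (use \<open>P x z0\<close> step in blast)+
  qed
  have "(x, y) \<in> A" if x: "x \<in> B" and y: "y \<in> B" for x y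
  proof (cases "y \<in> \<Inter>X")
    case True
    have "y \<in> V" using y block_subset[OF X] by (auto simp: B_def)
    with all[OF x] True show ?thesis by (auto simp: P_def)
  next
    case False
    then obtain D where D: "D \<in> X" "y \<in> nbhd r (ends D)" using y by (auto simp: B_def block_def)
    obtain e where e: "e \<in> ends D" "e \<notin> D" "e \<in> V" using outer[OF D(1)] by blast
    have "P x e" using all[OF x e(3)] .
    then obtain D' where D': "D' \<in> X" "e \<notin> D'" "\<forall>e\<in>ends D'. (x, e) \<in> A"
      using D(1) e(2) unfolding P_def by blast
    then have "D' = D" using dis[OF D'(1) D(1) e(3)] e(2) by blast
    then have "(x, e) \<in> A" using D'(3) e(1) by blast
    then show ?thesis using A_trans nb[OF D(1) ends_nb[OF e(1)] D(2)] by blast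
  qed
  then show ?thesis unfolding conn_def A_def B_def by blast
qed

section \<open>The stabilizer of a class acting on its block\<close>

abbreviation cls_stab :: "'v set set \<Rightarrow> 'g set" where
  "cls_stab X \<equiv> stabilizer G (cls_act) X"

lemma subgroup_cls_stab: "X \<in> Opt // R \<Longrightarrow> subgroup (cls_stab X) G"
  by (rule group_action.stabilizer_subgroup[OF action_classes])

lemma cls_stabD:
  assumes "X \<in> Opt // R" "g \<in> cls_stab X"
  shows "g \<in> carrier G" "image (\<phi> g) ` X = X"
  using assms class_action_image[of g X] by (auto simp: stabilizer_def)

lemma cls_stabI:
  assumes "X \<in> Opt // R" "g \<in> carrier G" "C \<in> X" "\<phi> g ` C \<in> X"
  shows "g \<in> cls_stab X"
proof -
  have "cls_act g X = cls (\<phi> g ` C)"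
    using class_action_cls[OF assms(2)] classD[OF assms(1,3)] by simp
  then show ?thesis using classD(2)[OF assms(1,4)] assms(2) by (simp add: stabilizer_def)
qed

lemma block_invariant:
  assumes X: "X \<in> Opt // R" and g: "g \<in> cls_stab X"
  shows "\<phi> g ` block r X = block r X"
proof -
  have sub: "\<phi> g ` block r X \<subseteq> block r X" if g: "g \<in> cls_stab X" for g
  proof clarify
    fix x assume x: "x \<in> block r X"
    note g' = cls_stabD[OF X g]
    note f = act_aut[OF g'(1)]
    show "\<phi> g x \<in> block r X"
    proof (cases "x \<in> \<Inter>X")
      case True
      have "\<phi> g x \<in> D" if DX: "D \<in> X" for D
      proof -
        have "D \<in> image (\<phi> g) ` X" using DX g'(2) by simp
        then obtain D' where "D' \<in> X" "D = \<phi> g ` D'" by blast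
        then show ?thesis using True by blast
      qed
      then show ?thesis by (simp add: block_def)
    next
      case False
      then obtain D where D: "D \<in> X" "x \<in> nbhd r (ends D)" using x by (auto simp: block_def)
      have "D \<subseteq> V" using classD(1)[OF X D(1)] Opt_sub by blast
      then have "\<phi> g x \<in> nbhd r (ends (\<phi> g ` D))"
        using D(2) aut_ends[OF f] aut_nbhd[OF f ends_subset] by simp
      moreover have "\<phi> g ` D \<in> X" using g'(2) D(1) by blast
      ultimately show ?thesis by (auto simp: block_def)
    qed
  qed
  show ?thesis
  proof
    show "\<phi> g ` block r X \<subseteq> block r X" by (rule sub[OF g])
    have gG: "g \<in> carrier G" using cls_stabD[OF X g] by blast
    have "inv g \<in> cls_stab X" by (rule subgroup.m_inv_closed[OF subgroup_cls_stab[OF X] g])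
    then have "\<phi> g ` \<phi> (inv g) ` block r X \<subseteq> \<phi> g ` block r X" using sub by blast
    then show "block r X \<subseteq> \<phi> g ` block r X"
      using aut_image_inv[OF aut_sym[OF act_aut[OF gG]] block_subset[OF X]] by simp
  qed
qed

text \<open>Representatives are chosen inside \<open>\<Inter>X\<close> and inside \<open>X\<close>.
  An element of \<open>G\<close> leading to them then stabilizes \<open>X\<close>, by
  \<open>block_unique\<close> in the first case and because it maps a member of \<open>X\<close> to
  a member in the second.\<close>

lemma block_cofinite:
  assumes X: "X \<in> Opt // R"
  shows "\<exists>Q. finite Q \<and> Q \<subseteq> block r X \<and> (\<forall>x\<in>block r X. \<exists>g\<in>cls_stab X. \<phi> g x \<in> Q)"
proof -
  obtain Q0 where Q0: "finite Q0" "Q0 \<subseteq> V" "\<And>x. x \<in> V \<Longrightarrow> \<exists>g\<in>carrier G. \<phi> g x \<in> Q0"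
    by (rule finite_reps_V) blast
  obtain C where C: "C \<in> X" using X by (rule class_nonempty)
  have "\<Inter>X \<subseteq> V" using C classD(1)[OF X C] Opt_sub by blast
  then obtain Q1 where Q1: "finite Q1" "Q1 \<subseteq> \<Inter>X" "\<And>x. x \<in> \<Inter>X \<Longrightarrow> \<exists>g\<in>carrier G. \<phi> g x \<in> Q1"
    using group_action.finite_reps_subset[OF action Q0(1,3)] by meson
  obtain Q2 where Q2: "finite Q2" "Q2 \<subseteq> Opt" "\<And>C. C \<in> Opt \<Longrightarrow> \<exists>g\<in>carrier G. \<phi> g ` C \<in> Q2"
    by (rule finite_reps_Opt) blast
  interpret A: group_action G Opt "cut_act" by (rule action_Opt)
  have XO: "X \<subseteq> Opt" using classD(1)[OF X] by blast
  have "\<exists>g\<in>carrier G. cut_act g D \<in> Q2" if "D \<in> Opt" for D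
    using Q2(3)[OF that] that by (simp add: cut_action_def)
  then obtain Q3 where Q3: "finite Q3" "Q3 \<subseteq> X" "\<And>D. D \<in> X \<Longrightarrow> \<exists>g\<in>carrier G. cut_act g D \<in> Q3"
    using A.finite_reps_subset[OF Q2(1) _ XO] by meson
  let ?Q = "Q1 \<union> (\<Union>D\<in>Q3. nbhd r (ends D))"
  have "finite (nbhd r (ends D))" if "D \<in> Q3" for D
    using finite_nbhd[OF finite_ends[OF is_cutD(6)[OF opt_cut_is_cut]]] XO Q3(2) that by blast
  then have "finite ?Q" using Q1(1) Q3(1) by simp
  moreover have "?Q \<subseteq> block r X" using Q1(2) Q3(2) by (auto simp: block_def)
  moreover have "\<exists>g\<in>cls_stab X. \<phi> g x \<in> ?Q" if x: "x \<in> block r X" for x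
  proof (cases "x \<in> \<Inter>X")
    case True
    then obtain g where g: "g \<in> carrier G" "\<phi> g x \<in> Q1" using Q1(3) by blast
    define Y where "Y = cls_act g X"
    have Y: "Y \<in> Opt // R" unfolding Y_def
      by (rule group_action.element_image[OF action_classes g(1) X refl])
    have "\<phi> g x \<in> \<Inter>Y" using True class_action_image[OF g(1) X] by (auto simp: Y_def)
    then have "Y = X" using block_unique[OF Y X] g(2) Q1(2) by blast
    then have "g \<in> cls_stab X" using g by (simp add: stabilizer_def Y_def)
    with g show ?thesis by blast
  next
    case False
    then obtain D where D: "D \<in> X" "x \<in> nbhd r (ends D)" using x by (auto simp: block_def)
    then have DO: "D \<in> Opt" using XO by blast
    obtain g where g: "g \<in> carrier G" "\<phi> g ` D \<in> Q3"
      using Q3(3)[OF D(1)] DO by (auto simp: cut_action_def)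
    note f = act_aut[OF g(1)]
    have "D \<subseteq> V" using D XO Opt_sub by blast
    then have "\<phi> g x \<in> nbhd r (ends (\<phi> g ` D))"
      using D(2) aut_ends[OF f] aut_nbhd[OF f ends_subset] by simp
    moreover have "g \<in> cls_stab X" by (rule cls_stabI[OF X g(1) D(1)]) (use g Q3 in blast)
    ultimately show ?thesis using g(2) by (intro bexI[of _ g]) auto
  qed
  ultimately show ?thesis by (intro exI[of _ ?Q]) blast
qed

text \<open>A path from \<open>y\<close> to \<open>S\<close> either stays outside \<open>D\<close>
  and arrives in \<open>S - D\<close>, or first enters \<open>D\<close> across its boundary; both
  times it meets \<open>ends D\<close> no later.\<close>

lemma nbhd_outside:
  assumes "y \<in> nbhd n S" "y \<notin> D" "S - D \<subseteq> ends D"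
  shows "y \<in> nbhd n (ends D)"
  using assms(1,2)
proof (induction n arbitrary: y)
  case 0
  with assms(3) show ?case by auto
next
  case (Suc n)
  show ?case
  proof (cases "y \<in> nbhd n S")
    case True
    with Suc show ?thesis by auto
  next
    case False
    with Suc.prems obtain z where z: "z \<in> nbhd n S" "(z, y) \<in> E" by auto
    show ?thesis
    proof (cases "z \<in> D")
      case True
      then have "y \<in> ends D" using in_ends[OF z(2)] Suc.prems by blast
      then show ?thesis using subset_nbhd by blast
    next
      case False
      with Suc.IH z show ?thesis by auto
    qed
  qed
qed

text \<open>The complement of another member \<open>D'\<close> lies in \<open>D\<close>, so ends of
  \<open>D'\<close> outside \<open>D\<close> are ends of \<open>D\<close> as well. Thus everything
  outside \<open>D\<close> lies in one thickened boundary.\<close>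

lemma finite_block_outside:
  assumes X: "X \<in> Opt // R" and D: "D \<in> X"
  shows "finite (block r X - D)"
proof -
  have "y \<in> nbhd r (ends D)" if y: "y \<in> block r X" "y \<notin> D" for y
  proof -
    obtain D' where D': "D' \<in> X" "y \<in> nbhd r (ends D')" using y D by (auto simp: block_def)
    show ?thesis
    proof (cases "D = D'")
      case False
      have "ends D' - D \<subseteq> ends D"
      proof
        fix e assume e: "e \<in> ends D' - D"
        then obtain w where w: "(e, w) \<in> bd E D' \<or> (w, e) \<in> bd E D'" by (auto simp: ends_def)
        have "e \<in> V" using e ends_subset by blast
        then have "e \<in> D'" using class_cover[OF X D'(1) D] False e by blast
        with w have ew: "(e, w) \<in> E" "w \<notin> D'" by (auto simp: bd_def)
        then have "w \<in> D" using class_cover[OF X D'(1) D] False E_sub by blast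
        then show "e \<in> ends D" using in_ends[OF E_sym[OF ew(1)]] e by blast
      qed
      then show ?thesis by (rule nbhd_outside[OF D'(2) y(2)])
    qed (use D' in simp)
  qed
  moreover have "finite (nbhd r (ends D))"
    using finite_nbhd finite_ends is_cutD(6) opt_cut_is_cut classD(1)[OF X D] by blast
  ultimately show ?thesis by (meson DiffE finite_subset subsetI)
qed

text \<open>Any splitting cut yields an optimal cut \<open>F\<close> splitting \<alpha>. A member of
  \<open>X\<close> lies on one side of \<open>F\<close>, so the other side contains only finitely
  many vertices of the block.\<close>

lemma no_splitting_in_block:
  assumes X: "X \<in> Opt // R" and \<alpha>: "bipath \<alpha>" "range \<alpha> \<subseteq> block r X"
    and C: "is_cut \<Gamma> C" "splits \<alpha> C"
  shows False
proof -
  let ?c = "\<lambda>C. card (bd E C)" and ?m = "crossings k"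
  obtain C1 where C1: "C1 \<in> Cmin \<alpha>"
    using ex_has_least_nat[of "\<lambda>C. is_cut \<Gamma> C \<and> splits \<alpha> C" C ?c] C unfolding min_cuts_iff by blast
  obtain F where F: "F \<in> Copt k \<alpha>"
    using ex_has_least_nat[of "\<lambda>C. C \<in> Cmin \<alpha>" C1 ?m] C1
    unfolding opt_cuts_splitting_iff by blast
  then have FO: "F \<in> Opt" using \<alpha> by (auto simp: opt_cuts_def)
  have sp: "infinite (range \<alpha> \<inter> F)" "infinite (range \<alpha> \<inter> (V - F))"
    using F by (auto simp: opt_cuts_splitting_iff min_cuts_iff splits_def)
  obtain D where D: "D \<in> X" "D \<subseteq> F \<or> D \<subseteq> V - F" using edge_towards[OF X FO] by blast
  have "finite (block r X - D)" by (rule finite_block_outside[OF X D(1)])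
  moreover have "range \<alpha> \<inter> F \<subseteq> block r X - D \<or> range \<alpha> \<inter> (V - F) \<subseteq> block r X - D"
    using D(2) \<alpha>(2) by blast
  ultimately show False using sp finite_subset by blast
qed

abbreviation block_edges :: "nat \<Rightarrow> 'v set set \<Rightarrow> 'v rel" where
  "block_edges r X \<equiv> E \<inter> block r X \<times> block r X"

text \<open>Modulo the stabilizer of \<open>X\<close>, one of the two ends lies in a finite set, and
  only finitely many \<open>K\<close>-cuts have a given vertex as an end. Lengths are measured
  inside the block, where the stabilizer preserves them.\<close>

lemma block_cut_diameter:
  assumes X: "X \<in> Opt // R" and r: "conn E (block r X)"
  obtains M where "\<And>D x y. kcut K D \<Longrightarrow> x \<in> ends D \<inter> block r X \<Longrightarrow> y \<in> ends D \<inter> block r X \<Longrightarrow>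
    \<exists>m\<le>M. (x, y) \<in> block_edges r X ^^ m"
    and "\<And>g x y m. g \<in> cls_stab X \<Longrightarrow> x \<in> block r X \<Longrightarrow> y \<in> block r X \<Longrightarrow>
      (\<phi> g x, \<phi> g y) \<in> block_edges r X ^^ m \<longleftrightarrow> (x, y) \<in> block_edges r X ^^ m"
proof -
  define B where "B = block r X"
  define A where "A = E \<inter> B \<times> B"
  have BV: "B \<subseteq> V" using block_subset[OF X] by (simp add: B_def)
  have moveA: "(\<phi> g x, \<phi> g y) \<in> A ^^ m" if g: "g \<in> cls_stab X" and "(x, y) \<in> A ^^ m" for g x y m
    using that(2)
  proof (induction m arbitrary: y)
    case (Suc m)
    then obtain z where z: "(x, z) \<in> A ^^ m" "(z, y) \<in> A" by auto
    have "\<phi> g z \<in> B" "\<phi> g y \<in> B" using z(2) block_invariant[OF X g, of r] by (auto simp: A_def B_def)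
    then have "(\<phi> g z, \<phi> g y) \<in> A" using z(2) act_edge cls_stabD(1)[OF X g] by (auto simp: A_def)
    with Suc.IH[OF z(1)] show ?case by (rule relpow_Suc_I)
  qed simp
  have moveA_iff: "(\<phi> g x, \<phi> g y) \<in> A ^^ m \<longleftrightarrow> (x, y) \<in> A ^^ m"
    if g: "g \<in> cls_stab X" and xy: "x \<in> B" "y \<in> B" for g x y m
  proof
    assume "(\<phi> g x, \<phi> g y) \<in> A ^^ m"
    then have "(\<phi> (inv g) (\<phi> g x), \<phi> (inv g) (\<phi> g y)) \<in> A ^^ m"
      by (rule moveA[OF subgroup.m_inv_closed[OF subgroup_cls_stab[OF X] g]])
    then show "(x, y) \<in> A ^^ m" using act_inv[OF cls_stabD(1)[OF X g]] xy BV by (metis subsetD)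
  qed (rule moveA[OF g])
  obtain Q where Q: "finite Q" "Q \<subseteq> B" "\<And>x. x \<in> B \<Longrightarrow> \<exists>g\<in>cls_stab X. \<phi> g x \<in> Q"
    using block_cofinite[OF X, of r] unfolding B_def by blast
  define P where "P = (\<Union>x\<in>Q. \<Union>w\<in>E `` {x}. \<Union>D\<in>{D. kcut K D \<and> ((x, w) \<in> bd E D \<or> (w, x) \<in> bd E D)}. {x} \<times> (ends D \<inter> B))"
  have "finite {D. kcut K D \<and> ((x, w) \<in> bd E D \<or> (w, x) \<in> bd E D)}" for x w
    using finite_k_cuts_through[of K x w] finite_k_cuts_through[of K w x]
    by (auto simp: conj_disj_distribL)
  moreover have "finite (ends D)" if "kcut K D" for D
    using that finite_ends is_cutD(6) by (auto simp: is_k_cut_def)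
  ultimately have finP: "finite P" unfolding P_def using Q(1) finite_nbrs
    by (intro finite_UN_I finite_cartesian_product) auto
  \<comment> \<open>Any length will do, since only an upper bound over the finite set
    \<open>P\<close> is required.\<close>
  define len where "len p = (SOME m. p \<in> A ^^ m)" for p
  have len: "p \<in> A ^^ len p" if "p \<in> B \<times> B" for p
  proof -
    have "p \<in> A\<^sup>*" using r that by (auto simp: conn_def A_def B_def)
    then have "\<exists>m. p \<in> A ^^ m" by (cases p) (simp add: rtrancl_power)
    then show ?thesis unfolding len_def by (rule someI_ex)
  qed
  define M where "M = Max (insert 0 (len ` P))"
  have bound: "\<exists>m\<le>M. (x, y) \<in> A ^^ m" if D: "kcut K D" and x: "x \<in> ends D \<inter> B" and y: "y \<in> ends D \<inter> B" for D x y
  proof -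
    obtain g where g: "g \<in> cls_stab X" "\<phi> g x \<in> Q" using Q(3) x by blast
    have gG: "g \<in> carrier G" using cls_stabD(1)[OF X g(1)] .
    note f = act_aut[OF gG]
    have DV: "D \<subseteq> V" using D is_cutD by (auto simp: is_k_cut_def)
    have D': "kcut K (\<phi> g ` D)" using aut_is_k_cut[OF f D] .
    have e: "\<phi> g x \<in> ends (\<phi> g ` D)" "\<phi> g y \<in> ends (\<phi> g ` D)" using x y aut_ends[OF f DV] by auto
    have yB: "\<phi> g y \<in> B" using y block_invariant[OF X g(1), of r] by (auto simp: B_def)
    obtain w where w: "(\<phi> g x, w) \<in> bd E (\<phi> g ` D) \<or> (w, \<phi> g x) \<in> bd E (\<phi> g ` D)"
      using e(1) by (auto simp: ends_def)
    then have "w \<in> E `` {\<phi> g x}" using E_sym by (auto simp: bd_def)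
    then have inP: "(\<phi> g x, \<phi> g y) \<in> P" using g(2) D' w e(2) yB unfolding P_def by blast
    have "len (\<phi> g x, \<phi> g y) \<le> M" unfolding M_def using inP finP by simp
    moreover have "(\<phi> g x, \<phi> g y) \<in> A ^^ len (\<phi> g x, \<phi> g y)" using len g(2) Q(2) yB by blast
    ultimately show ?thesis using moveA_iff[OF g(1)] x y by blast
  qed
  show thesis by (rule that[OF bound[unfolded A_def B_def] moveA_iff[unfolded A_def B_def]])
qed

text \<open>An infinite block contains a bi-infinite geodesic. A cut of bounded size that has a large ball
  around some vertex of the geodesic on one side and a tail of it on the other splits the geodesic,
  since otherwise the geodesic would cross its boundary at two places far apart. But no cut splits
  a path in a block.\<close>

theorem finite_block:
  assumes X: "X \<in> Opt // R" and r: "\<And>C. C \<in> Opt \<Longrightarrow> conn E (nbhd r (ends C))"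
    and sep: "rays_separated V E K"
  shows "finite (block r X)"
proof (rule ccontr)
  define B where "B = block r X"
  define A where "A = E \<inter> B \<times> B"
  assume "infinite (block r X)"
  then have inf: "infinite B" by (simp add: B_def)
  have conB: "conn E B" unfolding B_def using X r by (rule conn_block)
  obtain M where M: "\<And>D x y. kcut K D \<Longrightarrow> x \<in> ends D \<inter> B \<Longrightarrow> y \<in> ends D \<inter> B \<Longrightarrow> \<exists>m\<le>M. (x, y) \<in> A ^^ m"
    and moveA: "\<And>g x y m. g \<in> cls_stab X \<Longrightarrow> x \<in> B \<Longrightarrow> y \<in> B \<Longrightarrow>
      (\<phi> g x, \<phi> g y) \<in> A ^^ m \<longleftrightarrow> (x, y) \<in> A ^^ m"
    using block_cut_diameter[OF X conB[unfolded B_def], of K] unfolding A_def B_def by metis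
  obtain Q where Q: "finite Q" "Q \<subseteq> B" "\<And>x. x \<in> B \<Longrightarrow> \<exists>g\<in>cls_stab X. \<phi> g x \<in> Q"
    using block_cofinite[OF X, of r] unfolding B_def by blast
  have "\<exists>p :: int \<Rightarrow> 'v. (\<forall>i. (p i, p (i + 1)) \<in> A) \<and> (\<forall>i j m. i \<le> j \<and> (p i, p j) \<in> A ^^ m \<longrightarrow> j - i \<le> int m)"
  proof (rule biinfinite_geodesic[of A B Q "\<phi> ` cls_stab X"])
    show "finite (A `` {x})" for x using finite_nbrs[of x] by (rule rev_finite_subset) (auto simp: A_def)
    show "sym A" unfolding A_def by (rule sym_Restr[OF sym_E])
    show "(x, y) \<in> A\<^sup>*" if "x \<in> B" "y \<in> B" for x y using conB that by (auto simp: conn_def A_def)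
    show "\<exists>h\<in>\<phi> ` cls_stab X. h x \<in> Q" if "x \<in> B" for x using Q(3)[OF that] by blast
    show "(h x, h y) \<in> A ^^ m \<longleftrightarrow> (x, y) \<in> A ^^ m" if "h \<in> \<phi> ` cls_stab X" "x \<in> B" "y \<in> B" for h x y m
      using that moveA by blast
  qed (use inf Q(1) in \<open>auto simp: A_def\<close>)
  then obtain p :: "int \<Rightarrow> 'v" where p: "\<And>i. (p i, p (i + 1)) \<in> A"
    and geo: "\<And>i j m. i \<le> j \<Longrightarrow> (p i, p j) \<in> A ^^ m \<Longrightarrow> j - i \<le> int m" by blast
  have pB: "p i \<in> B" for i using p[of i] by (simp add: A_def)
  have "p i \<noteq> p j" if "i < j" for i j using geo[of i j 0] that by auto
  then have "inj p" by (metis injI linorder_neqE_linordered_idom)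
  then have \<alpha>: "bipath p" using p by (simp add: biinfinite_path_def A_def)
  have p0: "p 0 \<in> V" using biinfinite_in_V[OF \<alpha>] .
  obtain D n where D: "cut V E D" "card (bd E D) \<le> K" "nbhd M {p 0} \<subseteq> D"
    and n: "\<forall>i\<ge>n. fwd p i \<in> V - D"
    using ray_cut_from_ball[OF sep ray_fwd[OF \<alpha>] p0] by metis
  have kD: "kcut K D" using D by (simp add: is_k_cut_def is_cut_iff boundary_eq)
  then have cD: "is_cut \<Gamma> D" by (simp add: is_k_cut_def)
  \<comment> \<open>The first \<open>M\<close> steps stay in the ball and hence in \<open>D\<close>,
    so the first vertex outside \<open>D\<close> comes later than step \<open>M\<close>; it is an
    end of \<open>D\<close>.\<close>
  have exit: "\<exists>l>M. \<beta> l \<in> ends D" if ray: "\<And>i. (\<beta> i, \<beta> (Suc i)) \<in> E" "\<beta> 0 = p 0" and out: "\<beta> n' \<notin> D" for \<beta> and n' :: nat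
  proof -
    define l where "l = (LEAST l. \<beta> l \<notin> D)"
    have l: "\<beta> l \<notin> D" unfolding l_def using out by (rule LeastI)
    have in_nb: "\<beta> i \<in> nbhd i {p 0}" for i
      by (induction i) (use ray in auto)
    have "M < l"
    proof (rule ccontr)
      assume "\<not> M < l"
      then have "\<beta> l \<in> nbhd M {p 0}" using in_nb[of l] nbhd_mono[of l M "{p 0}"] by auto
      with l D(3) show False by blast
    qed
    moreover then obtain l' where l': "l = Suc l'" by (cases l) auto
    then have "\<beta> l' \<in> D" unfolding l_def using not_less_Least[of l' "\<lambda>l. \<beta> l \<notin> D"] l_def by auto
    then have "\<beta> l \<in> ends D" using in_ends[OF ray(1)[of l']] l l' by blast
    ultimately show ?thesis by blast
  qed
  have "tail_in (bwd p) D \<or> tail_in (bwd p) (V - D)" using tail_bwd[OF \<alpha> is_cutD(6)[OF cD]] .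
  then show False
  proof
    assume "tail_in (bwd p) D"
    moreover have "tail_in (fwd p) (V - D)" using n by (auto simp: tail_in_def)
    ultimately have "splits p D"
      by (intro splits_if_tails[OF \<alpha> is_cutD(6)[OF cD] is_cutD(1)[OF cD], of "V - D"]) auto
    moreover have "range p \<subseteq> block r X" using pB by (auto simp: B_def)
    ultimately show False using no_splitting_in_block[OF X \<alpha>] cD by blast
  next
    assume "tail_in (bwd p) (V - D)"
    then obtain n' where "bwd p n' \<notin> D" by (auto simp: tail_in_def)
    then obtain l' where l': "l' > M" "bwd p l' \<in> ends D"
      using exit[of "bwd p", OF ray_bwd(2)[OF \<alpha>]] by (auto simp: bwd_def)
    have "fwd p n \<notin> D" using n by blast
    then obtain l where l: "l > M" "fwd p l \<in> ends D"
      using exit[of "fwd p", OF ray_fwd(2)[OF \<alpha>]] by (auto simp: fwd_def)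
    \<comment> \<open>These two ends are \<open>l + l'\<close> apart on the geodesic, more than
      \<open>2 * M\<close>, while \<open>M\<close> bounds their distance in the block.\<close>
    obtain m where "m \<le> M" "(bwd p l', fwd p l) \<in> A ^^ m"
      using M[OF kD, of "bwd p l'" "fwd p l"] l l' pB by (auto simp: fwd_def bwd_def)
    then have "int l - (- int l') \<le> int m" using geo[of "- int l'" "int l" m] by (simp add: fwd_def bwd_def)
    with \<open>m \<le> M\<close> l l' show False by linarith
  qed
qed

lemma virtually_class_stabilizer:
  assumes cl: "closed_under_finite_index_normal \<G>"
    and st: "\<And>v. v \<in> V \<Longrightarrow> G\<lparr>carrier := stabilizer G \<phi> v\<rparr> \<in> \<G>"
    and sep: "rays_separated V E K" and X: "X \<in> Opt // R"
  shows "virtually \<G> (G\<lparr>carrier := cls_stab X\<rparr>)"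
proof -
  obtain r where r: "\<And>C. C \<in> Opt \<Longrightarrow> conn E (nbhd r (ends C))" by (rule connecting_radius) blast
  obtain C where C: "C \<in> X" using X by (rule class_nonempty)
  show ?thesis
  proof (rule virtually_setwise_stabilizer[OF cl st subgroup_cls_stab[OF X] classD(1)[OF X C]])
    show "finite (block r X)" using X r sep by (rule finite_block)
    show "ends C \<subseteq> block r X" using C subset_nbhd by (fastforce simp: block_def)
    show "\<phi> g ` block r X = block r X" if "g \<in> cls_stab X" for g using block_invariant[OF X that] .
    show "g \<in> cls_stab X" if "g \<in> carrier G" "\<phi> g ` C = C" for g
      using cls_stabI[OF X that(1) C] that(2) C by simp
  qed
qed

end

section \<open>Groups acting on graphs of finite treewidth\<close>

lemma acts_on_simple_graphD:
  assumes "acts_on_simple_graph G \<Gamma> \<phi>"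
  shows "group_action G (pverts \<Gamma>) \<phi>"
    and "g \<in> carrier G \<Longrightarrow> (u, v) \<in> parcs \<Gamma> \<Longrightarrow> (\<phi> g u, \<phi> g v) \<in> parcs \<Gamma>"
proof -
  have A: "group_action G (pverts \<Gamma>) \<phi>" "group_action G (parcs \<Gamma>) (induced_arc_action \<Gamma> \<phi>)"
    using assms by (auto simp: acts_on_simple_graph_def acts_on_graph_def)
  show "group_action G (pverts \<Gamma>) \<phi>" by (rule A(1))
  assume "g \<in> carrier G" "(u, v) \<in> parcs \<Gamma>"
  then have "induced_arc_action \<Gamma> \<phi> g (u, v) \<in> parcs \<Gamma>"
    by (rule group_action.element_image[OF A(2)]) simp
  with \<open>(u, v) \<in> parcs \<Gamma>\<close> show "(\<phi> g u, \<phi> g v) \<in> parcs \<Gamma>" by (simp add: induced_arc_action_def)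
qed

lemma (in lf_graph) bounded_degree:
  assumes act: "group_action G V \<phi>"
    and edge: "\<And>g u v. g \<in> carrier G \<Longrightarrow> (u, v) \<in> E \<Longrightarrow> (\<phi> g u, \<phi> g v) \<in> E"
    and fin: "finite (orbits G V \<phi>)"
  shows "\<exists>d. \<forall>v\<in>V. card (E `` {v}) \<le> d"
proof -
  interpret group_action G V \<phi> by (rule act)
  obtain Q where Q: "finite Q" "\<And>x. x \<in> V \<Longrightarrow> \<exists>g\<in>carrier G. \<phi> g x \<in> Q"
    using finite_orbitsE[OF fin] by metis
  define d where "d = Max (insert 0 ((\<lambda>q. card (E `` {q})) ` Q))"
  have "card (E `` {v}) \<le> d" if v: "v \<in> V" for v
  proof -
    obtain g where g: "g \<in> carrier G" "\<phi> g v \<in> Q" using Q(2)[OF v] by blast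
    have "inj_on (\<phi> g) (E `` {v})" using inj_prop[OF g(1)] by (rule inj_on_subset) (use E_sub in auto)
    moreover have "\<phi> g ` (E `` {v}) \<subseteq> E `` {\<phi> g v}" using edge[OF g(1)] by auto
    ultimately have "card (E `` {v}) \<le> card (E `` {\<phi> g v})" using finite_nbrs by (rule card_inj_on_le)
    also have "\<dots> \<le> d" unfolding d_def using Q(1) g(2) by simp
    finally show ?thesis .
  qed
  then show ?thesis by blast
qed

theorem theorem5p9:
  fixes \<G> :: "'g monoid set"
    and G :: "'g monoid"
    and \<Gamma> :: "'v pair_pre_digraph"
    and \<phi> :: "'g \<Rightarrow> 'v \<Rightarrow> 'v"
  assumes "\<forall>H\<in>\<G>. group H"
    and "closed_under_finite_index_normal \<G>"
    and "pair_bidirected_digraph \<Gamma>"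
    and "connected_graph (with_proj \<Gamma>)"
    and "locally_finite (with_proj \<Gamma>)"
    and "finite_treewidth TYPE('t) \<Gamma>"
    and "group G"
    and "acts_on_simple_graph G \<Gamma> \<phi>"
    and "finite_quotient G (with_proj \<Gamma>) \<phi> (induced_arc_action \<Gamma> \<phi>)"
    and "\<forall>v\<in>pverts \<Gamma>. G\<lparr>carrier := stabilizer G \<phi> v\<rparr> \<in> \<G>"
  shows "accessible \<Gamma> \<and>
    (\<forall>k. accessible_bound \<Gamma> k \<longrightarrow>
      (let T = structure_tree \<Gamma> k;
           rev = structure_tree_rev \<Gamma> k;
           \<Phi> = cut_class_action \<Gamma> k \<phi>;
           \<Psi> = cut_action \<Gamma> k \<phi>
       in undirected_tree T rev \<and>
          acts_on_graph G T rev \<Phi> \<Psi> \<and>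
          (\<forall>g\<in>carrier G. \<forall>C\<in>opt_cuts \<Gamma> k. \<Phi> g (cut_class \<Gamma> k C) = cut_class \<Gamma> k (\<phi> g ` C)) \<and>
          (\<forall>x\<in>verts T. virtually \<G> (G\<lparr>carrier := stabilizer G \<Phi> x\<rparr>)) \<and>
          (\<forall>e\<in>arcs T. virtually \<G> (G\<lparr>carrier := stabilizer G \<Psi> e\<rparr>) \<and>
             virtually \<G> (G\<lparr>carrier := stabilizer G (\<lambda>g. image (\<Psi> g)) {e, rev e}\<rparr>)) \<and>
          finite_quotient G T \<Phi> \<Psi>))"
proof -
  interpret lf_graph \<Gamma> using assms(3-5) by (rule lf_graph.intro)
  note act = acts_on_simple_graphD[OF assms(8)]
  have orb: "finite (orbits G V \<phi>)" using assms(9) by (simp add: finite_quotient_def)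
  obtain d where d: "\<forall>v\<in>V. card (E `` {v}) \<le> d" using bounded_degree[OF act orb] by blast
  obtain K where K: "rays_separated V E K"
    using finite_treewidth_separates[OF assms(6) sym_E E_sub conn_V] finite_nbrs d by blast
  show ?thesis
  proof (intro conjI allI impI, goal_cases)
    case 1
    show ?case using accessible_if_rays_separated[OF K] by (auto simp: accessible_def)
  next
    \<comment> \<open>\<open>k\<close> is an arbitrary accessibility bound; the blocks are still
      treated with the constant \<open>K\<close> obtained from the tree decomposition.\<close>
    case (2 k)
    then interpret acting \<Gamma> k G \<phi>
      using act orb assms(7) lf_graph_axioms
      by (auto simp: acting_def acting_axioms_def opt_graph_def opt_graph_axioms_def)
    have st: "\<And>v. v \<in> V \<Longrightarrow> G\<lparr>carrier := stabilizer G \<phi> v\<rparr> \<in> \<G>" using assms(10) by blast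
    show ?case
      unfolding Let_def finite_quotient_def T_simps
      using tree_T acts_on_T class_action_cls virtually_class_stabilizer[OF assms(2) st K]
        virtually_cut_stabilizer[OF assms(2) st] finite_orbits_Opt finite_orbits_classes
      by simp
  qed
qed

end
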